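(* Let $N\ge 3$ be an integer and let $\lambda\in\mathbb{R}$ with $\lambda\neq \frac N2$. If $N\neq 4$, assume in addition that $\lambda\neq\lambda_n$ for every integer $n\ge 1$, where $\lambda_n:=\frac{(2n+N-2)^2-4}{2(N-4)}$. Then there is a constant $C(\lambda,N)>0$ such that $$\int_{\mathbb{R}^N}\left|-\Delta v+\lambda\frac{x\cdot\nabla v}{|x|^2}\right|^2dx\ \ge\ C(\lambda,N)\int_{\mathbb{R}^N}\frac{|x\cdot\nabla v|^2}{|x|^4}\,dx\qquad\text{for all } v\in C_c^\infty(\mathbb{R}^N).$$ The constant is explicitly given as follows: - if $N=4$: $C(\lambda,4)=(2-\lambda)^2$; - if $N=3$ and $\lambda\ge-\frac12$: $C(\lambda,3)=\left(\lambda-\frac32\right)^2$; - if $N=3$ and $\lambda<-\frac12$: $$C(\lambda,3)=\min\left\{\left(\lambda-\tfrac32\right)^2,\ 4\min_{1\le k\le k_0(3,\lambda)}\left[k(k+1)+\tfrac12\left(\lambda-\tfrac32\right)\right]^2\right\};$$ - if $N>4$ and $\lambda\le\frac{N^2-2N-2}{2(N-4)}$: $C(\lambda,N)=\left(\frac N2-\lambda\right)^2$; - if $N>4$ and $\lambda>\frac{N^2-2N-2}{2(N-4)}$: $$C(\lambda,N)=\min\left\{\left(\tfrac N2-\lambda\right)^2,\ \left(\tfrac{2}{N-4}\right)^2\min_{1\le k\le k_0(N,\lambda)}\left[k(k+N-2)+\tfrac{N-4}{2}\left(\tfrac N2-\lambda\right)\right]^2\right\}.$$ Here the inner minima run over integers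 $k$, and $k_0(N,\lambda)$ is the integer defined in the context.
   Context: For $N$ and $\lambda$ as in the cases where it is used, put $\kappa(N,\lambda):=\frac{-N+\sqrt{4\lambda(N-4)-N^2+4N+4}}{2}$. Define $k_0(N,\lambda):=\kappa(N,\lambda)$ if $\kappa(N,\lambda)\in\mathbb{N}$, and $k_0(N,\lambda):=[\kappa(N,\lambda)]+1$ otherwise, where $[\cdot]$ denotes the integer part. *)

theory Defs
  imports "HOL-Analysis.Analysis"
begin

definition partial_deriv :: "'n::finite \<Rightarrow> (real^'n \<Rightarrow> real) \<Rightarrow> real^'n \<Rightarrow> real" where
  "partial_deriv i v x = frechet_derivative v (at x) (axis i 1)"

definition grad :: "(real^'n \<Rightarrow> real) \<Rightarrow> real^'n \<Rightarrow> real^'n" where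
  "grad v x = (\<chi> i. partial_deriv i v x)"

definition laplacian :: "(real^'n \<Rightarrow> real) \<Rightarrow> real^'n \<Rightarrow> real" where
  "laplacian v x = (\<Sum>i\<in>UNIV. partial_deriv i (partial_deriv i v) x)"

text \<open>The predicate \<open>C_k k v\<close> says that \<open>v\<close> is of class \<open>C^k\<close> on the whole space.
  \<open>frechet_derivative\<close> is unspecified where \<open>v\<close> is not differentiable, so differentiability
  is demanded at every level of the recursion.\<close>

fun C_k :: "nat \<Rightarrow> (real^'n \<Rightarrow> real) \<Rightarrow> bool" where
  "C_k 0 v \<longleftrightarrow> continuous_on UNIV v"
| "C_k (Suc k) v \<longleftrightarrow> (\<forall>x. v differentiable (at x)) \<and> (\<forall>i. C_k k (partial_deriv i v))"

definition test_functions :: "(real^'n \<Rightarrow> real) set" where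
  "test_functions = {v. (\<forall>k. C_k k v) \<and> compact (closure (support_on UNIV v))}"

text \<open>The dimension \<open>N\<close> is cast to \<open>real\<close> before subtracting, since \<open>N - 4\<close> is
  negative for \<open>N = 3\<close>.\<close>

definition lam_exc :: "nat \<Rightarrow> nat \<Rightarrow> real" where
  "lam_exc N n = ((2 * real n + real N - 2)\<^sup>2 - 4) / (2 * (real N - 4))"

definition kappa :: "nat \<Rightarrow> real \<Rightarrow> real" where
  "kappa N lam =
    (- real N + sqrt (4 * lam * (real N - 4) - (real N)\<^sup>2 + 4 * real N + 4)) / 2"

definition k0 :: "nat \<Rightarrow> real \<Rightarrow> int" where
  "k0 N lam = (if kappa N lam \<in> \<nat> then \<lfloor>kappa N lam\<rfloor> else \<lfloor>kappa N lam\<rfloor> + 1)"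

text \<open>Meant for \<open>N \<ge> 3\<close>. Wherever an inner minimum is taken, \<open>kappa N lam > 0\<close>, so that the
  radicand in \<open>kappa\<close> is positive and \<open>{1..k0 N lam}\<close> is nonempty.\<close>

definition hardy_rellich_const :: "real \<Rightarrow> nat \<Rightarrow> real" where
  "hardy_rellich_const lam N =
    (if N = 4 then (2 - lam)\<^sup>2
     else if N = 3 then
       (if lam \<ge> - 1/2 then (lam - 3/2)\<^sup>2
        else min ((lam - 3/2)\<^sup>2)
               (4 * (MIN k\<in>{1..k0 3 lam}.
                       (of_int (k * (k + 1)) + 1/2 * (lam - 3/2))\<^sup>2)))
     else
       (if lam \<le> ((real N)\<^sup>2 - 2 * real N - 2) / (2 * (real N - 4))
        then (real N / 2 - lam)\<^sup>2
        else min ((real N / 2 - lam)\<^sup>2)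
               ((2 / (real N - 4))\<^sup>2 * (MIN k\<in>{1..k0 N lam}.
                  (of_int (k * (k + int N - 2)) + (real N - 4) / 2 * (real N / 2 - lam))\<^sup>2))))"

lemma kappa_pos:
  assumes "N = 3 \<and> lam < - 1/2 \<or>
           N > 4 \<and> lam > ((real N)\<^sup>2 - 2 * real N - 2) / (2 * (real N - 4))"
  shows "kappa N lam > 0"
proof -
  have "4 * lam * (real N - 4) - (real N)\<^sup>2 + 4 * real N + 4 > (real N)\<^sup>2"
    using assms
  proof
    assume "N = 3 \<and> lam < - 1/2"
    then show ?thesis by (simp add: power2_eq_square)
  next
    assume h: "N > 4 \<and> lam > ((real N)\<^sup>2 - 2 * real N - 2) / (2 * (real N - 4))"
    then have "0 < 2 * (real N - 4)" by simp
    with h have "(real N)\<^sup>2 - 2 * real N - 2 < lam * (2 * (real N - 4))"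
      using pos_divide_less_eq by blast
    then show ?thesis by (simp add: algebra_simps)
  qed
  then have "sqrt (4 * lam * (real N - 4) - (real N)\<^sup>2 + 4 * real N + 4) > real N"
    by (rule real_less_rsqrt)
  then show ?thesis by (simp add: kappa_def)
qed

lemma k0_ge_1: "kappa N lam > 0 \<Longrightarrow> k0 N lam \<ge> 1"
  by (auto simp: k0_def Nats_def)

end

theory Submission
  imports Defs
begin

text \<open>
  Write \<open>E = x \<cdot> \<nabla>\<close>, \<open>L\<^sub>i\<^sub>j = x\<^sub>i \<partial>\<^sub>j - x\<^sub>j \<partial>\<^sub>i\<close> and \<open>L = - 1/2 \<Sum> L\<^sub>i\<^sub>j\<^sup>2\<close>, so that
  \<open>|x|\<^sup>2 \<Delta> = E\<^sup>2 + (N - 2) E - L\<close>, and let \<open>\<parallel>\<cdot>\<parallel>\<close> be the norm with weight \<open>|x|\<^sup>-\<^sup>4\<close>. There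
  \<open>E + E\<^sup>* = 4 - N = 2 a\<close>, the \<open>L\<^sub>i\<^sub>j\<close> are antisymmetric and commute with \<open>E\<close>, and
  \<open>\<parallel>E u\<parallel> \<ge> |a| \<parallel>u\<parallel>\<close>. With \<open>A = \<lambda> - N / 2\<close>, expanding the square gives
  \<open>\<parallel>|x|\<^sup>2 (- \<Delta> v + \<lambda> E v / |x|\<^sup>2)\<parallel>\<^sup>2 \<ge> A\<^sup>2 \<parallel>E v\<parallel>\<^sup>2 + 2 a A \<langle>v, L v\<rangle> + \<parallel>L v\<parallel>\<^sup>2\<close>. For \<open>C \<le> A\<^sup>2\<close> the right-hand
  side minus \<open>C \<parallel>E v\<parallel>\<^sup>2\<close> is at least \<open>\<parallel>(L + a A) v\<parallel>\<^sup>2 - C a\<^sup>2 \<parallel>v\<parallel>\<^sup>2\<close>, which is nonnegative as soon as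
  \<open>C a\<^sup>2 \<le> (c\<^sub>k + a A)\<^sup>2\<close> for all eigenvalues \<open>c\<^sub>k = k (k + N - 2)\<close> of \<open>L\<close>; the constant of the theorem
  is the largest such \<open>C\<close>. The spectral bound needs neither surface measure nor completeness
  of spherical harmonics: it is tested against polynomials, which split into
  eigenfunctions because \<open>(c\<^sub>n - L) p = |x|\<^sup>2 \<Delta> p\<close> for \<open>p\<close> homogeneous of degree \<open>n\<close>. For \<open>N = 3\<close>
  the norm \<open>\<parallel>v\<parallel>\<close> is infinite unless \<open>v(0) = 0\<close>, and \<open>v - v(0)\<close> takes the place of \<open>v\<close>.
\<close>

section \<open>Calculus of smooth functions\<close>

text \<open>The obstacle is v itself: \<open>|v|^2 |x|^-4\<close> need not be integrable, and the
  polynomials used in the spectral bound have no bounded support. Both the spectral bound and the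
  Hardy bound for v are therefore proved for truncated C^1 radial weights approximating
  \<open>|x|^-4\<close>. Only their combination, from which the norm of v has been eliminated, is
  passed to the limit. What survives are \<open>E v\<close>, \<open>L v\<close> and
  \<open>rot i j v\<close>; these vanish at the origin, so their products are
  O(\<open>|x|^2\<close>) there, which is integrable against \<open>|x|^-4\<close> because N >= 3.

  Origin of the constant: k = 0 gives \<open>C <= A^2\<close>. Since
  \<open>(c + p)^2 - p^2 = c (c + 2 p)\<close>, an eigenvalue with \<open>c_k + 2 a A >= 0\<close>
  adds no further condition. The larger root of \<open>k (k + N - 2) + 2 a A\<close> is
  \<open>kappa N lam + 1\<close>, so only k from 1 to \<open>k0 N lam\<close> can matter. The
  excluded values of lambda are the zeros of \<open>c_k + a A\<close>, at which the constant would
  be 0. In dimension 4, a = 0 and no eigenvalue enters.\<close>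

definition smooth :: "(real^'n \<Rightarrow> real) \<Rightarrow> bool" where
  "smooth f \<longleftrightarrow> (\<forall>k. C_k k f)"

lemma partial_deriv_eqI:
  "(f has_derivative D) (at x) \<Longrightarrow> partial_deriv i f x = D (axis i 1)"
  by (simp add: partial_deriv_def frechet_derivative_at[symmetric])

lemma has_derivative_partial_deriv:
  fixes f :: "real^'n \<Rightarrow> real"
  assumes "f differentiable (at x)"
  shows "(f has_derivative (\<lambda>h. \<Sum>i\<in>UNIV. h $ i * partial_deriv i f x)) (at x)"
proof -
  have D: "(f has_derivative frechet_derivative f (at x)) (at x)"
    using assms frechet_derivative_works by blast
  have lin: "linear (frechet_derivative f (at x))"
    using D has_derivative_linear by blast
  have "frechet_derivative f (at x) h = (\<Sum>i\<in>UNIV. h $ i * partial_deriv i f x)" for h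
  proof -
    have "frechet_derivative f (at x) h = frechet_derivative f (at x) (\<Sum>i\<in>UNIV. h $ i *\<^sub>R axis i 1)"
      by (simp add: basis_expansion flip: scalar_mult_eq_scaleR)
    also have "\<dots> = (\<Sum>i\<in>UNIV. h $ i * partial_deriv i f x)"
      by (simp add: linear_sum[OF lin] linear_scale[OF lin] partial_deriv_def)
    finally show ?thesis .
  qed
  then have "frechet_derivative f (at x) = (\<lambda>h. \<Sum>i\<in>UNIV. h $ i * partial_deriv i f x)"
    by blast
  with D show ?thesis by simp
qed

lemma partial_deriv_const [simp]: "partial_deriv i (\<lambda>x. c) = (\<lambda>x. 0)"
  by (rule ext, subst partial_deriv_eqI[OF has_derivative_const]) simp

lemma partial_deriv_coord [simp]: "partial_deriv i (\<lambda>x. x $ j) = (\<lambda>x. if i = j then 1 else 0)"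
proof (rule ext)
  fix x :: "real^'a"
  have "((\<lambda>x. x $ j) has_derivative (\<lambda>h. h $ j)) (at x)"
    by (intro bounded_linear.has_derivative[OF bounded_linear_vec_nth] has_derivative_ident)
  from partial_deriv_eqI[OF this] show "partial_deriv i (\<lambda>x. x $ j) x = (if i = j then 1 else 0)"
    by (simp add: axis_def)
qed

lemma partial_deriv_add:
  assumes "\<And>x. f differentiable (at x)" "\<And>x. g differentiable (at x)"
  shows "partial_deriv i (\<lambda>x. f x + g x) = (\<lambda>x. partial_deriv i f x + partial_deriv i g x)"
proof (rule ext)
  fix x
  have "(f has_derivative frechet_derivative f (at x)) (at x)"
    "(g has_derivative frechet_derivative g (at x)) (at x)"
    using assms frechet_derivative_works by blast+
  from has_derivative_add[OF this] show "partial_deriv i (\<lambda>x. f x + g x) x = partial_deriv i f x + partial_deriv i g x"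
    by (subst partial_deriv_eqI) (auto simp: partial_deriv_def)
qed

lemma partial_deriv_mult:
  assumes "\<And>x. f differentiable (at x)" "\<And>x. g differentiable (at x)"
  shows "partial_deriv i (\<lambda>x. f x * g x) = (\<lambda>x. f x * partial_deriv i g x + partial_deriv i f x * g x)"
proof (rule ext)
  fix x
  have "(f has_derivative frechet_derivative f (at x)) (at x)"
    "(g has_derivative frechet_derivative g (at x)) (at x)"
    using assms frechet_derivative_works by blast+
  from has_derivative_mult[OF this] show "partial_deriv i (\<lambda>x. f x * g x) x = f x * partial_deriv i g x + partial_deriv i f x * g x"
    by (subst partial_deriv_eqI) (auto simp: partial_deriv_def)
qed

lemma smooth_differentiable: "smooth f \<Longrightarrow> f differentiable (at x)"
  unfolding smooth_def using C_k.simps(2) by blast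

lemma smooth_continuous: "smooth f \<Longrightarrow> continuous_on S f"
  unfolding smooth_def using C_k.simps(1) continuous_on_subset by blast

lemma smooth_partial_deriv: "smooth f \<Longrightarrow> smooth (partial_deriv i f)"
  unfolding smooth_def using C_k.simps(2) by blast

text \<open>The Leibniz rule multiplies a derivative of one factor by the other factor itself, so in
  the induction for products a function of class \<open>Suc k\<close> must also be known to be of
  class k.\<close>

lemma C_k_antimono: "C_k (Suc k) f \<Longrightarrow> C_k k f"
proof (induction k arbitrary: f)
  case 0
  then show ?case
    by (simp add: differentiable_imp_continuous_within continuous_at_imp_continuous_on)
next
  case (Suc k)
  then have "\<forall>x. f differentiable (at x)" "\<And>i. C_k (Suc k) (partial_deriv i f)"
    by (metis C_k.simps(2))+
  with Suc.IH show ?case by simp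
qed

lemma C_k_const: "C_k k (\<lambda>x. c)"
  by (induction k arbitrary: c) auto

lemma C_k_add: "C_k k f \<Longrightarrow> C_k k g \<Longrightarrow> C_k k (\<lambda>x. f x + g x)"
  by (induction k arbitrary: f g) (auto intro: continuous_intros simp: partial_deriv_add)

lemma C_k_mult: "C_k k f \<Longrightarrow> C_k k g \<Longrightarrow> C_k k (\<lambda>x. f x * g x)"
proof (induction k arbitrary: f g)
  case 0
  then show ?case by (auto intro: continuous_intros)
next
  case (Suc k)
  have "C_k k f" "C_k k g" using Suc.prems C_k_antimono by blast+
  moreover have "\<forall>x. f differentiable (at x)" "\<forall>x. g differentiable (at x)"
    "\<And>i. C_k k (partial_deriv i f)" "\<And>i. C_k k (partial_deriv i g)"
    using Suc.prems by auto
  ultimately show ?case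
    using Suc.IH by (auto simp: partial_deriv_mult intro!: C_k_add)
qed

lemma smooth_const: "smooth (\<lambda>x. c)"
  by (simp add: smooth_def C_k_const)

lemma smooth_coord: "smooth (\<lambda>x. x $ i)"
proof -
  have "C_k k (\<lambda>x::real^'a. x $ i)" for k
    by (cases k) (auto intro!: continuous_intros C_k_const bounded_linear_imp_differentiable
        bounded_linear_vec_nth)
  then show ?thesis by (simp add: smooth_def)
qed

lemma smooth_add: "smooth f \<Longrightarrow> smooth g \<Longrightarrow> smooth (\<lambda>x. f x + g x)"
  by (simp add: smooth_def C_k_add)

lemma smooth_mult: "smooth f \<Longrightarrow> smooth g \<Longrightarrow> smooth (\<lambda>x. f x * g x)"
  by (simp add: smooth_def C_k_mult)

lemma smooth_cmult: "smooth f \<Longrightarrow> smooth (\<lambda>x. c * f x)"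
  by (rule smooth_mult[OF smooth_const])

lemma smooth_diff: "smooth f \<Longrightarrow> smooth g \<Longrightarrow> smooth (\<lambda>x. f x - g x)"
  using smooth_add[OF _ smooth_cmult[of g "-1"], of f] by simp

lemma smooth_sum: "(\<And>i. i \<in> I \<Longrightarrow> smooth (f i)) \<Longrightarrow> smooth (\<lambda>x. \<Sum>i\<in>I. f i x)"
proof (induction I rule: infinite_finite_induct)
  case (insert i I)
  then show ?case by (simp add: smooth_add)
qed (simp_all add: smooth_const)

lemma smooth_sq: "smooth f \<Longrightarrow> smooth (\<lambda>x. (f x)\<^sup>2)"
  unfolding power2_eq_square by (rule smooth_mult)

lemmas smooth_intros = smooth_const smooth_coord smooth_add smooth_mult smooth_diff smooth_sum
  smooth_partial_deriv smooth_sq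

lemma pd_add: "smooth f \<Longrightarrow> smooth g \<Longrightarrow>
    partial_deriv i (\<lambda>x. f x + g x) = (\<lambda>x. partial_deriv i f x + partial_deriv i g x)"
  by (simp add: partial_deriv_add smooth_differentiable)

lemma pd_mult: "smooth f \<Longrightarrow> smooth g \<Longrightarrow>
    partial_deriv i (\<lambda>x. f x * g x) = (\<lambda>x. f x * partial_deriv i g x + partial_deriv i f x * g x)"
  by (simp add: partial_deriv_mult smooth_differentiable)

lemma pd_cmult: "smooth f \<Longrightarrow> partial_deriv i (\<lambda>x. c * f x) = (\<lambda>x. c * partial_deriv i f x)"
  by (simp add: pd_mult smooth_const)

lemma pd_diff: "smooth f \<Longrightarrow> smooth g \<Longrightarrow>
    partial_deriv i (\<lambda>x. f x - g x) = (\<lambda>x. partial_deriv i f x - partial_deriv i g x)"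
  using pd_add[OF _ smooth_cmult[of g "-1"], of f] by (simp add: pd_cmult[of g _ "-1", simplified])

lemma pd_sum: "(\<And>j. j \<in> I \<Longrightarrow> smooth (f j)) \<Longrightarrow>
    partial_deriv i (\<lambda>x. \<Sum>j\<in>I. f j x) = (\<lambda>x. \<Sum>j\<in>I. partial_deriv i (f j) x)"
proof (induction I rule: infinite_finite_induct)
  case (insert j I)
  then show ?case by (simp add: pd_add smooth_sum)
qed simp_all

lemma norm2_eq_sum: "(norm (x::real^'n))\<^sup>2 = (\<Sum>i\<in>UNIV. x $ i * x $ i)"
  by (simp add: norm_eq_sqrt_inner inner_vec_def sum_nonneg)

lemma smooth_norm2: "smooth (\<lambda>x. (norm x)\<^sup>2)"
  unfolding norm2_eq_sum by (intro smooth_intros)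

lemma smooth_DERIV_axis:
  assumes "smooth f"
  shows "((\<lambda>t. f (y + t *\<^sub>R axis i 1)) has_real_derivative partial_deriv i f (y + t *\<^sub>R axis i 1)) (at t)"
proof -
  have "(f has_derivative (\<lambda>h. \<Sum>k\<in>UNIV. h $ k * partial_deriv k f (y + t *\<^sub>R axis i 1))) (at (y + t *\<^sub>R axis i 1))"
    by (intro has_derivative_partial_deriv smooth_differentiable assms)
  moreover have "((\<lambda>t. y + t *\<^sub>R axis i 1) has_derivative (\<lambda>h. h *\<^sub>R axis i 1)) (at t)"
    by (auto intro!: derivative_eq_intros)
  ultimately have "((\<lambda>t. f (y + t *\<^sub>R axis i 1)) has_derivative
      (\<lambda>h. \<Sum>k\<in>UNIV. (h *\<^sub>R axis i 1) $ k * partial_deriv k f (y + t *\<^sub>R axis i 1))) (at t)"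
    by (rule has_derivative_compose[rotated])
  moreover have "(\<lambda>h. \<Sum>k\<in>UNIV. (h *\<^sub>R axis i 1) $ k * partial_deriv k f (y + t *\<^sub>R axis i 1))
      = (*) (partial_deriv i f (y + t *\<^sub>R axis i 1))"
    by (auto simp: axis_def if_distrib if_distribR cong: if_cong)
  ultimately show ?thesis by (simp add: has_field_derivative_def)
qed

text \<open>Two applications of the mean value theorem: to the increment in direction j as a
  function of the offset along i, then to \<open>partial_deriv i f\<close> along j. The left side is
  symmetric in i and j, the right side is not; Schwarz's theorem comes from this.\<close>

lemma second_difference_mvt:
  assumes "smooth f" "h > 0"
  shows "\<exists>s t. 0 < s \<and> s < h \<and> 0 < t \<and> t < h \<and>
    f (x + h *\<^sub>R axis i 1 + h *\<^sub>R axis j 1) - f (x + h *\<^sub>R axis i 1) - f (x + h *\<^sub>R axis j 1) + f x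
    = h\<^sup>2 * partial_deriv j (partial_deriv i f) (x + s *\<^sub>R axis i 1 + t *\<^sub>R axis j 1)"
proof -
  let ?g = "\<lambda>s. f (x + h *\<^sub>R axis j 1 + s *\<^sub>R axis i 1) - f (x + s *\<^sub>R axis i 1)"
  have "\<exists>s. 0 < s \<and> s < h \<and> ?g h - ?g 0 = (h - 0) *
      (partial_deriv i f (x + h *\<^sub>R axis j 1 + s *\<^sub>R axis i 1) - partial_deriv i f (x + s *\<^sub>R axis i 1))"
    using assms by (intro MVT2 DERIV_diff smooth_DERIV_axis) auto
  then obtain s where s: "0 < s" "s < h" "?g h - ?g 0 = h *
      (partial_deriv i f (x + h *\<^sub>R axis j 1 + s *\<^sub>R axis i 1) - partial_deriv i f (x + s *\<^sub>R axis i 1))"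
    by auto
  let ?k = "\<lambda>t. partial_deriv i f (x + s *\<^sub>R axis i 1 + t *\<^sub>R axis j 1)"
  have "\<exists>t. 0 < t \<and> t < h \<and> ?k h - ?k 0 = (h - 0) *
      partial_deriv j (partial_deriv i f) (x + s *\<^sub>R axis i 1 + t *\<^sub>R axis j 1)"
    using assms by (intro MVT2 smooth_DERIV_axis smooth_partial_deriv) auto
  then obtain t where t: "0 < t" "t < h" "?k h - ?k 0 = h *
      partial_deriv j (partial_deriv i f) (x + s *\<^sub>R axis i 1 + t *\<^sub>R axis j 1)"
    by auto
  have "?g h - ?g 0 = h * (?k h - ?k 0)"
    using s(3) by (simp add: add.commute add.left_commute)
  with s t show ?thesis
    by (intro exI[of _ s] exI[of _ t]) (auto simp: algebra_simps power2_eq_square)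
qed

text \<open>Both orders of differentiation represent the same second difference, at two points
  within \<open>2 * h\<close> of x. Letting h tend to 0, continuity of the second derivatives gives
  equality at x.\<close>

lemma partial_deriv_commute:
  assumes "smooth f"
  shows "partial_deriv i (partial_deriv j f) = partial_deriv j (partial_deriv i f)"
proof (rule ext)
  fix x
  have ex: "\<exists>y z. norm (y - x) \<le> 2 * h \<and> norm (z - x) \<le> 2 * h \<and>
      partial_deriv i (partial_deriv j f) y = partial_deriv j (partial_deriv i f) z" if "h > 0" for h
  proof -
    have bd: "norm (x + s *\<^sub>R axis a 1 + t *\<^sub>R axis b 1 - x) \<le> 2 * h"
      if "0 < s" "s < h" "0 < t" "t < h" for s t a b
    proof -
      have "norm (s *\<^sub>R axis a 1 + t *\<^sub>R axis b (1::real)) \<le> s + t"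
        using norm_triangle_ineq[of "s *\<^sub>R axis a 1" "t *\<^sub>R axis b (1::real)"] that by simp
      then show ?thesis using that by (simp add: algebra_simps)
    qed
    obtain s t where 1: "0 < s" "s < h" "0 < t" "t < h"
      "f (x + h *\<^sub>R axis i 1 + h *\<^sub>R axis j 1) - f (x + h *\<^sub>R axis i 1) - f (x + h *\<^sub>R axis j 1) + f x
        = h\<^sup>2 * partial_deriv j (partial_deriv i f) (x + s *\<^sub>R axis i 1 + t *\<^sub>R axis j 1)"
      using second_difference_mvt[OF assms \<open>h > 0\<close>] by blast
    obtain s' t' where 2: "0 < s'" "s' < h" "0 < t'" "t' < h"
      "f (x + h *\<^sub>R axis j 1 + h *\<^sub>R axis i 1) - f (x + h *\<^sub>R axis j 1) - f (x + h *\<^sub>R axis i 1) + f x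
        = h\<^sup>2 * partial_deriv i (partial_deriv j f) (x + s' *\<^sub>R axis j 1 + t' *\<^sub>R axis i 1)"
      using second_difference_mvt[OF assms \<open>h > 0\<close>] by blast
    have "f (x + h *\<^sub>R axis j 1 + h *\<^sub>R axis i 1) = f (x + h *\<^sub>R axis i 1 + h *\<^sub>R axis j 1)"
      by (simp add: algebra_simps)
    with 1(5) 2(5) have "h\<^sup>2 * partial_deriv i (partial_deriv j f) (x + s' *\<^sub>R axis j 1 + t' *\<^sub>R axis i 1)
      = h\<^sup>2 * partial_deriv j (partial_deriv i f) (x + s *\<^sub>R axis i 1 + t *\<^sub>R axis j 1)"
      by linarith
    then have "partial_deriv i (partial_deriv j f) (x + s' *\<^sub>R axis j 1 + t' *\<^sub>R axis i 1)
      = partial_deriv j (partial_deriv i f) (x + s *\<^sub>R axis i 1 + t *\<^sub>R axis j 1)"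
      using \<open>h > 0\<close> by simp
    with bd[OF 1(1-4)] bd[OF 2(1-4)] show ?thesis by blast
  qed
  have "\<forall>n. \<exists>y z. norm (y - x) \<le> 2 * inverse (real (Suc n)) \<and> norm (z - x) \<le> 2 * inverse (real (Suc n)) \<and>
      partial_deriv i (partial_deriv j f) y = partial_deriv j (partial_deriv i f) z"
    by (intro allI ex) simp
  then obtain y z where yz: "\<And>n. norm (y n - x) \<le> 2 * inverse (real (Suc n))"
    "\<And>n. norm (z n - x) \<le> 2 * inverse (real (Suc n))"
    "\<And>n. partial_deriv i (partial_deriv j f) (y n) = partial_deriv j (partial_deriv i f) (z n)"
    by metis
  have lim0: "(\<lambda>n. 2 * inverse (real (Suc n))) \<longlonglongrightarrow> 0"
    using tendsto_mult_left[OF LIMSEQ_inverse_real_of_nat, of 2] by simp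
  have "y \<longlonglongrightarrow> x" "z \<longlonglongrightarrow> x"
    using Lim_null_comparison[OF _ lim0, of "\<lambda>n. y n - x"] Lim_null_comparison[OF _ lim0, of "\<lambda>n. z n - x"] yz
    by (auto simp: LIM_zero_iff)
  moreover have "isCont (partial_deriv i (partial_deriv j f)) x" "isCont (partial_deriv j (partial_deriv i f)) x"
    using smooth_continuous[of _ UNIV] smooth_partial_deriv assms
    by (meson continuous_on_eq_continuous_at open_UNIV UNIV_I)+
  ultimately have "(\<lambda>n. partial_deriv i (partial_deriv j f) (y n)) \<longlonglongrightarrow> partial_deriv i (partial_deriv j f) x"
    "(\<lambda>n. partial_deriv j (partial_deriv i f) (z n)) \<longlonglongrightarrow> partial_deriv j (partial_deriv i f) x"
    by (auto intro: isCont_tendsto_compose)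
  then show "partial_deriv i (partial_deriv j f) x = partial_deriv j (partial_deriv i f) x"
    using LIMSEQ_unique yz(3) by simp
qed

section \<open>Euler field, rotation fields and spherical Laplacian\<close>

definition euler :: "(real^'n \<Rightarrow> real) \<Rightarrow> real^'n \<Rightarrow> real" where
  "euler f x = (\<Sum>i\<in>UNIV. x $ i * partial_deriv i f x)"

definition rot :: "'n \<Rightarrow> 'n \<Rightarrow> (real^'n \<Rightarrow> real) \<Rightarrow> real^'n \<Rightarrow> real" where
  "rot i j f x = x $ i * partial_deriv j f x - x $ j * partial_deriv i f x"

text \<open>On each sphere centred at the origin, \<open>sph\<close> is minus the Laplace--Beltrami operator of the
  unit sphere. The double sum counts every pair of indices twice, hence the factor \<open>1/2\<close>.\<close>

definition sph :: "(real^'n \<Rightarrow> real) \<Rightarrow> real^'n \<Rightarrow> real" where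
  "sph f x = - (1/2) * (\<Sum>i\<in>UNIV. \<Sum>j\<in>UNIV. rot i j (rot i j f) x)"

lemma euler_alt: "euler f = (\<lambda>x. \<Sum>i\<in>UNIV. x $ i * partial_deriv i f x)"
  by (simp add: euler_def fun_eq_iff)

lemma rot_alt: "rot i j f = (\<lambda>x. x $ i * partial_deriv j f x - x $ j * partial_deriv i f x)"
  by (simp add: rot_def fun_eq_iff)

lemma sph_alt: "sph f = (\<lambda>x. - (1/2) * (\<Sum>i\<in>UNIV. \<Sum>j\<in>UNIV. rot i j (rot i j f) x))"
  by (simp add: sph_def fun_eq_iff)

lemma lap_alt: "laplacian f = (\<lambda>x. \<Sum>i\<in>UNIV. partial_deriv i (partial_deriv i f) x)"
  by (simp add: laplacian_def fun_eq_iff)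

lemma inner_grad: "x \<bullet> grad v x = euler v x"
  by (simp add: grad_def euler_def inner_vec_def)

lemma smooth_euler: "smooth f \<Longrightarrow> smooth (euler f)"
  unfolding euler_alt by (intro smooth_intros)

lemma smooth_rot: "smooth f \<Longrightarrow> smooth (rot i j f)"
  unfolding rot_alt by (intro smooth_intros)

lemma smooth_sph: "smooth f \<Longrightarrow> smooth (sph f)"
  unfolding sph_alt by (intro smooth_intros smooth_rot)

lemma euler_const: "euler (\<lambda>x. c) x = 0"
  by (simp add: euler_def)

lemma rot_const [simp]: "rot i j (\<lambda>x. c) = (\<lambda>x. 0)"
  by (simp add: rot_alt)

lemma rot_add: "smooth f \<Longrightarrow> smooth g \<Longrightarrow> rot i j (\<lambda>x. f x + g x) = (\<lambda>x. rot i j f x + rot i j g x)"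
  by (simp add: rot_alt pd_add algebra_simps)

lemma rot_diff: "smooth f \<Longrightarrow> smooth g \<Longrightarrow> rot i j (\<lambda>x. f x - g x) = (\<lambda>x. rot i j f x - rot i j g x)"
  by (simp add: rot_alt pd_diff algebra_simps)

lemma rot_cmult: "smooth f \<Longrightarrow> rot i j (\<lambda>x. c * f x) = (\<lambda>x. c * rot i j f x)"
  by (simp add: rot_alt pd_cmult algebra_simps)

lemma rot_mult: "smooth f \<Longrightarrow> smooth g \<Longrightarrow>
    rot i j (\<lambda>x. f x * g x) = (\<lambda>x. f x * rot i j g x + rot i j f x * g x)"
  by (simp add: rot_alt pd_mult algebra_simps)

lemma euler_add: "smooth f \<Longrightarrow> smooth g \<Longrightarrow> euler (\<lambda>x. f x + g x) = (\<lambda>x. euler f x + euler g x)"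
  by (simp add: euler_alt pd_add algebra_simps sum.distrib)

lemma euler_diff: "smooth f \<Longrightarrow> smooth g \<Longrightarrow> euler (\<lambda>x. f x - g x) = (\<lambda>x. euler f x - euler g x)"
  by (simp add: euler_alt pd_diff algebra_simps sum_subtractf)

lemma euler_cmult: "smooth f \<Longrightarrow> euler (\<lambda>x. c * f x) = (\<lambda>x. c * euler f x)"
  by (simp add: euler_alt pd_cmult algebra_simps sum_distrib_left)

lemma euler_mult: "smooth f \<Longrightarrow> smooth g \<Longrightarrow>
    euler (\<lambda>x. f x * g x) = (\<lambda>x. f x * euler g x + euler f x * g x)"
  by (simp add: euler_alt pd_mult algebra_simps sum.distrib sum_distrib_left sum_distrib_right)

lemma euler_coord: "euler (\<lambda>x. x $ i) = (\<lambda>x. x $ i)"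
  by (simp add: euler_alt if_distrib cong: if_cong)

lemma pd_norm2: "partial_deriv i (\<lambda>x. (norm x)\<^sup>2) = (\<lambda>x. 2 * x $ i)"
  unfolding norm2_eq_sum
  by (simp add: pd_sum pd_mult smooth_intros sum.distrib if_distrib if_distribR cong: if_cong)

lemma rot_norm2: "rot i j (\<lambda>x. (norm x)\<^sup>2) = (\<lambda>x. 0)"
  by (simp add: rot_alt pd_norm2)

text \<open>Stated for all pairs, so that the double sum in \<open>sph\<close> runs unrestricted. On
  the diagonal the differentiated coordinates contribute extra terms, collected in the conditional;
  summed, they give twice the Euler field.\<close>

lemma rot_rot_eq:
  assumes f: "smooth f"
  shows "rot i j (rot i j f) x =
    x $ i * (x $ i * partial_deriv j (partial_deriv j f) x) + x $ j * (x $ j * partial_deriv i (partial_deriv i f) x)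
    - x $ i * (x $ j * partial_deriv j (partial_deriv i f) x) - x $ j * (x $ i * partial_deriv i (partial_deriv j f) x)
    - x $ i * partial_deriv i f x - x $ j * partial_deriv j f x
    + (if i = j then x $ i * partial_deriv j f x + x $ j * partial_deriv i f x else 0)"
proof -
  have "rot i j (rot i j f) = (\<lambda>x. x $ i * (x $ i * partial_deriv j (partial_deriv j f) x
        + (if j = i then 1 else 0) * partial_deriv j f x
        - (x $ j * partial_deriv j (partial_deriv i f) x + partial_deriv i f x))
      - x $ j * (x $ i * partial_deriv i (partial_deriv j f) x + partial_deriv j f x
        - (x $ j * partial_deriv i (partial_deriv i f) x + (if i = j then 1 else 0) * partial_deriv i f x)))"
    by (simp add: rot_alt pd_diff pd_mult smooth_intros f)
  then show ?thesis by (auto simp: algebra_simps)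
qed

lemma pd_euler:
  assumes f: "smooth f"
  shows "partial_deriv k (euler f) x = (\<Sum>j\<in>UNIV. x $ j * partial_deriv k (partial_deriv j f) x) + partial_deriv k f x"
proof -
  have "partial_deriv k (euler f) x = (\<Sum>j\<in>UNIV. x $ j * partial_deriv k (partial_deriv j f) x)
      + (\<Sum>j\<in>UNIV. (if k = j then 1 else 0) * partial_deriv j f x)"
    by (simp add: euler_alt pd_sum pd_mult smooth_intros f flip: sum.distrib)
  also have "(\<Sum>j\<in>UNIV. (if k = j then 1 else 0) * partial_deriv j f x) = partial_deriv k f x"
    by (simp add: if_distrib[of "\<lambda>z. z * _"] cong: if_cong)
  finally show ?thesis .
qed

lemma euler_euler_eq:
  assumes f: "smooth f"
  shows "euler (euler f) x = euler f x + (\<Sum>i\<in>UNIV. \<Sum>j\<in>UNIV. x $ i * (x $ j * partial_deriv i (partial_deriv j f) x))"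
proof -
  show ?thesis
    by (simp add: euler_def[of "euler f"] euler_def[of f] pd_euler[OF f] algebra_simps sum.distrib sum_distrib_left)
qed

text \<open>The polar decomposition of the Laplacian without polar coordinates. In the sum over all
  pairs the pure second derivatives give \<open>2 |x|^2 \<Delta>\<close>, the mixed ones
  \<open>-2 (E^2 - E)\<close>, and the first-order terms \<open>-2 N E + 2 E\<close>; the factor
  -1/2 then yields the claim.\<close>

lemma laplacian_euler_sph:
  fixes f :: "real^'n \<Rightarrow> real"
  assumes f: "smooth f"
  shows "(norm x)\<^sup>2 * laplacian f x = euler (euler f) x + (real CARD('n) - 2) * euler f x - sph f x"
proof -
  have A: "(\<Sum>i\<in>UNIV. \<Sum>j\<in>UNIV. x $ i * (x $ i * partial_deriv j (partial_deriv j f) x)) = (norm x)\<^sup>2 * laplacian f x"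
    unfolding norm2_eq_sum laplacian_def by (simp add: sum_product mult.assoc)
  have A': "(\<Sum>i\<in>UNIV. \<Sum>j\<in>UNIV. x $ j * (x $ j * partial_deriv i (partial_deriv i f) x)) = (norm x)\<^sup>2 * laplacian f x"
    by (subst sum.swap) (rule A)
  have B: "(\<Sum>i\<in>UNIV. \<Sum>j\<in>UNIV. x $ i * (x $ j * partial_deriv i (partial_deriv j f) x)) = euler (euler f) x - euler f x"
    by (simp add: euler_euler_eq f)
  have B1: "(\<Sum>i\<in>UNIV. \<Sum>j\<in>UNIV. x $ j * (x $ i * partial_deriv i (partial_deriv j f) x)) = euler (euler f) x - euler f x"
    unfolding B[symmetric] by (simp add: ac_simps)
  have B2: "(\<Sum>i\<in>UNIV. \<Sum>j\<in>UNIV. x $ i * (x $ j * partial_deriv j (partial_deriv i f) x)) = euler (euler f) x - euler f x"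
    by (subst sum.swap) (rule B1)
  have D: "(\<Sum>i\<in>UNIV. \<Sum>j\<in>(UNIV::'n set). x $ i * partial_deriv i f x) = real CARD('n) * euler f x"
    by (simp add: euler_def sum_distrib_left mult_ac)
  have D': "(\<Sum>i\<in>(UNIV::'n set). \<Sum>j\<in>UNIV. x $ j * partial_deriv j f x) = real CARD('n) * euler f x"
    by (subst sum.swap) (rule D)
  have F: "(\<Sum>i\<in>UNIV. \<Sum>j\<in>UNIV. if i = j then x $ i * partial_deriv j f x + x $ j * partial_deriv i f x else 0) = 2 * euler f x"
    by (simp add: euler_def sum_distrib_left)
  have "(\<Sum>i\<in>UNIV. \<Sum>j\<in>UNIV. rot i j (rot i j f) x) = (norm x)\<^sup>2 * laplacian f x + (norm x)\<^sup>2 * laplacian f x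
      - (euler (euler f) x - euler f x) - (euler (euler f) x - euler f x)
      - real CARD('n) * euler f x - real CARD('n) * euler f x + 2 * euler f x"
    unfolding rot_rot_eq[OF f] sum.distrib sum_subtractf A A' B1 B2 D D' F by simp
  then show ?thesis by (simp add: sph_def algebra_simps)
qed

text \<open>Dilations commute with rotations. On coefficients: E fixes each coordinate function, and
  symmetry of second derivatives turns the derivatives of \<open>euler f\<close> into those of the
  first derivatives.\<close>

lemma rot_euler:
  assumes f: "smooth f"
  shows "rot i j (euler f) = euler (rot i j f)"
proof (rule ext)
  fix x
  have 1: "rot i j (euler f) x = x $ i * ((\<Sum>l\<in>UNIV. x $ l * partial_deriv j (partial_deriv l f) x) + partial_deriv j f x)
     - x $ j * ((\<Sum>l\<in>UNIV. x $ l * partial_deriv i (partial_deriv l f) x) + partial_deriv i f x)"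
    by (simp add: rot_def pd_euler[OF f])
  have e: "euler (partial_deriv k f) x = (\<Sum>l\<in>UNIV. x $ l * partial_deriv k (partial_deriv l f) x)" for k
    by (simp add: euler_def partial_deriv_commute[OF f, of _ k])
  have "euler (rot i j f) x = x $ i * euler (partial_deriv j f) x + x $ i * partial_deriv j f x
      - (x $ j * euler (partial_deriv i f) x + x $ j * partial_deriv i f x)"
    by (simp add: rot_alt euler_diff euler_mult euler_coord smooth_intros f)
  with 1 show "rot i j (euler f) x = euler (rot i j f) x" by (simp add: e algebra_simps)
qed

lemma sph_const: "sph (\<lambda>x. c) = (\<lambda>x. 0)"
  by (simp add: sph_alt)

lemma sph_add: "smooth f \<Longrightarrow> smooth g \<Longrightarrow> sph (\<lambda>x. f x + g x) = (\<lambda>x. sph f x + sph g x)"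
  by (simp add: sph_alt rot_add smooth_rot sum.distrib algebra_simps)

lemma sph_diff: "smooth f \<Longrightarrow> smooth g \<Longrightarrow> sph (\<lambda>x. f x - g x) = (\<lambda>x. sph f x - sph g x)"
  by (simp add: sph_alt rot_diff smooth_rot sum_subtractf algebra_simps)

lemma sph_cmult: "smooth f \<Longrightarrow> sph (\<lambda>x. c * f x) = (\<lambda>x. c * sph f x)"
  by (simp add: sph_alt rot_cmult smooth_rot sum_distrib_left mult_ac)

lemma sph_sum: "(\<And>i. i \<in> I \<Longrightarrow> smooth (f i)) \<Longrightarrow> sph (\<lambda>x. \<Sum>i\<in>I. f i x) = (\<lambda>x. \<Sum>i\<in>I. sph (f i) x)"
proof (induction I rule: infinite_finite_induct)
  case (insert j I)
  then show ?case by (simp add: sph_add smooth_sum)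
qed (simp_all add: sph_const)

lemma sph_norm2_mult: "smooth f \<Longrightarrow> sph (\<lambda>x. (norm x)\<^sup>2 * f x) = (\<lambda>x. (norm x)\<^sup>2 * sph f x)"
  by (simp add: sph_alt rot_mult rot_norm2 smooth_norm2 smooth_rot sum_distrib_left mult_ac)

section \<open>Homogeneous polynomials and their splitting into eigenfunctions\<close>

inductive hpoly :: "nat \<Rightarrow> (real^'n \<Rightarrow> real) \<Rightarrow> bool" where
  const: "hpoly 0 (\<lambda>x. c)"
| coord: "hpoly n p \<Longrightarrow> hpoly (Suc n) (\<lambda>x. x $ i * p x)"
| add: "hpoly n p \<Longrightarrow> hpoly n q \<Longrightarrow> hpoly n (\<lambda>x. p x + q x)"

lemma hpoly_smooth: "hpoly n p \<Longrightarrow> smooth p"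
  by (induction rule: hpoly.induct) (intro smooth_intros; assumption)+

lemma hpoly_zero: "hpoly n (\<lambda>x. 0)"
proof (induction n)
  case (Suc n)
  \<comment> \<open>Any coordinate serves: multiplying 0 by it raises the degree, so 0 is
    homogeneous of every degree.\<close>
  then show ?case using hpoly.coord[OF Suc, of undefined] by simp
qed (rule hpoly.const)

lemma hpoly_cmult: "hpoly n p \<Longrightarrow> hpoly n (\<lambda>x. c * p x)"
proof (induction rule: hpoly.induct)
  case (coord n p i)
  show ?case using hpoly.coord[OF coord.IH, of i] by (simp add: mult_ac)
qed (auto intro: hpoly.intros simp: algebra_simps)

lemma hpoly_sum: "(\<And>i. i \<in> I \<Longrightarrow> hpoly n (p i)) \<Longrightarrow> hpoly n (\<lambda>x. \<Sum>i\<in>I. p i x)"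
proof (induction I rule: infinite_finite_induct)
  case (insert j I)
  then show ?case by (simp add: hpoly.add)
qed (simp_all add: hpoly_zero)

lemma hpoly_mult: "hpoly n p \<Longrightarrow> hpoly m q \<Longrightarrow> hpoly (n + m) (\<lambda>x. p x * q x)"
proof (induction rule: hpoly.induct)
  case (coord n p i)
  then show ?case using hpoly.coord[of "n + m" "\<lambda>x. p x * q x" i] by (simp add: mult_ac)
qed (auto intro: hpoly.intros hpoly_cmult simp: algebra_simps)

text \<open>Degree 0 is separated because \<open>n - 1\<close> truncates there. That constants have
  exactly zero derivative is what makes degrees 0 and 1 harmonic in
  \<open>hpoly_laplacian\<close>.\<close>

lemma hpoly_partial_deriv:
  "hpoly n p \<Longrightarrow> (if n = 0 then partial_deriv i p = (\<lambda>x. 0) else hpoly (n - 1) (partial_deriv i p))"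
proof (induction rule: hpoly.induct)
  case (coord n p j)
  have eq: "partial_deriv i (\<lambda>x. x $ j * p x) = (\<lambda>x. x $ j * partial_deriv i p x + (if i = j then 1 else 0) * p x)"
    using coord.hyps by (simp add: pd_mult smooth_coord hpoly_smooth)
  have "hpoly n (\<lambda>x. x $ j * partial_deriv i p x)"
  proof (cases n)
    case 0
    then show ?thesis using coord.IH by (simp add: hpoly_zero)
  next
    case (Suc m)
    then show ?thesis using coord.IH by (simp add: hpoly.coord)
  qed
  then have "hpoly n (\<lambda>x. x $ j * partial_deriv i p x + (if i = j then 1 else 0) * p x)"
    by (intro hpoly.add hpoly_cmult coord.hyps)
  then show ?case by (simp add: eq)
next
  case (add n p q)
  then show ?case by (auto simp: pd_add hpoly_smooth intro: hpoly.add)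
qed simp

lemma hpoly_laplacian:
  assumes "hpoly n p"
  shows "if n < 2 then laplacian p = (\<lambda>x. 0) else hpoly (n - 2) (laplacian p)"
proof -
  consider "n = 0" | "n = 1" | "n \<ge> 2" by linarith
  then show ?thesis
  proof cases
    case 1
    then show ?thesis using hpoly_partial_deriv[OF assms] by (simp add: lap_alt)
  next
    case 2
    then have "hpoly 0 (partial_deriv i p)" for i using hpoly_partial_deriv[OF assms, of i] by simp
    from hpoly_partial_deriv[OF this] show ?thesis using 2 by (simp add: lap_alt)
  next
    case 3
    then have "hpoly (n - 1) (partial_deriv i p)" for i using hpoly_partial_deriv[OF assms, of i] by simp
    from hpoly_partial_deriv[OF this] have "hpoly (n - 1 - 1) (partial_deriv i (partial_deriv i p))" for i
      using 3 by (simp split: if_splits)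
    then show ?thesis using 3 by (simp add: lap_alt hpoly_sum numeral_2_eq_2)
  qed
qed

lemma euler_hpoly: "hpoly n p \<Longrightarrow> euler p = (\<lambda>x. real n * p x)"
  by (induction rule: hpoly.induct)
    (auto simp: euler_mult euler_coord euler_add smooth_coord hpoly_smooth algebra_simps euler_const[abs_def] fun_eq_iff)

definition sph_ev :: "nat \<Rightarrow> nat \<Rightarrow> real" where
  "sph_ev N k = real k * (real k + real N - 2)"

lemma sph_hpoly:
  fixes p :: "real^'n \<Rightarrow> real"
  assumes "hpoly n p"
  shows "sph p x = sph_ev CARD('n) n * p x - (norm x)\<^sup>2 * laplacian p x"
proof -
  have "euler (euler p) x = real n * (real n * p x)"
    using assms by (simp add: euler_hpoly euler_cmult hpoly_smooth)
  then show ?thesis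
    using laplacian_euler_sph[OF hpoly_smooth[OF assms], of x]
    by (simp add: euler_hpoly[OF assms] sph_ev_def algebra_simps)
qed

text \<open>Only the eigenvalue equation is recorded; a component may carry powers of
  \<open>|x|^2\<close> and need not be homogeneous of degree k. Requiring zeros beyond n lets
  decompositions of different length be added index by index.\<close>

definition sph_decomp :: "(real^'n \<Rightarrow> real) \<Rightarrow> nat \<Rightarrow> (nat \<Rightarrow> real^'n \<Rightarrow> real) \<Rightarrow> bool" where
  "sph_decomp p n q \<longleftrightarrow> (\<forall>k. smooth (q k) \<and> sph (q k) = (\<lambda>x. sph_ev CARD('n) k * q k x)) \<and>
     (\<forall>k>n. q k = (\<lambda>x. 0)) \<and> p = (\<lambda>x. \<Sum>k\<le>n. q k x)"

lemma sph_ev_less: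
  assumes "N \<ge> 3" "k < n"
  shows "sph_ev N k < sph_ev N n"
proof -
  have "real k * (real k + real N - 2) \<le> real k * (real n + real N - 2)"
    using assms by (intro mult_left_mono) auto
  also have "\<dots> < real n * (real n + real N - 2)"
    using assms by (intro mult_strict_right_mono) auto
  finally show ?thesis by (simp add: sph_ev_def)
qed

text \<open>Induction on the degree, with the Laplacian lowering it by 2. If
  \<open>laplacian p\<close> is the sum of the \<open>q k\<close>, then
  \<open>r k = |x|^2 q k / (c_n - c_k)\<close> is again an eigenfunction for \<open>c_k\<close>,
  because \<open>|x|^2\<close> commutes with L. By \<open>sph_hpoly\<close>, applying
  \<open>c_n - L\<close> to p gives \<open>|x|^2 laplacian p\<close>, which the \<open>r k\<close>
  reproduce; so \<open>s = p - \<Sum> r k\<close> satisfies \<open>L s = c_n s\<close>. The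
  divisions are legitimate because the eigenvalues increase strictly.\<close>

lemma hpoly_sph_decomp:
  fixes p :: "real^'n \<Rightarrow> real"
  assumes N: "CARD('n) \<ge> 3"
  shows "hpoly n p \<Longrightarrow> \<exists>q. sph_decomp p n q"
proof (induction n arbitrary: p rule: less_induct)
  case (less n)
  have sp: "smooth p" using less.prems by (rule hpoly_smooth)
  let ?c = "sph_ev CARD('n)"
  show ?case
  proof (cases "n < 2")
    case True
    then have "laplacian p = (\<lambda>x. 0)" using hpoly_laplacian[OF less.prems] by simp
    then have "sph p = (\<lambda>x. ?c n * p x)" using sph_hpoly[OF less.prems] by (simp add: fun_eq_iff)
    moreover have "(\<Sum>k\<le>n. (if k = n then p else (\<lambda>x. 0)) x) = p x" for x
      by (subst sum.remove[of _ n]) (auto intro!: sum.neutral)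
    ultimately have "sph_decomp p n (\<lambda>k. if k = n then p else (\<lambda>x. 0))"
      by (auto simp: sph_decomp_def sp smooth_const sph_const)
    then show ?thesis by blast
  next
    case False
    then have "hpoly (n - 2) (laplacian p)" "n - 2 < n" using hpoly_laplacian[OF less.prems] by auto
    with less.IH obtain q where q: "sph_decomp (laplacian p) (n - 2) q" by blast
    then have sq: "smooth (q k)" and eq: "sph (q k) = (\<lambda>x. ?c k * q k x)"
      and zq: "k > n - 2 \<Longrightarrow> q k = (\<lambda>x. 0)"
      and lq: "laplacian p = (\<lambda>x. \<Sum>k\<le>n-2. q k x)" for k
      by (auto simp: sph_decomp_def)
    define r where "r k = (\<lambda>x. inverse (?c n - ?c k) * ((norm x)\<^sup>2 * q k x))" for k
    have sr: "smooth (r k)" for k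
      unfolding r_def by (intro smooth_intros smooth_norm2 sq)
    have er: "sph (r k) = (\<lambda>x. ?c k * r k x)" for k
      unfolding r_def sph_cmult[OF smooth_mult[OF smooth_norm2 sq]] sph_norm2_mult[OF sq] eq
      by (simp add: mult.left_commute)
    have zr: "k > n - 2 \<Longrightarrow> r k = (\<lambda>x. 0)" for k
      by (simp add: r_def zq)
    define s where "s = (\<lambda>x. p x - (\<Sum>k\<le>n-2. r k x))"
    have ss: "smooth s" unfolding s_def by (intro smooth_intros sp sr)
    have es: "sph s = (\<lambda>x. ?c n * s x)"
    proof (rule ext)
      fix x
      have "?c n * s x - sph s x = (norm x)\<^sup>2 * laplacian p x - (\<Sum>k\<le>n-2. (?c n - ?c k) * r k x)"
        by (simp add: s_def sph_diff sp smooth_sum sr sph_sum er sph_hpoly[OF less.prems]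
            algebra_simps sum_subtractf sum_distrib_left)
      also have "(\<Sum>k\<le>n-2. (?c n - ?c k) * r k x) = (\<Sum>k\<le>n-2. (norm x)\<^sup>2 * q k x)"
      proof (rule sum.cong)
        fix k assume "k \<in> {..n-2}"
        then have "?c k < ?c n" using False N by (intro sph_ev_less) auto
        then show "(?c n - ?c k) * r k x = (norm x)\<^sup>2 * q k x" by (simp add: r_def field_simps)
      qed simp
      finally show "sph s x = ?c n * s x" by (simp add: lq sum_distrib_left)
    qed
    have sum: "p x = (\<Sum>k\<le>n. (if k = n then s else r k) x)" for x
    proof -
      have "(\<Sum>k\<le>n. (if k = n then s else r k) x) = s x + (\<Sum>k\<in>{..n}-{n}. (if k = n then s else r k) x)"
        by (subst sum.remove[of _ n]) auto
      also have "(\<Sum>k\<in>{..n}-{n}. (if k = n then s else r k) x) = (\<Sum>k\<le>n-2. r k x)"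
      proof (rule sum.mono_neutral_cong_right)
        show "\<forall>i\<in>{..n} - {n} - {..n - 2}. (if i = n then s else r i) x = 0"
          by (auto simp: r_def zq)
      qed (use False in auto)
      finally show ?thesis by (simp add: s_def)
    qed
    have "sph_decomp p n (\<lambda>k. if k = n then s else r k)"
      unfolding sph_decomp_def using sum zr by (auto simp: ss sr es er)
    then show ?thesis by blast
  qed
qed

lemma sph_decomp_mono:
  assumes "sph_decomp p n q" "n \<le> m"
  shows "sph_decomp p m q"
proof -
  have "(\<Sum>k\<le>m. q k x) = (\<Sum>k\<le>n. q k x)" for x
    using assms by (intro sum.mono_neutral_right) (auto simp: sph_decomp_def)
  with assms show ?thesis by (auto simp: sph_decomp_def)
qed

lemma sph_decomp_add:
  assumes "sph_decomp p n q" "sph_decomp p' m q'"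
  shows "sph_decomp (\<lambda>x. p x + p' x) (max n m) (\<lambda>k x. q k x + q' k x)"
  using sph_decomp_mono[OF assms(1), of "max n m"] sph_decomp_mono[OF assms(2), of "max n m"]
  by (auto simp: sph_decomp_def sph_add smooth_add sum.distrib algebra_simps)

inductive gpoly :: "(real^'n \<Rightarrow> real) \<Rightarrow> bool" where
  hom: "hpoly n p \<Longrightarrow> gpoly p"
| add: "gpoly p \<Longrightarrow> gpoly q \<Longrightarrow> gpoly (\<lambda>x. p x + q x)"

lemma gpoly_mult: "gpoly p \<Longrightarrow> gpoly q \<Longrightarrow> gpoly (\<lambda>x. p x * q x)"
proof (induction rule: gpoly.induct)
  case (hom n p)
  from hom.prems hom.hyps show ?case
    by (induction rule: gpoly.induct) (auto intro: gpoly.intros hpoly_mult simp: algebra_simps)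
next
  case (add p p')
  then show ?case by (simp add: algebra_simps gpoly.add)
qed

text \<open>Connects the polynomial functions of the Weierstrass theorem with sums of homogeneous
  ones; a linear functional is expanded in the coordinates and has degree 1.\<close>

lemma real_polynomial_function_gpoly:
  fixes p :: "real^'n \<Rightarrow> real"
  shows "real_polynomial_function p \<Longrightarrow> gpoly p"
proof (induction rule: real_polynomial_function.induct)
  case (linear f)
  then have lin: "linear f" by (rule bounded_linear.linear)
  have "f x = (\<Sum>i\<in>UNIV. x $ i * f (axis i 1))" for x
  proof -
    have "f x = f (\<Sum>i\<in>UNIV. x $ i *\<^sub>R axis i 1)"
      by (simp add: basis_expansion flip: scalar_mult_eq_scaleR)
    also have "\<dots> = (\<Sum>i\<in>UNIV. x $ i * f (axis i 1))"
      by (simp add: linear_sum[OF lin] linear_scale[OF lin])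
    finally show ?thesis .
  qed
  then have "f = (\<lambda>x. \<Sum>i\<in>UNIV. x $ i * f (axis i 1))" by blast
  moreover have "hpoly (Suc 0) (\<lambda>x. \<Sum>i\<in>UNIV. x $ i * f (axis i 1))"
    by (intro hpoly_sum hpoly.coord hpoly.const)
  ultimately show ?case using gpoly.hom by metis
qed (auto intro: gpoly.intros hpoly.const gpoly_mult)

lemma real_polynomial_function_sph_decomp:
  fixes p :: "real^'n \<Rightarrow> real"
  assumes "real_polynomial_function p" "CARD('n) \<ge> 3"
  shows "\<exists>n q. sph_decomp p n q"
  using real_polynomial_function_gpoly[OF assms(1)]
proof (induction rule: gpoly.induct)
  case (hom n p)
  then show ?case using hpoly_sph_decomp[OF assms(2)] by blast
next
  case (add p q)
  then show ?case using sph_decomp_add by blast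
qed

section \<open>Integration by parts against radial weights\<close>

lemma integrable_continuous_bounded_support:
  fixes f :: "real^'n \<Rightarrow> real"
  assumes "continuous_on UNIV f" "\<And>x. norm x > R \<Longrightarrow> f x = 0"
  shows "integrable lborel f"
proof -
  have "set_integrable lborel (cball 0 R) f"
    unfolding set_integrable_def
    by (intro borel_integrable_compact) (auto intro: continuous_on_subset[OF assms(1)])
  moreover have "(\<lambda>x. indicator (cball 0 R) x *\<^sub>R f x) = f"
    using assms(2) by (auto simp: indicator_def fun_eq_iff dist_norm not_le)
  ultimately show ?thesis by (simp add: set_integrable_def)
qed

lemma bounded_continuous_bounded_support:
  fixes f :: "real^'n \<Rightarrow> real"
  assumes "continuous_on UNIV f" "\<And>x. norm x > R \<Longrightarrow> f x = 0"
  obtains B where "B > 0" "\<And>x. \<bar>f x\<bar> \<le> B"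
proof -
  have "bounded (f ` cball 0 R)"
    by (intro compact_imp_bounded compact_continuous_image) (auto intro: continuous_on_subset[OF assms(1)])
  then obtain B where B: "B > 0" "\<And>x. x \<in> cball 0 R \<Longrightarrow> \<bar>f x\<bar> \<le> B"
    by (auto simp: bounded_pos)
  have "\<bar>f x\<bar> \<le> B" for x
    using B assms(2)[of x] by (cases "norm x \<le> R") auto
  with B(1) that show ?thesis by blast
qed

lemma lborel_integral_translate:
  fixes f :: "real^'n \<Rightarrow> real"
  assumes "f \<in> borel_measurable borel"
  shows "(\<integral>x. f (a + x) \<partial>lborel) = (\<integral>x. f x \<partial>lborel)"
proof -
  have "(\<integral>x. f x \<partial>lborel) = (\<integral>x. f x \<partial>(distr lborel borel ((+) a)))"
    by (simp add: lborel_distr_plus)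
  also have "\<dots> = (\<integral>x. f (a + x) \<partial>lborel)"
    by (subst integral_distr) (use assms in auto)
  finally show ?thesis by simp
qed

text \<open>Differentiate the translation-invariant integral \<open>\<integral>f(x + t e\<^sub>i) dx\<close> at \<open>t = 0\<close>.\<close>

lemma integral_partial_deriv_eq_0:
  fixes f :: "real^'n \<Rightarrow> real"
  assumes der: "\<And>x. (f has_derivative D x) (at x)"
    and cont: "continuous_on UNIV (\<lambda>x. D x (axis i 1))"
    and supp: "\<And>x. norm x > R \<Longrightarrow> f x = 0"
  shows "(\<integral>x. D x (axis i 1) \<partial>lborel) = 0"
proof -
  let ?e = "axis i 1 :: real^'n"
  let ?g = "\<lambda>x. D x ?e"
  have cf: "continuous_on UNIV f"
    using der by (intro has_derivative_continuous_on) (auto intro: has_derivative_at_withinI)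
  have line: "((\<lambda>t. f (y + t *\<^sub>R ?e)) has_real_derivative ?g (y + t *\<^sub>R ?e)) (at t)" for y t
  proof -
    have "((\<lambda>t. y + t *\<^sub>R ?e) has_derivative (\<lambda>h. h *\<^sub>R ?e)) (at t)"
      by (auto intro!: derivative_eq_intros)
    from has_derivative_compose[OF this der]
    have "((\<lambda>t. f (y + t *\<^sub>R ?e)) has_derivative (\<lambda>h. D (y + t *\<^sub>R ?e) (h *\<^sub>R ?e))) (at t)" .
    moreover have "(\<lambda>h. D (y + t *\<^sub>R ?e) (h *\<^sub>R ?e)) = (*) (?g (y + t *\<^sub>R ?e))"
      using linear_scale[OF has_derivative_linear[OF der]] by (auto simp: mult.commute)
    ultimately show ?thesis by (simp add: has_field_derivative_def)
  qed
  \<comment> \<open>Outside the ball f is locally 0, so its derivative there is the zero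
    map.\<close>
  have g0: "?g x = 0" if "norm x > R" for x
  proof -
    have "open {x. norm x > R}" by (intro open_Collect_less continuous_intros)
    then have "((\<lambda>x. 0) has_derivative D x) (at x)"
      by (intro has_derivative_transform_within_open[OF der, where s = "{x. norm x > R}"]) (use that supp in auto)
    then have "D x = (\<lambda>h. 0)" using has_derivative_unique has_derivative_const by blast
    then show ?thesis by simp
  qed
  obtain B where B: "B > 0" "\<And>x. \<bar>?g x\<bar> \<le> B"
    using bounded_continuous_bounded_support[OF cont g0] by blast
  define h where "h n = inverse (real (Suc n))" for n
  \<comment> \<open>Steps of length at most 1 keep all difference quotients supported in the ball of
    radius \<open>R + 1\<close>, where the mean value theorem bounds them by B; this is the
    integrable majorant.\<close>
  have h: "0 < h n" "h n \<le> 1" for n by (auto simp: h_def field_simps)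
  have h0: "h \<longlonglongrightarrow> 0" unfolding h_def by (rule LIMSEQ_inverse_real_of_nat)
  let ?s = "\<lambda>n x. (f (h n *\<^sub>R ?e + x) - f x) / h n"
  have "(\<lambda>n. \<integral>x. ?s n x \<partial>lborel) \<longlonglongrightarrow> (\<integral>x. ?g x \<partial>lborel)"
  proof (rule integral_dominated_convergence)
    show "integrable lborel (\<lambda>x. B * indicator (cball 0 (R + 1)) x)"
      by (rule integrable_mult_right, rule integrable_real_indicator)
        (simp_all add: emeasure_bounded_finite[OF bounded_cball, unfolded infinity_ennreal_def])
    show "?g \<in> borel_measurable lborel"
      using borel_measurable_continuous_onI[OF cont] by simp
    show "?s n \<in> borel_measurable lborel" for n
    proof -
      have "continuous_on UNIV (\<lambda>x. f (h n *\<^sub>R ?e + x))"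
        by (intro continuous_on_compose2[OF cf]) (auto intro!: continuous_intros)
      then have "continuous_on UNIV (?s n)"
        using h(1)[of n] by (intro continuous_intros cf) auto
      then show ?thesis using borel_measurable_continuous_onI by simp
    qed
    show "AE x in lborel. (\<lambda>n. ?s n x) \<longlonglongrightarrow> ?g x"
    proof (rule AE_I2)
      fix x
      have "((\<lambda>t. (f (x + t *\<^sub>R ?e) - f x) / t) \<longlongrightarrow> ?g x) (at 0)"
        using line[of x 0] by (simp add: DERIV_def)
      moreover have "filterlim h (at 0) sequentially"
        using h0 h(1) by (auto simp: filterlim_at less_imp_neq[symmetric] intro!: always_eventually)
      ultimately have "(\<lambda>n. (f (x + h n *\<^sub>R ?e) - f x) / h n) \<longlonglongrightarrow> ?g x"
        by (rule filterlim_compose)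
      then show "(\<lambda>n. ?s n x) \<longlonglongrightarrow> ?g x" by (simp add: add.commute)
    qed
    show "AE x in lborel. norm (?s n x) \<le> B * indicator (cball 0 (R + 1)) x" for n
    proof (rule AE_I2)
      fix x
      show "norm (?s n x) \<le> B * indicator (cball 0 (R + 1)) x"
      proof (cases "norm x \<le> R + 1")
        case True
        have "\<exists>z>0. z < h n \<and> f (x + h n *\<^sub>R ?e) - f (x + 0 *\<^sub>R ?e) = (h n - 0) * ?g (x + z *\<^sub>R ?e)"
          using h by (intro MVT2 line) auto
        then obtain z where "f (x + h n *\<^sub>R ?e) - f x = h n * ?g (x + z *\<^sub>R ?e)" by auto
        then have "?s n x = ?g (x + z *\<^sub>R ?e)"
          using h(1)[of n] by (simp add: add.commute)
        then show ?thesis using B True by (simp add: dist_norm)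
      next
        case False
        have "norm x \<le> norm (h n *\<^sub>R ?e + x) + norm (h n *\<^sub>R ?e)"
          using norm_triangle_ineq4[of "h n *\<^sub>R ?e + x" "h n *\<^sub>R ?e"] by simp
        then have "R < norm (h n *\<^sub>R ?e + x)" using False h[of n] by simp
        then show ?thesis using False supp B by simp
      qed
    qed
  qed
  \<comment> \<open>By translation invariance the two terms of the difference quotient have equal
    integrals.\<close>
  moreover have "(\<integral>x. ?s n x \<partial>lborel) = 0" for n
  proof -
    have i1: "integrable lborel f" by (rule integrable_continuous_bounded_support[OF cf supp])
    have m: "f \<in> borel_measurable borel" using borel_measurable_continuous_onI[OF cf] by simp
    have "integrable lborel (\<lambda>x. f (h n *\<^sub>R ?e + x))"
    proof (rule integrable_continuous_bounded_support)
      show "continuous_on UNIV (\<lambda>x. f (h n *\<^sub>R ?e + x))"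
        by (intro continuous_on_compose2[OF cf]) (auto intro!: continuous_intros)
      show "f (h n *\<^sub>R ?e + x) = 0" if "norm x > R + 1" for x
      proof -
        have "norm x \<le> norm (h n *\<^sub>R ?e + x) + norm (h n *\<^sub>R ?e)"
          using norm_triangle_ineq4[of "h n *\<^sub>R ?e + x" "h n *\<^sub>R ?e"] by simp
        then have "R < norm (h n *\<^sub>R ?e + x)" using that h[of n] by simp
        then show ?thesis by (rule supp)
      qed
    qed
    then show ?thesis
      using lborel_integral_translate[OF m, of "h n *\<^sub>R ?e"] i1 by simp
  qed
  ultimately have "(\<lambda>n::nat. 0) \<longlonglongrightarrow> (\<integral>x. ?g x \<partial>lborel)" by (simp only:)
  then show ?thesis by (simp add: LIMSEQ_const_iff)
qed

text \<open>A radial weight on \<open>\<real>\<^sup>n\<close> is written \<open>w (|x|\<^sup>2)\<close>, with \<open>w'\<close> the derivative of \<open>w\<close>.\<close>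

definition radial_weight :: "(real \<Rightarrow> real) \<Rightarrow> (real \<Rightarrow> real) \<Rightarrow> bool" where
  "radial_weight w w' \<longleftrightarrow> (\<forall>s\<ge>0. (w has_real_derivative w' s) (at s)) \<and> continuous_on {0..} w'"

lemma radial_weight_continuous:
  assumes "radial_weight w w'"
  shows "continuous_on S (\<lambda>x::real^'n. w ((norm x)\<^sup>2))" "continuous_on S (\<lambda>x::real^'n. w' ((norm x)\<^sup>2))"
proof -
  have "continuous_on {0..} w"
    using assms unfolding radial_weight_def
    by (intro DERIV_atLeastAtMost_imp_continuous_on continuous_at_imp_continuous_on) (auto intro: DERIV_isCont)
  then show "continuous_on S (\<lambda>x::real^'n. w ((norm x)\<^sup>2))"
    by (rule continuous_on_compose2) (auto intro!: continuous_intros)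
  have "continuous_on {0..} w'" using assms by (simp add: radial_weight_def)
  then show "continuous_on S (\<lambda>x::real^'n. w' ((norm x)\<^sup>2))"
    by (rule continuous_on_compose2) (auto intro!: continuous_intros)
qed

lemma has_derivative_norm2: "((\<lambda>x. (norm x)\<^sup>2) has_derivative (\<lambda>h. 2 * (x \<bullet> h))) (at x)"
  for x :: "real^'n"
  unfolding power2_norm_eq_inner by (auto intro!: derivative_eq_intros simp: inner_commute)

lemma has_derivative_radial_weight:
  assumes "radial_weight w w'"
  shows "((\<lambda>x::real^'n. w ((norm x)\<^sup>2)) has_derivative (\<lambda>h. w' ((norm x)\<^sup>2) * (2 * (x \<bullet> h)))) (at x)"
proof -
  have "(w has_derivative (*) (w' ((norm x)\<^sup>2))) (at ((norm x)\<^sup>2))"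
    using assms by (auto simp: radial_weight_def has_field_derivative_def)
  from has_derivative_compose[OF has_derivative_norm2 this] show ?thesis .
qed

text \<open>Support is demanded of the products, so that either factor may supply it: a cutoff
  weight when f is a polynomial or a shifted function, and f itself when the weight is
  \<open>1 / (s + e)^2\<close>.\<close>

lemma integral_radial_partial_deriv:
  fixes f :: "real^'n \<Rightarrow> real"
  assumes w: "radial_weight w w'" and f: "smooth f"
    and supp: "\<And>x. norm x > R \<Longrightarrow> w ((norm x)\<^sup>2) * f x = 0"
    and supp': "\<And>x. norm x > R \<Longrightarrow> w' ((norm x)\<^sup>2) * f x = 0"
  shows "(\<integral>x. w ((norm x)\<^sup>2) * partial_deriv i f x + w' ((norm x)\<^sup>2) * (2 * x $ i) * f x \<partial>lborel) = 0"
    and "integrable lborel (\<lambda>x. w' ((norm x)\<^sup>2) * (2 * x $ i) * f x)"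
    and "integrable lborel (\<lambda>x. w ((norm x)\<^sup>2) * partial_deriv i f x)"
    and "(\<integral>x. w ((norm x)\<^sup>2) * partial_deriv i f x \<partial>lborel) = - (\<integral>x. w' ((norm x)\<^sup>2) * (2 * x $ i) * f x \<partial>lborel)"
proof -
  let ?D = "\<lambda>x h. w ((norm x)\<^sup>2) * (\<Sum>k\<in>UNIV. h $ k * partial_deriv k f x) + (w' ((norm x)\<^sup>2) * (2 * (x \<bullet> h))) * f x"
  have D: "((\<lambda>x. w ((norm x)\<^sup>2) * f x) has_derivative ?D x) (at x)" for x
    by (intro has_derivative_mult has_derivative_radial_weight[OF w] has_derivative_partial_deriv
        smooth_differentiable[OF f])
  have Di: "?D x (axis i 1) = w ((norm x)\<^sup>2) * partial_deriv i f x + w' ((norm x)\<^sup>2) * (2 * x $ i) * f x" for x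
    by (simp add: axis_def inner_vec_def if_distrib if_distribR cong: if_cong)
  note cs = radial_weight_continuous[OF w] smooth_continuous[OF f] smooth_continuous[OF smooth_partial_deriv[OF f]]
  have c: "continuous_on UNIV (\<lambda>x. ?D x (axis i 1))"
    unfolding Di by (intro continuous_intros cs)
  show int: "(\<integral>x. w ((norm x)\<^sup>2) * partial_deriv i f x + w' ((norm x)\<^sup>2) * (2 * x $ i) * f x \<partial>lborel) = 0"
    using integral_partial_deriv_eq_0[OF D c supp] unfolding Di .
  show I1: "integrable lborel (\<lambda>x. w' ((norm x)\<^sup>2) * (2 * x $ i) * f x)"
  proof (rule integrable_continuous_bounded_support)
    show "continuous_on UNIV (\<lambda>x. w' ((norm x)\<^sup>2) * (2 * x $ i) * f x)" by (intro continuous_intros cs)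
  qed (use supp' in auto)
  show I2: "integrable lborel (\<lambda>x. w ((norm x)\<^sup>2) * partial_deriv i f x)"
  proof (rule integrable_continuous_bounded_support)
    show "continuous_on UNIV (\<lambda>x. w ((norm x)\<^sup>2) * partial_deriv i f x)" by (intro continuous_intros cs)
    fix x :: "real^'n" assume x: "norm x > R"
    \<comment> \<open>Outside the ball the product is locally 0, hence so is its derivative; the
      part containing \<open>w'\<close> vanishes by \<open>supp'\<close>, which leaves the part
      containing the derivative of f.\<close>
    have "open {x. norm x > R}" by (intro open_Collect_less continuous_intros)
    then have "((\<lambda>x. 0) has_derivative ?D x) (at x)"
      by (intro has_derivative_transform_within_open[OF D, where s = "{x. norm x > R}"]) (use x supp in auto)
    then have "?D x = (\<lambda>h. 0)" using has_derivative_unique has_derivative_const by blast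
    then have "?D x (axis i 1) = 0" by metis
    then show "w ((norm x)\<^sup>2) * partial_deriv i f x = 0" using supp'[OF x] unfolding Di by auto
  qed
  show "(\<integral>x. w ((norm x)\<^sup>2) * partial_deriv i f x \<partial>lborel) = - (\<integral>x. w' ((norm x)\<^sup>2) * (2 * x $ i) * f x \<partial>lborel)"
    using int by (subst (asm) Bochner_Integration.integral_add[OF I2 I1]) simp
qed

text \<open>The vector field \<open>w (|x|^2) x\<close> has divergence
  \<open>N w + 2 |x|^2 w'\<close>. The coordinate identity is applied to \<open>x $ i * f x\<close>
  and summed over i.\<close>

lemma integral_radial_euler:
  fixes f :: "real^'n \<Rightarrow> real"
  assumes w: "radial_weight w w'" and f: "smooth f"
    and supp: "\<And>x. norm x > R \<Longrightarrow> w ((norm x)\<^sup>2) * f x = 0"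
    and supp': "\<And>x. norm x > R \<Longrightarrow> w' ((norm x)\<^sup>2) * f x = 0"
  shows "integrable lborel (\<lambda>x. w ((norm x)\<^sup>2) * euler f x)"
    and "integrable lborel (\<lambda>x. (real CARD('n) * w ((norm x)\<^sup>2) + 2 * (norm x)\<^sup>2 * w' ((norm x)\<^sup>2)) * f x)"
    and "(\<integral>x. w ((norm x)\<^sup>2) * euler f x \<partial>lborel) =
     - (\<integral>x. (real CARD('n) * w ((norm x)\<^sup>2) + 2 * (norm x)\<^sup>2 * w' ((norm x)\<^sup>2)) * f x \<partial>lborel)"
proof -
  note cs = radial_weight_continuous[OF w] smooth_continuous[OF f]
  have pi: "partial_deriv i (\<lambda>x. x $ i * f x) = (\<lambda>x. x $ i * partial_deriv i f x + f x)" for i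
    by (simp add: pd_mult smooth_coord f)
  have *: "norm x > R \<Longrightarrow> w ((norm x)\<^sup>2) * (x $ i * f x) = 0"
    "norm x > R \<Longrightarrow> w' ((norm x)\<^sup>2) * (x $ i * f x) = 0" for x i using supp[of x] supp'[of x] by auto
  note R = integral_radial_partial_deriv[where i=i and f="\<lambda>x. x $ i * f x" for i, OF w smooth_mult[OF smooth_coord f] *, unfolded pi]
  have P2: "integrable lborel (\<lambda>x. w' ((norm x)\<^sup>2) * (2 * x $ i) * (x $ i * f x))" for i
    by (rule R(2))
  have P3: "integrable lborel (\<lambda>x. w ((norm x)\<^sup>2) * (x $ i * partial_deriv i f x + f x))" for i
    by (rule R(3))
  have P4: "(\<integral>x. w ((norm x)\<^sup>2) * (x $ i * partial_deriv i f x + f x) \<partial>lborel) =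
      - (\<integral>x. w' ((norm x)\<^sup>2) * (2 * x $ i) * (x $ i * f x) \<partial>lborel)" for i
    by (rule R(4))
  have s1: "(\<lambda>x. \<Sum>i\<in>UNIV. w ((norm x)\<^sup>2) * (x $ i * partial_deriv i f x + f x)) =
      (\<lambda>x. w ((norm x)\<^sup>2) * euler f x + real CARD('n) * w ((norm x)\<^sup>2) * f x)"
    by (auto simp: euler_def algebra_simps sum.distrib sum_distrib_left)
  have s2: "(\<lambda>x. \<Sum>i\<in>UNIV. w' ((norm x)\<^sup>2) * (2 * x $ i) * (x $ i * f x)) =
      (\<lambda>x. 2 * (norm x)\<^sup>2 * w' ((norm x)\<^sup>2) * f x)"
    by (auto simp: norm2_eq_sum[of x for x] algebra_simps sum_distrib_left sum_distrib_right)
  have J1: "integrable lborel (\<lambda>x. w ((norm x)\<^sup>2) * euler f x + real CARD('n) * w ((norm x)\<^sup>2) * f x)"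
    unfolding s1[symmetric] by (intro Bochner_Integration.integrable_sum P3)
  have J2: "integrable lborel (\<lambda>x. 2 * (norm x)\<^sup>2 * w' ((norm x)\<^sup>2) * f x)"
    unfolding s2[symmetric] by (intro Bochner_Integration.integrable_sum P2)
  have J3: "integrable lborel (\<lambda>x. real CARD('n) * w ((norm x)\<^sup>2) * f x)"
  proof (rule integrable_continuous_bounded_support)
    show "continuous_on UNIV (\<lambda>x. real CARD('n) * w ((norm x)\<^sup>2) * f x)" by (intro continuous_intros cs)
  qed (use supp in auto)
  show J4: "integrable lborel (\<lambda>x. w ((norm x)\<^sup>2) * euler f x)"
    using Bochner_Integration.integrable_diff[OF J1 J3] by simp
  show "integrable lborel (\<lambda>x. (real CARD('n) * w ((norm x)\<^sup>2) + 2 * (norm x)\<^sup>2 * w' ((norm x)\<^sup>2)) * f x)"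
    using Bochner_Integration.integrable_add[OF J3 J2] by (simp add: algebra_simps)
  have "(\<integral>x. w ((norm x)\<^sup>2) * euler f x + real CARD('n) * w ((norm x)\<^sup>2) * f x \<partial>lborel)
     = - (\<integral>x. 2 * (norm x)\<^sup>2 * w' ((norm x)\<^sup>2) * f x \<partial>lborel)"
    unfolding s1[symmetric] s2[symmetric] Bochner_Integration.integral_sum[OF P3]
      Bochner_Integration.integral_sum[OF P2] P4 sum_negf ..
  then have "(\<integral>x. w ((norm x)\<^sup>2) * euler f x \<partial>lborel) = - (\<integral>x. real CARD('n) * w ((norm x)\<^sup>2) * f x \<partial>lborel)
     - (\<integral>x. 2 * (norm x)\<^sup>2 * w' ((norm x)\<^sup>2) * f x \<partial>lborel)"
    by (subst (asm) Bochner_Integration.integral_add[OF J4 J3]) simp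
  also have "\<dots> = - (\<integral>x. (real CARD('n) * w ((norm x)\<^sup>2) + 2 * (norm x)\<^sup>2 * w' ((norm x)\<^sup>2)) * f x \<partial>lborel)"
    using Bochner_Integration.integral_add[OF J3 J2] by (simp add: algebra_simps)
  finally show "(\<integral>x. w ((norm x)\<^sup>2) * euler f x \<partial>lborel) =
     - (\<integral>x. (real CARD('n) * w ((norm x)\<^sup>2) + 2 * (norm x)\<^sup>2 * w' ((norm x)\<^sup>2)) * f x \<partial>lborel)" .
qed

text \<open>Rotation fields are divergence free and tangent to spheres: \<open>rot i j f\<close> is
  a difference of two partial derivatives of products, and the two terms in which the weight is
  differentiated cancel.\<close>

lemma integral_radial_rot:
  fixes f :: "real^'n \<Rightarrow> real"
  assumes w: "radial_weight w w'" and f: "smooth f"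
    and supp: "\<And>x. norm x > R \<Longrightarrow> w ((norm x)\<^sup>2) * f x = 0"
    and supp': "\<And>x. norm x > R \<Longrightarrow> w' ((norm x)\<^sup>2) * f x = 0"
  shows "integrable lborel (\<lambda>x. w ((norm x)\<^sup>2) * rot i j f x)"
    and "(\<integral>x. w ((norm x)\<^sup>2) * rot i j f x \<partial>lborel) = 0"
proof -
  have *: "norm x > R \<Longrightarrow> w ((norm x)\<^sup>2) * (x $ i * f x) = 0"
    "norm x > R \<Longrightarrow> w' ((norm x)\<^sup>2) * (x $ i * f x) = 0" for x i using supp[of x] supp'[of x] by auto
  note R = integral_radial_partial_deriv[OF w smooth_mult[OF smooth_coord f] *]
  have P: "(\<integral>x. w ((norm x)\<^sup>2) * partial_deriv a (\<lambda>x. x $ b * f x) x \<partial>lborel)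
      = - (\<integral>x. w' ((norm x)\<^sup>2) * (2 * x $ a) * (x $ b * f x) \<partial>lborel)" for a b
    by (rule R(4))
  have Q: "integrable lborel (\<lambda>x. w ((norm x)\<^sup>2) * partial_deriv a (\<lambda>x. x $ b * f x) x)" for a b
    by (rule R(3))
  have r: "rot i j f x = partial_deriv j (\<lambda>x. x $ i * f x) x - partial_deriv i (\<lambda>x. x $ j * f x) x" for x
    by (simp add: rot_def pd_mult smooth_coord f)
  have e: "(\<lambda>x. w ((norm x)\<^sup>2) * rot i j f x) =
     (\<lambda>x. w ((norm x)\<^sup>2) * partial_deriv j (\<lambda>x. x $ i * f x) x - w ((norm x)\<^sup>2) * partial_deriv i (\<lambda>x. x $ j * f x) x)"
    by (simp add: r algebra_simps)
  show "integrable lborel (\<lambda>x. w ((norm x)\<^sup>2) * rot i j f x)"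
    unfolding e by (intro Bochner_Integration.integrable_diff Q)
  show "(\<integral>x. w ((norm x)\<^sup>2) * rot i j f x \<partial>lborel) = 0"
    unfolding e Bochner_Integration.integral_diff[OF Q Q] P by (simp add: mult_ac)
qed

section \<open>Spectral gap of the spherical Laplacian\<close>

text \<open>The weight carries the bounded support because it is paired with polynomials and with
  \<open>v - v 0\<close>. The bound R refers to \<open>s = |x|^2\<close>, not to the norm.\<close>

definition cutoff_weight :: "(real \<Rightarrow> real) \<Rightarrow> (real \<Rightarrow> real) \<Rightarrow> bool" where
  "cutoff_weight w w' \<longleftrightarrow> radial_weight w w' \<and> (\<forall>s\<ge>0. 0 \<le> w s) \<and>
     (\<exists>R\<ge>0. \<forall>s>R. w s = 0 \<and> w' s = 0)"

lemma cutoff_weightE: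
  assumes "cutoff_weight w w'"
  obtains R where "radial_weight w w'" "\<And>s. s \<ge> 0 \<Longrightarrow> 0 \<le> w s"
    "\<And>x::real^'n. norm x > R \<Longrightarrow> w ((norm x)\<^sup>2) = 0" "\<And>x::real^'n. norm x > R \<Longrightarrow> w' ((norm x)\<^sup>2) = 0"
proof -
  obtain R where R: "R \<ge> 0" "\<And>s. s > R \<Longrightarrow> w s = 0 \<and> w' s = 0"
    using assms by (auto simp: cutoff_weight_def)
  have "(norm x)\<^sup>2 > R" if "norm x > sqrt R" for x :: "real^'n"
    using that R(1) by (metis real_sqrt_less_iff real_sqrt_unique norm_ge_zero)
  with R(2) that[of "sqrt R"] assms show ?thesis by (auto simp: cutoff_weight_def)
qed

definition wint :: "(real \<Rightarrow> real) \<Rightarrow> (real^'n \<Rightarrow> real) \<Rightarrow> real" where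
  "wint w h = (\<integral>x. w ((norm x)\<^sup>2) * h x \<partial>lborel)"

context
  fixes w w' :: "real \<Rightarrow> real"
  assumes w: "cutoff_weight w w'"
begin

lemma wint_integrable:
  fixes h :: "real^'n \<Rightarrow> real"
  assumes "continuous_on UNIV h"
  shows "integrable lborel (\<lambda>x. w ((norm x)\<^sup>2) * h x)"
proof -
  obtain R where R: "radial_weight w w'" "\<And>x::real^'n. norm x > R \<Longrightarrow> w ((norm x)\<^sup>2) = 0"
    using cutoff_weightE[OF w, where 'n='n] by metis
  show ?thesis
    by (rule integrable_continuous_bounded_support[of _ R])
      (auto intro!: continuous_intros radial_weight_continuous[OF R(1)] assms R(2))
qed

lemma wint_add: "continuous_on UNIV f \<Longrightarrow> continuous_on UNIV g \<Longrightarrow> wint w (\<lambda>x. f x + g x) = wint w f + wint w g"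
  by (simp add: wint_def distrib_left wint_integrable)

lemma wint_diff: "continuous_on UNIV f \<Longrightarrow> continuous_on UNIV g \<Longrightarrow> wint w (\<lambda>x. f x - g x) = wint w f - wint w g"
  by (simp add: wint_def right_diff_distrib wint_integrable)

lemma wint_cmult: "wint w (\<lambda>x. c * f x) = c * wint w f"
  by (simp add: wint_def mult.left_commute)

lemma wint_sum: "(\<And>i. i \<in> I \<Longrightarrow> continuous_on UNIV (f i)) \<Longrightarrow> wint w (\<lambda>x. \<Sum>i\<in>I. f i x) = (\<Sum>i\<in>I. wint w (f i))"
  by (simp add: wint_def sum_distrib_left wint_integrable)

lemma wint_mono:
  "continuous_on UNIV f \<Longrightarrow> continuous_on UNIV g \<Longrightarrow> (\<And>x. f x \<le> g x) \<Longrightarrow> wint w f \<le> wint w g"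
  unfolding wint_def using w
  by (intro Bochner_Integration.integral_mono wint_integrable mult_left_mono) (auto simp: cutoff_weight_def)

lemma wint_nonneg: "(\<And>x. 0 \<le> f x) \<Longrightarrow> 0 \<le> wint w f"
  unfolding wint_def using w
  by (intro Bochner_Integration.integral_nonneg mult_nonneg_nonneg) (auto simp: cutoff_weight_def)

lemma wint_sq_diff:
  assumes "smooth f" "smooth g"
  shows "wint w (\<lambda>x. (f x - c * g x)\<^sup>2) =
    wint w (\<lambda>x. (f x)\<^sup>2) - 2 * c * wint w (\<lambda>x. f x * g x) + c\<^sup>2 * wint w (\<lambda>x. (g x)\<^sup>2)"
proof -
  have eq: "(\<lambda>x. (f x - c * g x)\<^sup>2) = (\<lambda>x. ((f x)\<^sup>2 - 2 * c * (f x * g x)) + c\<^sup>2 * (g x)\<^sup>2)"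
    by (simp add: power2_eq_square algebra_simps)
  note c = continuous_intros smooth_continuous assms
  have "wint w (\<lambda>x. ((f x)\<^sup>2 - 2 * c * (f x * g x)) + c\<^sup>2 * (g x)\<^sup>2) =
      wint w (\<lambda>x. (f x)\<^sup>2 - 2 * c * (f x * g x)) + wint w (\<lambda>x. c\<^sup>2 * (g x)\<^sup>2)"
    by (rule wint_add) (intro c)+
  also have "wint w (\<lambda>x. (f x)\<^sup>2 - 2 * c * (f x * g x)) = wint w (\<lambda>x. (f x)\<^sup>2) - wint w (\<lambda>x. 2 * c * (f x * g x))"
    by (rule wint_diff) (intro c)+
  finally show ?thesis unfolding eq wint_cmult .
qed

lemma wint_rot_parts:
  assumes "smooth f" "smooth g"
  shows "wint w (\<lambda>x. f x * rot i j g x) = - wint w (\<lambda>x. rot i j f x * g x)"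
proof -
  obtain R where R: "radial_weight w w'" "\<And>x::real^'a. norm x > R \<Longrightarrow> w ((norm x)\<^sup>2) = 0"
    "\<And>x::real^'a. norm x > R \<Longrightarrow> w' ((norm x)\<^sup>2) = 0"
    using cutoff_weightE[OF w, where 'n='a] by metis
  have "wint w (rot i j (\<lambda>x. f x * g x)) = 0"
    unfolding wint_def by (rule integral_radial_rot(2)[OF R(1) smooth_mult[OF assms], of R]) (simp_all add: R)
  then show ?thesis
    using assms by (simp add: rot_mult wint_add smooth_continuous smooth_mult smooth_rot)
qed

text \<open>Antisymmetry of each rotation field turns L into its Dirichlet form. The form is
  symmetric in f and g, which gives self-adjointness, and its diagonal is the cross term of the
  final estimate.\<close>

lemma wint_sph_parts:
  assumes "smooth f" "smooth g"
  shows "wint w (\<lambda>x. f x * sph g x) = 1/2 * wint w (\<lambda>x. \<Sum>i\<in>UNIV. \<Sum>j\<in>UNIV. rot i j f x * rot i j g x)"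
proof -
  have "wint w (\<lambda>x. f x * sph g x) = wint w (\<lambda>x. - (1/2) * (\<Sum>i\<in>UNIV. \<Sum>j\<in>UNIV. f x * rot i j (rot i j g) x))"
    by (simp add: sph_def sum_distrib_left mult_ac)
  also have "\<dots> = - (1/2) * (\<Sum>i\<in>UNIV. \<Sum>j\<in>UNIV. wint w (\<lambda>x. f x * rot i j (rot i j g) x))"
    by (simp only: wint_cmult) (simp add: wint_sum smooth_continuous smooth_sum smooth_mult smooth_rot assms)
  also have "\<dots> = 1/2 * (\<Sum>i\<in>UNIV. \<Sum>j\<in>UNIV. wint w (\<lambda>x. rot i j f x * rot i j g x))"
    by (simp add: wint_rot_parts assms smooth_rot sum_negf)
  also have "\<dots> = 1/2 * wint w (\<lambda>x. \<Sum>i\<in>UNIV. \<Sum>j\<in>UNIV. rot i j f x * rot i j g x)"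
    by (simp add: wint_sum smooth_continuous smooth_sum smooth_mult smooth_rot assms)
  finally show ?thesis .
qed

lemma wint_sph_sym:
  assumes "smooth f" "smooth g"
  shows "wint w (\<lambda>x. f x * sph g x) = wint w (\<lambda>x. sph f x * g x)"
  using wint_sph_parts[OF assms] wint_sph_parts[OF assms(2,1)] by (simp add: mult.commute)

lemma wint_sph_orthogonal:
  assumes "smooth f" "smooth g" "sph f = (\<lambda>x. c * f x)" "sph g = (\<lambda>x. d * g x)" "c \<noteq> d"
  shows "wint w (\<lambda>x. f x * g x) = 0"
proof -
  have "d * wint w (\<lambda>x. f x * g x) = c * wint w (\<lambda>x. f x * g x)"
    using wint_sph_sym[OF assms(1,2)] unfolding assms(3,4) wint_cmult[symmetric] by (simp add: mult_ac)
  with assms(5) show ?thesis by simp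
qed

text \<open>Pythagoras: different indices have different eigenvalues, so self-adjointness of L kills
  all cross terms.\<close>

lemma wint_sph_decomp_sq:
  fixes q :: "nat \<Rightarrow> real^'n \<Rightarrow> real"
  assumes N: "CARD('n) \<ge> 3" and s: "\<And>k. smooth (q k)" and e: "\<And>k. sph (q k) = (\<lambda>x. sph_ev CARD('n) k * q k x)"
  shows "wint w (\<lambda>x. (\<Sum>k\<le>n. q k x)\<^sup>2) = (\<Sum>k\<le>n. wint w (\<lambda>x. (q k x)\<^sup>2))"
proof -
  have ne: "sph_ev CARD('n) k \<noteq> sph_ev CARD('n) l" if "k \<noteq> l" for k l
    using that sph_ev_less[OF N] by (metis linorder_neqE_nat less_irrefl)
  have "wint w (\<lambda>x. (\<Sum>k\<le>n. q k x)\<^sup>2) = (\<Sum>k\<le>n. \<Sum>l\<le>n. wint w (\<lambda>x. q k x * q l x))"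
    by (simp add: power2_eq_square sum_product wint_sum smooth_continuous smooth_sum smooth_mult s)
  also have "\<dots> = (\<Sum>k\<le>n. \<Sum>l\<le>n. if l = k then wint w (\<lambda>x. (q k x)\<^sup>2) else 0)"
    by (intro sum.cong refl) (auto simp: power2_eq_square intro: wint_sph_orthogonal[OF s s e e ne])
  also have "\<dots> = (\<Sum>k\<le>n. wint w (\<lambda>x. (q k x)\<^sup>2))" by simp
  finally show ?thesis .
qed

text \<open>Duality: for a polynomial \<open>p\<close> with eigencomponents \<open>p\<^sub>k\<close> and
  \<open>u = \<Sum> p\<^sub>k / (c\<^sub>k - b)\<close>, one has \<open>\<langle>f, p\<rangle> = \<langle>(L - b) f, u\<rangle>\<close> and
  \<open>\<delta> \<parallel>u\<parallel> \<le> \<parallel>p\<parallel>\<close>; letting \<open>p\<close> approximate \<open>f\<close> gives the bound.\<close>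

lemma wint_sph_gap:
  fixes f :: "real^'n \<Rightarrow> real"
  assumes N: "CARD('n) \<ge> 3" and f: "smooth f"
    and gap: "\<And>k. \<delta> \<le> (sph_ev CARD('n) k - b)\<^sup>2"
  shows "\<delta> * wint w (\<lambda>x. (f x)\<^sup>2) \<le> wint w (\<lambda>x. (sph f x - b * f x)\<^sup>2)"
proof (cases "\<delta> \<le> 0")
  case True
  then have "\<delta> * wint w (\<lambda>x. (f x)\<^sup>2) \<le> 0" by (intro mult_nonpos_nonneg wint_nonneg) auto
  also have "0 \<le> wint w (\<lambda>x. (sph f x - b * f x)\<^sup>2)" by (intro wint_nonneg) auto
  finally show ?thesis .
next
  case False
  let ?c = "sph_ev CARD('n)"
  let ?h = "\<lambda>x. sph f x - b * f x"
  have sh: "smooth ?h" by (intro smooth_intros smooth_sph f)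
  have cb: "?c k - b \<noteq> 0" for k using gap[of k] False by auto
  \<comment> \<open>The approximation error enters only as an additive term in the plain weighted
    norm, so uniform approximation of f suffices; its derivatives need not be approximated.\<close>
  have main: "\<delta> * wint w (\<lambda>x. (f x)\<^sup>2) \<le> wint w (\<lambda>x. (?h x)\<^sup>2) + \<delta> * wint w (\<lambda>x. (f x - p x)\<^sup>2)"
    if p: "real_polynomial_function p" for p
  proof -
    obtain n q where "sph_decomp p n q"
      using real_polynomial_function_sph_decomp[OF p N] by blast
    then have sq: "smooth (q k)" and eq: "sph (q k) = (\<lambda>x. ?c k * q k x)"
      and pq: "p = (\<lambda>x. \<Sum>k\<le>n. q k x)" for k
      by (auto simp: sph_decomp_def)
    define r where "r k = (\<lambda>x. inverse (?c k - b) * q k x)" for k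
    have sr: "smooth (r k)" for k unfolding r_def by (intro smooth_intros sq)
    have er: "sph (r k) = (\<lambda>x. ?c k * r k x)" for k
      unfolding r_def sph_cmult[OF sq] eq by (simp add: mult.left_commute)
    define u where "u = (\<lambda>x. \<Sum>k\<le>n. r k x)"
    have su: "smooth u" unfolding u_def by (intro smooth_intros sr)
    have sp: "smooth p" unfolding pq by (intro smooth_intros sq)
    have "sph u x - b * u x = p x" for x
    proof -
      have "sph u x - b * u x = (\<Sum>k\<le>n. (?c k - b) * r k x)"
        by (simp add: u_def sph_sum sr er sum_distrib_left sum_subtractf left_diff_distrib)
      also have "\<dots> = p x" using cb by (simp add: pq r_def mult.assoc[symmetric])
      finally show ?thesis .
    qed
    then have "wint w (\<lambda>x. f x * p x) = wint w (\<lambda>x. f x * sph u x - b * (f x * u x))"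
      by (simp add: algebra_simps flip: \<open>\<And>x. sph u x - b * u x = p x\<close>)
    also have "\<dots> = wint w (\<lambda>x. ?h x * u x)"
      using wint_sph_sym[OF f su]
      by (simp add: left_diff_distrib wint_diff wint_cmult smooth_continuous smooth_mult smooth_cmult smooth_sph f su mult.assoc)
    finally have fp: "wint w (\<lambda>x. f x * p x) = wint w (\<lambda>x. ?h x * u x)" .
    have "\<delta> * wint w (\<lambda>x. (u x)\<^sup>2) = (\<Sum>k\<le>n. \<delta> * wint w (\<lambda>x. (r k x)\<^sup>2))"
      unfolding u_def by (simp add: wint_sph_decomp_sq[OF N sr er] sum_distrib_left)
    also have "\<dots> \<le> (\<Sum>k\<le>n. wint w (\<lambda>x. (q k x)\<^sup>2))"
    proof (rule sum_mono)
      fix k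
      have "\<delta> * wint w (\<lambda>x. (r k x)\<^sup>2) \<le> (?c k - b)\<^sup>2 * wint w (\<lambda>x. (r k x)\<^sup>2)"
        by (intro mult_right_mono gap wint_nonneg) auto
      also have "\<dots> = wint w (\<lambda>x. (q k x)\<^sup>2)"
        using cb[of k] by (simp add: r_def power_mult_distrib wint_cmult flip: power_mult_distrib[of "_ - _" "inverse _"] mult.assoc)
      finally show "\<delta> * wint w (\<lambda>x. (r k x)\<^sup>2) \<le> wint w (\<lambda>x. (q k x)\<^sup>2)" .
    qed
    also have "\<dots> = wint w (\<lambda>x. (p x)\<^sup>2)"
      unfolding pq by (rule wint_sph_decomp_sq[OF N sq eq, symmetric])
    finally have up: "\<delta> * wint w (\<lambda>x. (u x)\<^sup>2) \<le> wint w (\<lambda>x. (p x)\<^sup>2)" .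
    \<comment> \<open>With this factor the cross term becomes
      \<open>2 \<delta> \<langle>f, p\<rangle>\<close> by duality and the last term is at most
      \<open>\<delta> \<parallel>p\<parallel>^2\<close>; together they are
      \<open>\<delta> \<parallel>f\<parallel>^2\<close> minus \<open>\<delta>\<close> times the
      squared approximation error.\<close>
    have "0 \<le> wint w (\<lambda>x. (?h x - \<delta> * u x)\<^sup>2)" by (intro wint_nonneg) auto
    also have "\<dots> = wint w (\<lambda>x. (?h x)\<^sup>2) - 2 * \<delta> * wint w (\<lambda>x. ?h x * u x) + \<delta>\<^sup>2 * wint w (\<lambda>x. (u x)\<^sup>2)"
      by (rule wint_sq_diff[OF sh su])
    also have "\<delta>\<^sup>2 * wint w (\<lambda>x. (u x)\<^sup>2) \<le> \<delta> * wint w (\<lambda>x. (p x)\<^sup>2)"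
      using mult_left_mono[OF up, of \<delta>] False by (simp add: power2_eq_square mult.assoc)
    finally have 1: "0 \<le> wint w (\<lambda>x. (?h x)\<^sup>2) - 2 * \<delta> * wint w (\<lambda>x. f x * p x) + \<delta> * wint w (\<lambda>x. (p x)\<^sup>2)"
      unfolding fp by simp
    have 2: "wint w (\<lambda>x. (f x - p x)\<^sup>2) = wint w (\<lambda>x. (f x)\<^sup>2) - 2 * wint w (\<lambda>x. f x * p x) + wint w (\<lambda>x. (p x)\<^sup>2)"
      using wint_sq_diff[OF f sp, of 1] by simp
    show ?thesis using 1 unfolding 2 by (simp add: algebra_simps)
  qed
  show ?thesis
  proof (rule field_le_epsilon)
    fix e :: real assume e: "e > 0"
    obtain R where R: "\<And>x::real^'n. norm x > R \<Longrightarrow> w ((norm x)\<^sup>2) = 0"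
      using cutoff_weightE[OF w, where 'n='n] by metis
    define M where "M = wint w (\<lambda>x::real^'n. 1)"
    have M: "M \<ge> 0" unfolding M_def by (intro wint_nonneg) auto
    \<comment> \<open>Uniform accuracy d on the ball carrying the weight costs at most
      \<open>\<delta> * (d^2 * M)\<close>, which must not exceed e; the summand 1 covers total mass
      \<open>M = 0\<close>.\<close>
    define d where "d = sqrt (e / (\<delta> * (M + 1)))"
    have d: "d > 0" "\<delta> * (d\<^sup>2 * M) \<le> e"
    proof -
      show "d > 0" using e M False by (simp add: d_def)
      have "d\<^sup>2 = e / (\<delta> * (M + 1))" unfolding d_def using e M False by (subst real_sqrt_pow2) auto
      then have "\<delta> * (d\<^sup>2 * M) = (\<delta> * (e * M)) / (\<delta> * (M + 1))" by simp
      also have "\<dots> = e * (M / (M + 1))"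
        using False by (subst nonzero_mult_divide_mult_cancel_left) auto
      also have "\<dots> \<le> e * 1" using e M by (intro mult_left_mono) auto
      finally show "\<delta> * (d\<^sup>2 * M) \<le> e" by simp
    qed
    obtain p where p: "real_polynomial_function p" "\<And>x. x \<in> cball 0 R \<Longrightarrow> \<bar>f x - p x\<bar> < d"
      using Stone_Weierstrass_real_polynomial_function[OF compact_cball smooth_continuous[OF f] d(1)] by metis
    have cp: "continuous_on UNIV p"
      using p(1) by (simp add: real_polynomial_function_eq continuous_on_polymonial_function)
    have "wint w (\<lambda>x. (f x - p x)\<^sup>2) \<le> wint w (\<lambda>x::real^'n. d\<^sup>2 * 1)"
      unfolding wint_def
    proof (rule Bochner_Integration.integral_mono)
      show "integrable lborel (\<lambda>x. w ((norm x)\<^sup>2) * (f x - p x)\<^sup>2)"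
        by (intro wint_integrable continuous_intros cp smooth_continuous f)
      show "integrable lborel (\<lambda>x::real^'n. w ((norm x)\<^sup>2) * (d\<^sup>2 * 1))"
        by (intro wint_integrable continuous_intros)
      show "w ((norm x)\<^sup>2) * (f x - p x)\<^sup>2 \<le> w ((norm x)\<^sup>2) * (d\<^sup>2 * 1)" for x
      proof (cases "norm x > R")
        case False
        then have "\<bar>f x - p x\<bar> \<le> d" using p(2)[of x] by auto
        then have "(f x - p x)\<^sup>2 \<le> d\<^sup>2" by (simp add: abs_le_square_iff[symmetric])
        then show ?thesis using w by (intro mult_left_mono) (auto simp: cutoff_weight_def)
      qed (simp add: R)
    qed
    also have "\<dots> = d\<^sup>2 * M" unfolding M_def by (rule wint_cmult)
    finally have "\<delta> * wint w (\<lambda>x. (f x - p x)\<^sup>2) \<le> \<delta> * (d\<^sup>2 * M)"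
      using False by (intro mult_left_mono) auto
    with main[OF p(1)] d(2) show "\<delta> * wint w (\<lambda>x. (f x)\<^sup>2) \<le> wint w (\<lambda>x. (?h x)\<^sup>2) + e" by linarith
  qed
qed

end

section \<open>The singular weight \<open>|x|\<^sup>-\<^sup>4\<close>\<close>

text \<open>Squaring makes the truncation continuously differentiable at 0; this is why the cutoff
  factor of \<open>Wt\<close> is squared.\<close>

lemma DERIV_max0_sq: "((\<lambda>y. (max 0 y)\<^sup>2) has_real_derivative 2 * max 0 y) (at y)"
proof -
  consider "y > 0" | "y < 0" | "y = 0" by linarith
  then show ?thesis
  proof cases
    case 1
    have "((\<lambda>y. y\<^sup>2) has_real_derivative 2 * max 0 y) (at y)"
      using 1 by (auto intro!: derivative_eq_intros)
    then show ?thesis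
      by (rule has_field_derivative_transform_within_open[of _ _ _ "{0<..}"]) (use 1 in auto)
  next
    case 2
    have "((\<lambda>y. 0) has_real_derivative 2 * max 0 y) (at y)"
      using 2 by (auto intro!: derivative_eq_intros)
    then show ?thesis
      by (rule has_field_derivative_transform_within_open[of _ _ _ "{..<0}"]) (use 2 in auto)
  next
    case 3
    have "(\<lambda>h::real. (max 0 h)\<^sup>2 / h) \<midarrow>0\<rightarrow> 0"
    proof (rule Lim_null_comparison)
      show "\<forall>\<^sub>F h::real in at 0. norm ((max 0 h)\<^sup>2 / h) \<le> \<bar>h\<bar>"
        by (auto simp: max_def power2_eq_square intro!: always_eventually)
      show "(\<lambda>h::real. \<bar>h\<bar>) \<midarrow>0\<rightarrow> 0" by (rule tendsto_rabs_zero) simp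
    qed
    then show ?thesis using 3 by (simp add: DERIV_def)
  qed
qed

text \<open>A truncated regularisation of \<open>|x|\<^sup>-\<^sup>4 = s\<^sup>-\<^sup>2\<close>.\<close>

definition Wt :: "real \<Rightarrow> real \<Rightarrow> real \<Rightarrow> real" where
  "Wt m e s = (max 0 (1 - s / m))\<^sup>2 / (s + e)\<^sup>2"

definition Wt' :: "real \<Rightarrow> real \<Rightarrow> real \<Rightarrow> real" where
  "Wt' m e s = - (2 / m) * max 0 (1 - s / m) / (s + e)\<^sup>2 - 2 * Wt m e s / (s + e)"

lemma DERIV_Wt:
  assumes "e > 0" "m > 0" "s \<ge> 0"
  shows "(Wt m e has_real_derivative Wt' m e s) (at s)"
proof -
  have "((\<lambda>s. 1 - s / m) has_real_derivative - (1 / m)) (at s)"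
    using assms by (auto intro!: derivative_eq_intros)
  from DERIV_chain2[OF DERIV_max0_sq this]
  have 1: "((\<lambda>s. (max 0 (1 - s / m))\<^sup>2) has_real_derivative 2 * max 0 (1 - s / m) * - (1 / m)) (at s)" .
  have 2: "((\<lambda>s. (s + e)\<^sup>2) has_real_derivative 2 * (s + e)) (at s)"
    by (auto intro!: derivative_eq_intros)
  have "(2 * max 0 (1 - s / m) * - (1 / m) * (s + e)\<^sup>2 - (max 0 (1 - s / m))\<^sup>2 * (2 * (s + e))) / ((s + e)\<^sup>2 * (s + e)\<^sup>2) = Wt' m e s"
  proof -
    have "(2 * y * - (1 / m) * t\<^sup>2 - y\<^sup>2 * (2 * t)) / (t\<^sup>2 * t\<^sup>2) = - (2 / m) * y / t\<^sup>2 - 2 * (y\<^sup>2 / t\<^sup>2) / t"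
      if "t \<noteq> 0" for y t :: real
      using that \<open>m > 0\<close> by (simp add: field_simps power2_eq_square)
    from this[of "s + e" "max 0 (1 - s / m)"] show ?thesis
      using assms by (simp add: Wt'_def Wt_def)
  qed
  with DERIV_divide[OF 1 2] assms show ?thesis by (simp add: Wt_def[abs_def])
qed

lemma cutoff_weight_Wt:
  assumes "e > 0" "m > 0"
  shows "cutoff_weight (Wt m e) (Wt' m e)"
proof -
  have "continuous_on {0..} (Wt' m e)"
    unfolding Wt'_def Wt_def using assms by (intro continuous_intros) (auto simp: add_eq_0_iff)
  moreover have "Wt m e s = 0 \<and> Wt' m e s = 0" if "s > m" for s
  proof -
    have "max 0 (1 - s / m) = 0" using that assms by (auto simp: max_def field_simps)
    then show ?thesis by (simp add: Wt_def Wt'_def)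
  qed
  then have "\<exists>R\<ge>0. \<forall>s>R. Wt m e s = 0 \<and> Wt' m e s = 0"
    using assms less_imp_le by blast
  moreover have "0 \<le> Wt m e s" for s by (simp add: Wt_def)
  ultimately show ?thesis
    using assms DERIV_Wt
    unfolding cutoff_weight_def radial_weight_def by auto
qed

lemma Wt_nonneg: "0 \<le> Wt m e s" by (simp add: Wt_def)

lemma max0_bounds: "s \<ge> 0 \<Longrightarrow> m > 0 \<Longrightarrow> 0 \<le> max 0 (1 - s / m) \<and> max 0 (1 - s / m) \<le> (1::real)"
  by simp

lemma Wt_le:
  assumes "e \<ge> 0" "m > 0" "s > 0"
  shows "Wt m e s \<le> 1 / s\<^sup>2"
proof -
  have "(max 0 (1 - s / m))\<^sup>2 \<le> 1" using max0_bounds[of s m] assms by (auto intro: power_le_one)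
  moreover have "s\<^sup>2 \<le> (s + e)\<^sup>2" using assms by (intro power_mono) auto
  ultimately show ?thesis unfolding Wt_def using assms by (intro frac_le) auto
qed

lemma Wt_le':
  assumes "e > 0" "m > 0" "s \<ge> 0"
  shows "Wt m e s \<le> 1 / (s + e)\<^sup>2"
proof -
  have "(max 0 (1 - s / m))\<^sup>2 \<le> 1" using max0_bounds[of s m] assms by (auto intro: power_le_one)
  then show ?thesis unfolding Wt_def by (intro divide_right_mono) auto
qed

text \<open>The left side is the divergence factor of \<open>integral_radial_euler\<close> in
  dimension c. On the right, \<open>s / (s + e)\<close> tends to 1 as e tends to 0, and the last
  term is the effect of the cutoff's slope, nonnegative before its sign and small for large
  m.\<close>

lemma Wt'_eq:
  "c * Wt m e s + 2 * s * Wt' m e s = c * Wt m e s - 4 * (s / (s + e)) * Wt m e s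
     - 4 * (s / m * max 0 (1 - s / m)) / (s + e)\<^sup>2"
  by (simp add: Wt'_def algebra_simps)

lemma cutoff_slope_bounds:
  fixes s m :: real
  assumes "s \<ge> 0" "m > 0"
  shows "0 \<le> s / m * max 0 (1 - s / m)" "s / m * max 0 (1 - s / m) \<le> 1" "s / m * max 0 (1 - s / m) \<le> s / m"
proof -
  show "0 \<le> s / m * max 0 (1 - s / m)"
    by (intro mult_nonneg_nonneg divide_nonneg_nonneg) (use assms in auto)
  show "s / m * max 0 (1 - s / m) \<le> s / m"
    using assms max0_bounds[OF assms] by (intro mult_right_le_one_le) auto
  show "s / m * max 0 (1 - s / m) \<le> 1"
  proof (cases "s \<le> m")
    case True
    then have "s / m * max 0 (1 - s / m) \<le> 1 * 1"
      using assms max0_bounds[OF assms] by (intro mult_mono) auto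
    then show ?thesis by simp
  next
    case False
    then have "max 0 (1 - s / m) = 0" using assms by (auto simp: max_def field_simps)
    then show ?thesis by simp
  qed
qed

text \<open>A bound uniform in e, for the local integrability of \<open>|x|^-2\<close> without polar
  coordinates. Integrating by parts against \<open>|x|^2\<close>, on which E acts as 2, shows that
  the integral of \<open>(2 + N - 4 s / (s + e)) Wt s\<close> minus the slope term is 0. The bracket
  is at least \<open>N - 2 >= 1\<close>, and the slope term is at most \<open>4 / m\<close> on the
  ball.\<close>

lemma wint_Wt_norm2_le:
  assumes N: "CARD('n) \<ge> 3" and "e > 0" "m > 0"
  shows "wint (Wt m e) (\<lambda>x::real^'n. (norm x)\<^sup>2) \<le> 4 / m * measure lborel (cball (0::real^'n) (sqrt m))"
proof -
  note cw = cutoff_weight_Wt[OF assms(2,3)]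
  let ?w = "Wt m e" let ?w' = "Wt' m e" let ?N = "real CARD('n)"
  let ?s = "\<lambda>x::real^'n. (norm x)\<^sup>2"
  have z: "?w (?s x) = 0" "?w' (?s x) = 0" if "norm x > sqrt m" for x :: "real^'n"
  proof -
    have "m < (norm x)\<^sup>2" using that assms by (metis real_sqrt_less_iff real_sqrt_unique norm_ge_zero)
    then have "max 0 (1 - ?s x / m) = 0" using assms by (auto simp: max_def field_simps)
    then show "?w (?s x) = 0" "?w' (?s x) = 0" by (simp_all add: Wt_def Wt'_def)
  qed
  have rw: "radial_weight ?w ?w'" using cw by (simp add: cutoff_weight_def)
  have ee: "euler ?s = (\<lambda>x. 2 * ?s x)"
    by (rule ext, simp add: euler_def pd_norm2) (simp add: norm2_eq_sum sum_distrib_left mult_ac)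
  note R = integral_radial_euler[OF rw smooth_norm2[where 'a='n], where R="sqrt m", unfolded ee]
  have i1: "integrable lborel (\<lambda>x::real^'n. ?w (?s x) * ?s x)"
    by (intro wint_integrable[OF cw] smooth_continuous smooth_norm2)
  have R3: "(\<integral>x. ?w (?s x) * (2 * ?s x) \<partial>lborel) =
    - (\<integral>x. (?N * ?w (?s x) + 2 * ?s x * ?w' (?s x)) * ?s x \<partial>lborel)"
    by (rule R(3)) (simp_all add: z)
  have i3: "integrable lborel (\<lambda>x::real^'n. ?w (?s x) * (2 * ?s x))"
    by (intro wint_integrable[OF cw] smooth_continuous smooth_cmult smooth_norm2)
  have i2: "integrable lborel (\<lambda>x::real^'n. (?N * ?w (?s x) + 2 * ?s x * ?w' (?s x)) * ?s x)"
    by (rule R(2)) (simp_all add: z)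
  have ic: "integrable lborel (\<lambda>x::real^'n. 4 / m * indicator (cball 0 (sqrt m)) x)"
    by (rule integrable_mult_right, rule integrable_real_indicator)
      (simp_all add: emeasure_bounded_finite[OF bounded_cball, unfolded infinity_ennreal_def])
  have "?w (?s x) * ?s x - 4 / m * indicator (cball 0 (sqrt m)) x \<le>
     ?w (?s x) * (2 * ?s x) + (?N * ?w (?s x) + 2 * ?s x * ?w' (?s x)) * ?s x" for x :: "real^'n"
  proof (cases "norm x \<le> sqrt m")
    case True
    define s where "s = ?s x"
    have s: "s \<ge> 0" by (simp add: s_def)
    have a: "4 * (s / m * max 0 (1 - s / m)) / (s + e)\<^sup>2 * s \<le> 4 / m"
    proof -
      have "4 * (s / m * max 0 (1 - s / m)) / (s + e)\<^sup>2 * s = 4 / m * (max 0 (1 - s / m) * (s / (s + e))\<^sup>2)"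
        by (simp add: power2_eq_square)
      also have "\<dots> \<le> 4 / m * (1 * 1)"
        using max0_bounds[OF s assms(3)] s assms(2,3) by (intro mult_left_mono mult_mono power_le_one) auto
      finally show ?thesis by simp
    qed
    have "s / (s + e) * ?w s \<le> ?w s"
      using s assms Wt_nonneg by (intro mult_left_le_one_le) auto
    then have "(s / (s + e) * ?w s) * s \<le> ?w s * s" using s by (intro mult_right_mono) auto
    moreover have "3 * (?w s * s) \<le> ?N * (?w s * s)"
      using N s Wt_nonneg[of m e s] by (intro mult_right_mono) auto
    moreover have "?w s * (2 * s) + (?N * ?w s + 2 * s * ?w' s) * s = 2 * (?w s * s) + ?N * (?w s * s)
      - 4 * ((s / (s + e) * ?w s) * s) - 4 * (s / m * max 0 (1 - s / m)) / (s + e)\<^sup>2 * s"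
      unfolding Wt'_eq by (simp add: algebra_simps)
    ultimately have "?w s * s - 4 / m \<le> ?w s * (2 * s) + (?N * ?w s + 2 * s * ?w' s) * s"
      using a by linarith
    then show ?thesis using True by (simp add: s_def)
  next
    case False
    then show ?thesis by (simp add: z)
  qed
  then have "(\<integral>x. ?w (?s x) * ?s x - 4 / m * indicator (cball 0 (sqrt m)) x \<partial>lborel) \<le>
    (\<integral>x. ?w (?s x) * (2 * ?s x) + (?N * ?w (?s x) + 2 * ?s x * ?w' (?s x)) * ?s x \<partial>lborel)"
    by (intro Bochner_Integration.integral_mono Bochner_Integration.integrable_diff Bochner_Integration.integrable_add i1 i2 i3 ic)
  also have "\<dots> = 0"
    unfolding Bochner_Integration.integral_add[OF i3 i2] R3 by simp
  finally show ?thesis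
    unfolding Bochner_Integration.integral_diff[OF i1 ic] by (simp add: wint_def)
qed

lemma Wt_tendsto:
  assumes "s > 0"
  shows "(\<lambda>n. Wt m (inverse (real (Suc n))) s) \<longlonglongrightarrow> (max 0 (1 - s / m))\<^sup>2 / s\<^sup>2"
proof -
  have "(\<lambda>n. (max 0 (1 - s / m))\<^sup>2 / (s + inverse (real (Suc n)))\<^sup>2) \<longlonglongrightarrow> (max 0 (1 - s / m))\<^sup>2 / (s + 0)\<^sup>2"
    by (intro tendsto_intros LIMSEQ_inverse_real_of_nat) (use assms in auto)
  then show ?thesis by (simp add: Wt_def)
qed

text \<open>Monotone convergence as the regularisation tends to 0 with the cutoff fixed; the uniform
  bound makes the integrals of the increasing sequence converge.\<close>

lemma integrable_cball_inverse_norm2: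
  assumes N: "CARD('n) \<ge> 3"
  shows "integrable lborel (\<lambda>x::real^'n. indicator (cball 0 R) x / (norm x)\<^sup>2 :: real)"
proof -
  \<comment> \<open>With this m the cutoff is at least 1/2 on the ball, hence its square at least
    1/4 and the factor 4 in the majorant below; the summand 1 keeps m positive for
    \<open>R = 0\<close>.\<close>
  define m where "m = 2 * R\<^sup>2 + 1"
  have m: "m > 0" "m \<ge> 2 * R\<^sup>2" by (auto simp: m_def add_nonneg_pos)
  let ?e = "\<lambda>n. inverse (real (Suc n))"
  have e: "?e n > 0" for n by simp
  let ?f = "\<lambda>n (x::real^'n). Wt m (?e n) ((norm x)\<^sup>2) * (norm x)\<^sup>2"
  let ?u = "\<lambda>x::real^'n. (max 0 (1 - (norm x)\<^sup>2 / m))\<^sup>2 / (norm x)\<^sup>2"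
  have int: "integrable lborel (?f n)" for n
    by (intro wint_integrable[OF cutoff_weight_Wt[OF e m(1)]] smooth_continuous smooth_norm2)
  have mono: "mono (\<lambda>n. ?f n x)" for x
  proof (rule monoI)
    fix i j :: nat assume ij: "i \<le> j"
    have "?e j \<le> ?e i" using ij by (intro le_imp_inverse_le) auto
    then have "((norm x)\<^sup>2 + ?e j)\<^sup>2 \<le> ((norm x)\<^sup>2 + ?e i)\<^sup>2"
      by (intro power_mono add_mono) auto
    then show "?f i x \<le> ?f j x"
      unfolding Wt_def using e[of j] by (intro mult_right_mono divide_left_mono mult_pos_pos zero_less_power)
        (auto intro: add_nonneg_pos)
  qed
  have le: "integral\<^sup>L lborel (?f n) \<le> 4 / m * measure lborel (cball (0::real^'n) (sqrt m))" for n
    using wint_Wt_norm2_le[OF N e m(1)] by (simp add: wint_def)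
  have inc: "incseq (\<lambda>n. integral\<^sup>L lborel (?f n))"
    using mono by (intro monoI Bochner_Integration.integral_mono int) (auto simp: mono_def)
  then obtain l where l: "(\<lambda>n. integral\<^sup>L lborel (?f n)) \<longlonglongrightarrow> l"
    using incseq_convergent[OF inc, of "4 / m * measure lborel (cball (0::real^'n) (sqrt m))"] le by blast
  have lim: "(\<lambda>n. ?f n x) \<longlonglongrightarrow> ?u x" for x
  proof (cases "x = 0")
    case False
    have "(\<lambda>n. ?f n x) \<longlonglongrightarrow> (max 0 (1 - (norm x)\<^sup>2 / m))\<^sup>2 / ((norm x)\<^sup>2)\<^sup>2 * (norm x)\<^sup>2"
      by (intro tendsto_mult tendsto_const Wt_tendsto) (use False in auto)
    then show ?thesis using False by (simp add: power2_eq_square)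
  qed simp
  have "integrable lborel ?u"
  proof (rule integral_monotone_convergence_nonneg(1)[OF int _ _ _ l])
    show "?u \<in> borel_measurable lborel" by measurable
  qed (use mono lim in \<open>auto simp: Wt_nonneg\<close>)
  then have "integrable lborel (\<lambda>x. 4 * ?u x)" by (rule integrable_mult_right)
  then show ?thesis
  proof (rule Bochner_Integration.integrable_bound)
    have "(\<lambda>x::real^'n. indicator (cball 0 R) x / (norm x)\<^sup>2 :: real) \<in> borel_measurable borel"
      by (intro borel_measurable_divide borel_measurable_indicator borel_measurable_continuous_onI continuous_intros) simp
    then show "(\<lambda>x::real^'n. indicator (cball 0 R) x / (norm x)\<^sup>2 :: real) \<in> borel_measurable lborel"
      by simp
    show "AE x in lborel. norm (indicator (cball 0 R) x / (norm x)\<^sup>2 :: real) \<le> norm (4 * ?u x)"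
    proof (rule AE_I2)
      fix x :: "real^'n"
      show "norm (indicator (cball 0 R) x / (norm x)\<^sup>2 :: real) \<le> norm (4 * ?u x)"
      proof (cases "norm x \<le> R")
        case True
        then have "(norm x)\<^sup>2 \<le> R\<^sup>2" by (intro power_mono) auto
        then have "(norm x)\<^sup>2 / m \<le> 1 / 2" using m by (simp add: field_simps)
        then have "1 / 2 \<le> max 0 (1 - (norm x)\<^sup>2 / m)" by linarith
        then have "(1/2)\<^sup>2 \<le> (max 0 (1 - (norm x)\<^sup>2 / m))\<^sup>2" by (rule power_mono) simp
        then have "1 / (norm x)\<^sup>2 \<le> 4 * (max 0 (1 - (norm x)\<^sup>2 / m))\<^sup>2 / (norm x)\<^sup>2"
          by (intro divide_right_mono) (simp_all add: power_divide)
        then show ?thesis using True by simp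
      qed simp
    qed
  qed
qed

section \<open>Integrals against \<open>|x|^-4\<close> as limits of truncated ones\<close>

definition tame :: "(real^'n \<Rightarrow> real) \<Rightarrow> bool" where
  "tame g \<longleftrightarrow> continuous_on UNIV g \<and> (\<exists>R. \<forall>x. norm x > R \<longrightarrow> g x = 0) \<and> (\<exists>K. \<forall>x. \<bar>g x\<bar> \<le> K * (norm x)\<^sup>2)"

definition hardy_int :: "(real^'n \<Rightarrow> real) \<Rightarrow> real" where
  "hardy_int g = (\<integral>x. g x / norm x ^ 4 \<partial>lborel)"

lemma tameE:
  assumes "tame g"
  obtains R K where "K \<ge> 0" "\<And>x. norm x > R \<Longrightarrow> g x = 0" "\<And>x. \<bar>g x\<bar> \<le> K * (norm x)\<^sup>2"
    "continuous_on UNIV g" "g 0 = 0"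
proof -
  obtain R K where *: "\<And>x. norm x > R \<Longrightarrow> g x = 0" "\<And>x. \<bar>g x\<bar> \<le> K * (norm x)\<^sup>2" "continuous_on UNIV g"
    using assms by (auto simp: tame_def)
  have K: "\<bar>g x\<bar> \<le> max 0 K * (norm x)\<^sup>2" for x
    using *(2)[of x] mult_right_mono[of K "max 0 K" "(norm x)\<^sup>2"] by force
  from K[of 0] have "g 0 = 0" by simp
  with that[of "max 0 K" R] * K show ?thesis by auto
qed

text \<open>Quadratic vanishing leaves a majorant \<open>K / |x|^2\<close> on a ball, which is
  integrable from dimension 3 on. The same majorant serves for all the dominated limits of the
  truncated weights.\<close>

lemma tame_bound:
  fixes g :: "real^'n \<Rightarrow> real"
  assumes N: "CARD('n) \<ge> 3" and g: "tame g"
  obtains b where "integrable lborel b" "\<And>x. \<bar>g x\<bar> / norm x ^ 4 \<le> b x" "\<And>x. 0 \<le> b x"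
proof -
  obtain R K where t: "K \<ge> 0" "\<And>x. norm x > R \<Longrightarrow> g x = 0" "\<And>x. \<bar>g x\<bar> \<le> K * (norm x)\<^sup>2"
    by (rule tameE[OF g]) blast
  let ?b = "\<lambda>x::real^'n. K * (indicator (cball 0 R) x / (norm x)\<^sup>2)"
  have "\<bar>g x\<bar> / norm x ^ 4 \<le> ?b x" for x
  proof (cases "norm x \<le> R \<and> x \<noteq> 0")
    case True
    then have "\<bar>g x\<bar> / norm x ^ 4 \<le> K * (norm x)\<^sup>2 / norm x ^ 4" using t(3) by (intro divide_right_mono) auto
    also have "\<dots> = ?b x" using True by (simp add: power2_eq_square power4_eq_xxxx)
    finally show ?thesis .
  next
    case False
    then show ?thesis using t(1) t(2)[of x] by (cases "x = 0") auto
  qed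
  moreover have "integrable lborel ?b"
    by (rule integrable_mult_right, rule integrable_cball_inverse_norm2[OF N])
  ultimately show ?thesis using t(1) by (intro that[of ?b]) auto
qed

lemma borel_measurable_continuous:
  "continuous_on UNIV g \<Longrightarrow> g \<in> borel_measurable lborel" for g :: "real^'n \<Rightarrow> real"
  using borel_measurable_continuous_onI by simp

lemma tame_integrable:
  fixes g :: "real^'n \<Rightarrow> real"
  assumes N: "CARD('n) \<ge> 3" and g: "tame g"
  shows "integrable lborel (\<lambda>x. g x / norm x ^ 4)"
proof -
  obtain b where b: "integrable lborel b" "\<And>x. \<bar>g x\<bar> / norm x ^ 4 \<le> b x" "\<And>x. 0 \<le> b x"
    using tame_bound[OF assms] by blast
  have m: "g \<in> borel_measurable lborel" using g borel_measurable_continuous by (auto simp: tame_def)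
  show ?thesis
    by (rule Bochner_Integration.integrable_bound[OF b(1)]) (use m b in auto)
qed

text \<open>The constant L is left free to cover both the weights themselves (\<open>L = 1\<close>)
  and the divergence factors of the Euler field (\<open>L = c - 4\<close>). Nothing is asked at
  \<open>s = 0\<close>, where g vanishes.\<close>

lemma radial_integral_tendsto:
  fixes g :: "real^'n \<Rightarrow> real"
  assumes N: "CARD('n) \<ge> 3" and g: "tame g"
    and meas: "\<And>n. (\<lambda>x. h n ((norm x)\<^sup>2) * g x) \<in> borel_measurable lborel"
    and bd: "\<And>n s. s > 0 \<Longrightarrow> \<bar>h n s\<bar> \<le> C / s\<^sup>2"
    and lim: "\<And>s. s > 0 \<Longrightarrow> (\<lambda>n. h n s) \<longlonglongrightarrow> L / s\<^sup>2"
  shows "(\<lambda>n. \<integral>x. h n ((norm x)\<^sup>2) * g x \<partial>lborel) \<longlonglongrightarrow> L * hardy_int g"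
proof -
  obtain b where b: "integrable lborel b" "\<And>x. \<bar>g x\<bar> / norm x ^ 4 \<le> b x" "\<And>x. 0 \<le> b x"
    using tame_bound[OF N g] by blast
  have g0: "g 0 = 0" by (rule tameE[OF g])
  have p4: "norm x ^ 4 = ((norm x)\<^sup>2)\<^sup>2" for x :: "real^'n" by simp
  have C: "C \<ge> 0" using bd[of 1 0] by auto
  have m: "g \<in> borel_measurable lborel" using g borel_measurable_continuous by (auto simp: tame_def)
  have "(\<lambda>n. \<integral>x. h n ((norm x)\<^sup>2) * g x \<partial>lborel) \<longlonglongrightarrow> (\<integral>x. L * (g x / norm x ^ 4) \<partial>lborel)"
  proof (rule integral_dominated_convergence[where w = "\<lambda>x. C * b x"])
    show "AE x in lborel. (\<lambda>n. h n ((norm x)\<^sup>2) * g x) \<longlonglongrightarrow> L * (g x / norm x ^ 4)"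
    proof (rule AE_I2)
      fix x :: "real^'n"
      show "(\<lambda>n. h n ((norm x)\<^sup>2) * g x) \<longlonglongrightarrow> L * (g x / norm x ^ 4)"
      proof (cases "x = 0")
        case False
        then have "(\<lambda>n. h n ((norm x)\<^sup>2) * g x) \<longlonglongrightarrow> L / ((norm x)\<^sup>2)\<^sup>2 * g x"
          by (intro tendsto_mult lim tendsto_const) auto
        then show ?thesis unfolding p4 by (simp only: times_divide_eq_left times_divide_eq_right)
      qed (simp add: g0)
    qed
    show "AE x in lborel. norm (h n ((norm x)\<^sup>2) * g x) \<le> C * b x" for n
    proof (rule AE_I2)
      fix x :: "real^'n"
      show "norm (h n ((norm x)\<^sup>2) * g x) \<le> C * b x"
      proof (cases "x = 0")
        case False
        then have "\<bar>h n ((norm x)\<^sup>2)\<bar> * \<bar>g x\<bar> \<le> C / ((norm x)\<^sup>2)\<^sup>2 * \<bar>g x\<bar>"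
          by (intro mult_right_mono bd) auto
        also have "\<dots> = C * (\<bar>g x\<bar> / norm x ^ 4)"
          unfolding p4 by (simp only: times_divide_eq_left times_divide_eq_right)
        also have "\<dots> \<le> C * b x" using b C by (intro mult_left_mono) auto
        finally show ?thesis by (simp add: abs_mult)
      qed (use g0 b C in auto)
    qed
  qed (use meas b(1) m in auto)
  then show ?thesis by (simp only: hardy_int_def integral_mult_right_zero)
qed

text \<open>One index drives both limits: the cutoff radius tends to infinity and the regularisation
  to 0.\<close>

abbreviation wt :: "nat \<Rightarrow> real \<Rightarrow> real" where
  "wt n \<equiv> Wt (real (Suc n)) (inverse (real (Suc n)))"

abbreviation wt' :: "nat \<Rightarrow> real \<Rightarrow> real" where
  "wt' n \<equiv> Wt' (real (Suc n)) (inverse (real (Suc n)))"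

lemma cutoff_weight_wt: "cutoff_weight (wt n) (wt' n)"
  by (intro cutoff_weight_Wt) auto

lemma wt_tendsto:
  assumes "s > 0"
  shows "(\<lambda>n. wt n s) \<longlonglongrightarrow> 1 / s\<^sup>2"
proof -
  have "(\<lambda>n. (max 0 (1 - s * inverse (real (Suc n))))\<^sup>2 / (s + inverse (real (Suc n)))\<^sup>2) \<longlonglongrightarrow> (max 0 (1 - s * 0))\<^sup>2 / (s + 0)\<^sup>2"
    by (intro tendsto_intros tendsto_max LIMSEQ_inverse_real_of_nat) (use assms in auto)
  then show ?thesis by (simp add: Wt_def divide_inverse)
qed

lemma wint_wt_tendsto:
  fixes g :: "real^'n \<Rightarrow> real"
  assumes N: "CARD('n) \<ge> 3" and g: "tame g"
  shows "(\<lambda>n. wint (wt n) g) \<longlonglongrightarrow> hardy_int g"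
proof -
  have "(\<lambda>n. \<integral>x. wt n ((norm x)\<^sup>2) * g x \<partial>lborel) \<longlonglongrightarrow> 1 * hardy_int g"
  proof (rule radial_integral_tendsto[OF N g, of _ 1])
    show "(\<lambda>x. wt n ((norm x)\<^sup>2) * g x) \<in> borel_measurable lborel" for n
      by (rule borel_measurable_integrable[OF wint_integrable[OF cutoff_weight_wt]]) (use g in \<open>simp add: tame_def\<close>)
    show "\<bar>wt n s\<bar> \<le> 1 / s\<^sup>2" if "s > 0" for n s
      using Wt_le[of "inverse (real (Suc n))" "real (Suc n)" s] that Wt_nonneg by simp
  qed (rule wt_tendsto)
  then show ?thesis by (simp add: wint_def)
qed

text \<open>The limit weight \<open>s^-2\<close> satisfies \<open>2 s w' = -4 w\<close>, which is
  the shift by 4; the contribution of the cutoff's slope disappears as the cutoff recedes.\<close>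

lemma wt_euler_tendsto:
  assumes s: "s > 0"
  shows "(\<lambda>n. c * wt n s + 2 * s * wt' n s) \<longlonglongrightarrow> (c - 4) / s\<^sup>2"
proof -
  have 1: "(\<lambda>n. s / (s + inverse (real (Suc n)))) \<longlonglongrightarrow> s / (s + 0)"
    by (intro tendsto_intros LIMSEQ_inverse_real_of_nat) (use assms in auto)
  have 2: "(\<lambda>n. (s * inverse (real (Suc n)) * max 0 (1 - s * inverse (real (Suc n)))) / (s + inverse (real (Suc n)))\<^sup>2) \<longlonglongrightarrow> (s * 0 * max 0 (1 - s * 0)) / (s + 0)\<^sup>2"
    by (intro tendsto_intros tendsto_max LIMSEQ_inverse_real_of_nat) (use assms in auto)
  have "(\<lambda>n. c * wt n s - 4 * (s / (s + inverse (real (Suc n)))) * wt n s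
     - 4 * ((s * inverse (real (Suc n)) * max 0 (1 - s * inverse (real (Suc n)))) / (s + inverse (real (Suc n)))\<^sup>2))
     \<longlonglongrightarrow> c * (1 / s\<^sup>2) - 4 * (s / (s + 0)) * (1 / s\<^sup>2) - 4 * ((s * 0 * max 0 (1 - s * 0)) / (s + 0)\<^sup>2)"
    by (intro tendsto_diff tendsto_mult tendsto_const wt_tendsto s 1 2)
  moreover have "c * (1 / s\<^sup>2) - 4 * (s / (s + 0)) * (1 / s\<^sup>2) - 4 * ((s * 0 * max 0 (1 - s * 0)) / (s + 0)\<^sup>2) = (c - 4) / s\<^sup>2"
    using s by (simp add: diff_divide_distrib)
  ultimately show ?thesis unfolding Wt'_eq by (simp add: divide_inverse mult.assoc)
qed

text \<open>The 8 is 4 from differentiating the regularised power and 4 from the slope of the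
  cutoff, each times at most \<open>1 / s^2\<close>.\<close>

lemma wt_euler_bound:
  assumes s: "s > 0" and c: "c \<ge> 0"
  shows "\<bar>c * wt n s + 2 * s * wt' n s\<bar> \<le> (c + 8) / s\<^sup>2"
proof -
  define m where "m = real (Suc n)"
  define e where "e = inverse m"
  have me: "m > 0" "e > 0" by (auto simp: m_def e_def)
  have w: "0 \<le> Wt m e s" "Wt m e s \<le> 1 / s\<^sup>2" using Wt_nonneg Wt_le me s by auto
  have 1: "c * Wt m e s \<le> c * (1 / s\<^sup>2)" using w c by (intro mult_left_mono) auto
  have "s / (s + e) * Wt m e s \<le> Wt m e s" using me s w by (intro mult_left_le_one_le) auto
  then have 2: "s / (s + e) * Wt m e s \<le> 1 / s\<^sup>2" using w by linarith
  have 3: "(s / m * max 0 (1 - s / m)) / (s + e)\<^sup>2 \<le> 1 / s\<^sup>2"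
    using cutoff_slope_bounds[of s m] me s by (intro frac_le power_mono) auto
  have 4: "0 \<le> (s / m * max 0 (1 - s / m)) / (s + e)\<^sup>2"
    using cutoff_slope_bounds[of s m] me s by (intro divide_nonneg_nonneg) auto
  have 5: "0 \<le> s / (s + e) * Wt m e s" "0 \<le> c * Wt m e s" using me s w c by auto
  have eq: "c * Wt m e s + 2 * s * Wt' m e s = c * Wt m e s - 4 * (s / (s + e) * Wt m e s)
     - 4 * ((s / m * max 0 (1 - s / m)) / (s + e)\<^sup>2)"
    unfolding Wt'_eq by simp
  have eq': "(c + 8) / s\<^sup>2 = c * (1 / s\<^sup>2) + 8 * (1 / s\<^sup>2)" by (simp add: add_divide_distrib)
  have aux: "\<bar>P - 4 * Q - 4 * T\<bar> \<le> Z + 8 * D"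
    if "P \<le> Z" "Q \<le> D" "T \<le> D" "0 \<le> T" "0 \<le> Q" "0 \<le> P" for P Q T Z D :: real
    using that by linarith
  have "\<bar>c * Wt m e s + 2 * s * Wt' m e s\<bar> \<le> (c + 8) / s\<^sup>2"
    unfolding eq eq' by (rule aux[OF 1 2 3 4 5])
  then show ?thesis by (simp add: m_def e_def)
qed

text \<open>Away from the origin the field \<open>|x|^-4 x\<close> has divergence
  \<open>(N - 4) |x|^-4\<close>. Tameness of f and of \<open>euler f\<close> lets the truncated
  identity pass to the limit, so the singularity leaves no boundary term.\<close>

lemma hardy_int_euler:
  fixes f :: "real^'n \<Rightarrow> real"
  assumes N: "CARD('n) \<ge> 3" and f: "smooth f" "tame f" "tame (euler f)"
  shows "hardy_int (euler f) = (4 - real CARD('n)) * hardy_int f"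
proof -
  have z: "integrable lborel (\<lambda>x. (real CARD('n) * wt n ((norm x)\<^sup>2) + 2 * (norm x)\<^sup>2 * wt' n ((norm x)\<^sup>2)) * f x)"
    "wint (wt n) (euler f) = - (\<integral>x. (real CARD('n) * wt n ((norm x)\<^sup>2) + 2 * (norm x)\<^sup>2 * wt' n ((norm x)\<^sup>2)) * f x \<partial>lborel)" for n
  proof -
    obtain R where R: "radial_weight (wt n) (wt' n)" "\<And>x::real^'n. norm x > R \<Longrightarrow> wt n ((norm x)\<^sup>2) = 0"
      "\<And>x::real^'n. norm x > R \<Longrightarrow> wt' n ((norm x)\<^sup>2) = 0"
      using cutoff_weightE[OF cutoff_weight_wt[of n], where 'n='n] by metis
    show "integrable lborel (\<lambda>x. (real CARD('n) * wt n ((norm x)\<^sup>2) + 2 * (norm x)\<^sup>2 * wt' n ((norm x)\<^sup>2)) * f x)"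
      by (rule integral_radial_euler(2)[OF R(1) f(1), where R=R]) (simp_all only: R mult_zero_left)
    show "wint (wt n) (euler f) = - (\<integral>x. (real CARD('n) * wt n ((norm x)\<^sup>2) + 2 * (norm x)\<^sup>2 * wt' n ((norm x)\<^sup>2)) * f x \<partial>lborel)"
      unfolding wint_def by (rule integral_radial_euler(3)[OF R(1) f(1), where R=R]) (simp_all only: R mult_zero_left)
  qed
  have "(\<lambda>n. \<integral>x. (real CARD('n) * wt n ((norm x)\<^sup>2) + 2 * (norm x)\<^sup>2 * wt' n ((norm x)\<^sup>2)) * f x \<partial>lborel)
     \<longlonglongrightarrow> (real CARD('n) - 4) * hardy_int f"
    by (rule radial_integral_tendsto[OF N f(2) borel_measurable_integrable[OF z(1)] wt_euler_bound wt_euler_tendsto])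
      simp_all
  then have "(\<lambda>n. wint (wt n) (euler f)) \<longlonglongrightarrow> - ((real CARD('n) - 4) * hardy_int f)"
    unfolding z(2) by (rule tendsto_minus)
  from LIMSEQ_unique[OF wint_wt_tendsto[OF N f(3)] this] show ?thesis by (simp add: algebra_simps)
qed

lemma hardy_int_rot:
  fixes f :: "real^'n \<Rightarrow> real"
  assumes N: "CARD('n) \<ge> 3" and f: "smooth f" "tame (rot i j f)"
  shows "hardy_int (rot i j f) = 0"
proof -
  have "wint (wt n) (rot i j f) = 0" for n
    \<comment> \<open>The other factor is the constant 1, which every rotation field
      annihilates.\<close>
    using wint_rot_parts[OF cutoff_weight_wt smooth_const[of 1] f(1)] by (simp add: wint_def del: of_nat_Suc)
  with wint_wt_tendsto[OF N f(2)] show ?thesis by (simp add: LIMSEQ_const_iff)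
qed

section \<open>Energy inequality\<close>

lemma tame_add: "tame f \<Longrightarrow> tame g \<Longrightarrow> tame (\<lambda>x. f x + g x)"
proof -
  assume f: "tame f" and g: "tame g"
  obtain R K where 1: "\<And>x. norm x > R \<Longrightarrow> f x = 0" "\<And>x. \<bar>f x\<bar> \<le> K * (norm x)\<^sup>2" "continuous_on UNIV f"
    by (rule tameE[OF f]) blast
  obtain R' K' where 2: "\<And>x. norm x > R' \<Longrightarrow> g x = 0" "\<And>x. \<bar>g x\<bar> \<le> K' * (norm x)\<^sup>2" "continuous_on UNIV g"
    by (rule tameE[OF g]) blast
  have "\<bar>f x + g x\<bar> \<le> (K + K') * (norm x)\<^sup>2" for x
    using 1(2)[of x] 2(2)[of x] abs_triangle_ineq[of "f x" "g x"] by (simp add: distrib_right)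
  moreover have "f x + g x = 0" if "norm x > max R R'" for x using that 1(1) 2(1) by simp
  ultimately show ?thesis
    unfolding tame_def using 1(3) 2(3) by (blast intro: continuous_on_add)
qed

lemma tame_zero: "tame (\<lambda>x. 0)"
  unfolding tame_def by (auto intro: exI[of _ 0])

lemma tame_sum: "(\<And>i. i \<in> I \<Longrightarrow> tame (f i)) \<Longrightarrow> tame (\<lambda>x. \<Sum>i\<in>I. f i x)"
proof (induction I rule: infinite_finite_induct)
  case (insert i I)
  then show ?case by (simp add: tame_add)
qed (simp_all add: tame_zero)

text \<open>Vanishing at the origin is encoded as a linear bound, so that a product of two such
  functions is tame. The fields E and \<open>rot i j\<close> have linear coefficients and carry
  every \<open>test_fun\<close> into this class; v itself need not belong to it.\<close>

definition test_fun0 :: "(real^'n \<Rightarrow> real) \<Rightarrow> bool" where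
  "test_fun0 f \<longleftrightarrow> smooth f \<and> (\<exists>R. \<forall>x. norm x > R \<longrightarrow> f x = 0) \<and> (\<exists>K. \<forall>x. \<bar>f x\<bar> \<le> K * norm x)"

definition test_fun :: "(real^'n \<Rightarrow> real) \<Rightarrow> bool" where
  "test_fun f \<longleftrightarrow> smooth f \<and> (\<exists>R. \<forall>x. norm x > R \<longrightarrow> f x = 0)"

lemma test_fun0_test_fun: "test_fun0 f \<Longrightarrow> test_fun f"
  by (auto simp: test_fun0_def test_fun_def)

lemma test_fun_smooth: "test_fun f \<Longrightarrow> smooth f"
  by (simp add: test_fun_def)

lemma test_fun0_smooth: "test_fun0 f \<Longrightarrow> smooth f"
  by (simp add: test_fun0_def)

lemma test_fun_partial_deriv:
  fixes f :: "real^'n \<Rightarrow> real"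
  assumes "test_fun f"
  shows "test_fun (partial_deriv i f)"
proof -
  obtain R where R: "\<And>x. norm x > R \<Longrightarrow> f x = 0" using assms by (auto simp: test_fun_def)
  have "partial_deriv i f x = 0" if "norm x > R" for x
  proof -
    have "open {x::real^'n. norm x > R}" by (intro open_Collect_less continuous_intros)
    then have "(f has_derivative (\<lambda>h. 0)) (at x)"
      by (intro has_derivative_transform_within_open[OF has_derivative_const[of 0], where s = "{x. norm x > R}"])
        (use R that in auto)
    from partial_deriv_eqI[OF this] show ?thesis .
  qed
  then show ?thesis using assms by (auto simp: test_fun_def smooth_partial_deriv)
qed

lemma test_fun0_coord_mult:
  fixes f :: "real^'n \<Rightarrow> real"
  assumes "test_fun f"
  shows "test_fun0 (\<lambda>x. x $ i * f x)"
proof -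
  obtain R where R: "\<And>x. norm x > R \<Longrightarrow> f x = 0" "smooth f" using assms by (auto simp: test_fun_def)
  obtain B where B: "B > 0" "\<And>x. \<bar>f x\<bar> \<le> B"
    using bounded_continuous_bounded_support[OF smooth_continuous[OF R(2)] R(1)] by blast
  have "\<bar>x $ i * f x\<bar> \<le> B * norm x" for x
    using mult_mono[OF component_le_norm_cart[of x i] B(2)[of x]] by (simp add: abs_mult mult.commute)
  then show ?thesis unfolding test_fun0_def using R by (auto intro: smooth_mult smooth_coord)
qed

lemma test_fun0_add:
  assumes "test_fun0 f" "test_fun0 g"
  shows "test_fun0 (\<lambda>x. f x + g x)"
proof -
  obtain R K where 1: "\<And>x. norm x > R \<Longrightarrow> f x = 0" "\<And>x. \<bar>f x\<bar> \<le> K * norm x"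
    using assms by (auto simp: test_fun0_def)
  obtain R' K' where 2: "\<And>x. norm x > R' \<Longrightarrow> g x = 0" "\<And>x. \<bar>g x\<bar> \<le> K' * norm x"
    using assms by (auto simp: test_fun0_def)
  have "\<bar>f x + g x\<bar> \<le> (K + K') * norm x" for x
    using 1(2)[of x] 2(2)[of x] abs_triangle_ineq[of "f x" "g x"] by (simp add: distrib_right)
  moreover have "f x + g x = 0" if "norm x > max R R'" for x using that 1(1) 2(1) by simp
  ultimately show ?thesis
    unfolding test_fun0_def using assms test_fun0_smooth smooth_add by blast
qed

lemma test_fun0_cmult: "test_fun0 f \<Longrightarrow> test_fun0 (\<lambda>x. c * f x)"
proof -
  assume f: "test_fun0 f"
  then obtain R K where 1: "\<And>x. norm x > R \<Longrightarrow> f x = 0" "\<And>x. \<bar>f x\<bar> \<le> K * norm x"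
    by (auto simp: test_fun0_def)
  have "\<bar>c * f x\<bar> \<le> (\<bar>c\<bar> * K) * norm x" for x
    using mult_left_mono[OF 1(2)[of x], of "\<bar>c\<bar>"] by (simp add: abs_mult mult.assoc)
  moreover have "c * f x = 0" if "norm x > R" for x using that 1(1) by simp
  ultimately show ?thesis
    unfolding test_fun0_def using f test_fun0_smooth smooth_cmult by blast
qed

lemma test_fun0_diff: "test_fun0 f \<Longrightarrow> test_fun0 g \<Longrightarrow> test_fun0 (\<lambda>x. f x - g x)"
  using test_fun0_add[OF _ test_fun0_cmult[of g "-1"], of f] by simp

lemma test_fun0_zero: "test_fun0 (\<lambda>x. 0)"
  unfolding test_fun0_def by (auto intro: smooth_const exI[of _ 0])

lemma test_fun0_sum: "(\<And>i. i \<in> I \<Longrightarrow> test_fun0 (f i)) \<Longrightarrow> test_fun0 (\<lambda>x. \<Sum>i\<in>I. f i x)"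
proof (induction I rule: infinite_finite_induct)
  case (insert i I)
  then show ?case by (simp add: test_fun0_add)
qed (simp_all add: test_fun0_zero)

lemma test_fun0_euler: "test_fun f \<Longrightarrow> test_fun0 (euler f)"
  unfolding euler_alt by (intro test_fun0_sum test_fun0_coord_mult test_fun_partial_deriv)

lemma test_fun0_rot: "test_fun f \<Longrightarrow> test_fun0 (rot i j f)"
  unfolding rot_alt by (intro test_fun0_diff test_fun0_coord_mult test_fun_partial_deriv)

lemma test_fun0_sph: "test_fun f \<Longrightarrow> test_fun0 (sph f)"
  unfolding sph_alt by (intro test_fun0_cmult test_fun0_sum test_fun0_rot[OF test_fun0_test_fun[OF test_fun0_rot]])

lemma tame_mult:
  assumes "test_fun0 f" "test_fun0 g"
  shows "tame (\<lambda>x. f x * g x)"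
proof -
  obtain R K where 1: "\<And>x. norm x > R \<Longrightarrow> f x = 0" "\<And>x. \<bar>f x\<bar> \<le> K * norm x"
    using assms by (auto simp: test_fun0_def)
  obtain K' where 2: "\<And>x. \<bar>g x\<bar> \<le> K' * norm x"
    using assms by (auto simp: test_fun0_def)
  have "\<bar>f x * g x\<bar> \<le> (K * K') * (norm x)\<^sup>2" for x
    using mult_mono[OF 1(2)[of x] 2[of x]] order_trans[OF abs_ge_zero 1(2)[of x]]
    by (simp add: abs_mult power2_eq_square mult_ac)
  moreover have "continuous_on UNIV (\<lambda>x. f x * g x)"
    using assms by (intro continuous_intros smooth_continuous test_fun0_smooth)
  moreover have "f x * g x = 0" if "norm x > R" for x using that 1(1) by simp
  ultimately show ?thesis unfolding tame_def by blast
qed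

lemma tame_sq: "test_fun0 f \<Longrightarrow> tame (\<lambda>x. (f x)\<^sup>2)"
  unfolding power2_eq_square by (rule tame_mult)

definition hardy_prod :: "(real^'n \<Rightarrow> real) \<Rightarrow> (real^'n \<Rightarrow> real) \<Rightarrow> real" where
  "hardy_prod f g = hardy_int (\<lambda>x. f x * g x)"

context
  assumes N: "CARD('n::finite) \<ge> 3"
begin

lemma hardy_int_add: "tame f \<Longrightarrow> tame g \<Longrightarrow> hardy_int (\<lambda>x::real^'n. f x + g x) = hardy_int f + hardy_int g"
  by (simp add: hardy_int_def add_divide_distrib tame_integrable N)

lemma hardy_int_cmult: "hardy_int (\<lambda>x::real^'n. c * f x) = c * hardy_int f"
  by (simp add: hardy_int_def flip: times_divide_eq_right)

lemma hardy_int_sum: "(\<And>i. i \<in> I \<Longrightarrow> tame (f i)) \<Longrightarrow> hardy_int (\<lambda>x::real^'n. \<Sum>i\<in>I. f i x) = (\<Sum>i\<in>I. hardy_int (f i))"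
  by (simp add: hardy_int_def sum_divide_distrib tame_integrable N)

lemma hardy_int_nonneg: "(\<And>x. 0 \<le> f x) \<Longrightarrow> 0 \<le> hardy_int (f :: real^'n \<Rightarrow> real)"
  unfolding hardy_int_def by (intro Bochner_Integration.integral_nonneg divide_nonneg_nonneg) auto

lemma hardy_prod_commute: "hardy_prod f g = hardy_prod g f"
  for f :: "real^'n \<Rightarrow> real"
  by (simp add: hardy_prod_def mult.commute)

lemma hardy_prod_add_left: "test_fun0 f \<Longrightarrow> test_fun0 g \<Longrightarrow> test_fun0 h \<Longrightarrow> hardy_prod (\<lambda>x. f x + g x) h = hardy_prod f h + hardy_prod g h"
  for f :: "real^'n \<Rightarrow> real"
  by (simp add: hardy_prod_def distrib_right hardy_int_add tame_mult)

lemma hardy_prod_cmult_left: "hardy_prod (\<lambda>x. c * f x) h = c * hardy_prod f h"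
  for f :: "real^'n \<Rightarrow> real"
  by (simp add: hardy_prod_def mult.assoc hardy_int_cmult)

lemma hardy_prod_add_right: "test_fun0 f \<Longrightarrow> test_fun0 g \<Longrightarrow> test_fun0 h \<Longrightarrow> hardy_prod h (\<lambda>x. f x + g x) = hardy_prod h f + hardy_prod h g"
  for f :: "real^'n \<Rightarrow> real"
  by (simp add: hardy_prod_commute[of h] hardy_prod_add_left)

lemma hardy_prod_cmult_right: "hardy_prod h (\<lambda>x. c * f x) = c * hardy_prod h f"
  for f :: "real^'n \<Rightarrow> real"
  by (simp add: hardy_prod_commute[of h] hardy_prod_cmult_left)

lemma hardy_prod_sum_right: "(\<And>i. i \<in> I \<Longrightarrow> test_fun0 (f i)) \<Longrightarrow> test_fun0 h \<Longrightarrow> hardy_prod h (\<lambda>x. \<Sum>i\<in>I. f i x) = (\<Sum>i\<in>I. hardy_prod h (f i))"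
  for h :: "real^'n \<Rightarrow> real"
  by (simp add: hardy_prod_def sum_distrib_left hardy_int_sum tame_mult)

lemma hardy_prod_self_nonneg: "0 \<le> hardy_prod f f"
  for f :: "real^'n \<Rightarrow> real"
  unfolding hardy_prod_def by (intro hardy_int_nonneg) simp

lemma hardy_prod_euler:
  fixes f :: "real^'n \<Rightarrow> real"
  assumes f: "test_fun0 f" and g: "test_fun0 g"
  shows "hardy_prod (euler f) g + hardy_prod f (euler g) = (4 - real CARD('n)) * hardy_prod f g"
proof -
  note nn = test_fun0_euler[OF test_fun0_test_fun[OF f]] test_fun0_euler[OF test_fun0_test_fun[OF g]]
  have e: "euler (\<lambda>x. f x * g x) = (\<lambda>x. f x * euler g x + euler f x * g x)"
    by (rule euler_mult) (intro test_fun0_smooth f g)+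
  have t: "tame (euler (\<lambda>x. f x * g x))"
    unfolding e by (intro tame_add tame_mult f g nn)
  have "hardy_int (euler (\<lambda>x. f x * g x)) = (4 - real CARD('n)) * hardy_int (\<lambda>x. f x * g x)"
    by (intro hardy_int_euler N t tame_mult f g smooth_mult test_fun0_smooth)
  then show ?thesis
    unfolding e hardy_prod_def using hardy_int_add[OF tame_mult[OF f nn(2)] tame_mult[OF nn(1) g]] by simp
qed

lemma hardy_prod_rot:
  fixes f :: "real^'n \<Rightarrow> real"
  assumes f: "test_fun0 f" and g: "test_fun0 g"
  shows "hardy_prod f (rot i j g) = - hardy_prod (rot i j f) g"
proof -
  note nn = test_fun0_rot[OF test_fun0_test_fun[OF f], of i j] test_fun0_rot[OF test_fun0_test_fun[OF g], of i j]
  have e: "rot i j (\<lambda>x. f x * g x) = (\<lambda>x. f x * rot i j g x + rot i j f x * g x)"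
    by (rule rot_mult) (intro test_fun0_smooth f g)+
  have t: "tame (rot i j (\<lambda>x. f x * g x))"
    unfolding e by (intro tame_add tame_mult f g nn)
  have "hardy_int (rot i j (\<lambda>x. f x * g x)) = 0"
    by (intro hardy_int_rot N t f g smooth_mult test_fun0_smooth)
  then show ?thesis
    unfolding e hardy_prod_def using hardy_int_add[OF tame_mult[OF f nn(2)] tame_mult[OF nn(1) g]] by simp
qed

text \<open>The first claim is \<open>E + E^* = 2 a\<close> on the diagonal. The second expands the
  square of \<open>E f - a f\<close>: its cross term is
  \<open>-2 a^2 \<parallel>f\<parallel>^2\<close> by the first, which outweighs the last square
  \<open>a^2 \<parallel>f\<parallel>^2\<close> by exactly the claimed amount.\<close>

lemma hardy_prod_hardy:
  fixes f :: "real^'n \<Rightarrow> real"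
  assumes f: "test_fun0 f" and a: "a = (4 - real CARD('n)) / 2"
  shows "hardy_prod (euler f) f = a * hardy_prod f f"
    and "a\<^sup>2 * hardy_prod f f \<le> hardy_prod (euler f) (euler f)"
proof -
  note ne = test_fun0_euler[OF test_fun0_test_fun[OF f]]
  show 1: "hardy_prod (euler f) f = a * hardy_prod f f"
    using hardy_prod_euler[OF f f] by (simp add: hardy_prod_commute[of f "euler f"] a)
  have "0 \<le> hardy_prod (\<lambda>x. euler f x + (- a) * f x) (\<lambda>x. euler f x + (- a) * f x)"
    by (rule hardy_prod_self_nonneg)
  also have "\<dots> = hardy_prod (euler f) (euler f) - 2 * a * hardy_prod (euler f) f + a\<^sup>2 * hardy_prod f f"
    using f ne by (simp only: hardy_prod_add_left hardy_prod_add_right hardy_prod_cmult_left hardy_prod_cmult_right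
        test_fun0_add test_fun0_cmult hardy_prod_commute[of f "euler f"]) (simp add: algebra_simps power2_eq_square)
  finally show "a\<^sup>2 * hardy_prod f f \<le> hardy_prod (euler f) (euler f)"
    unfolding 1 by (simp add: power2_eq_square)
qed

lemma hardy_prod_sph:
  fixes f :: "real^'n \<Rightarrow> real"
  assumes f: "test_fun0 f" and g: "test_fun g"
  shows "hardy_prod f (sph g) = 1/2 * (\<Sum>i\<in>UNIV. \<Sum>j\<in>UNIV. hardy_prod (rot i j f) (rot i j g))"
proof -
  have n: "test_fun0 (rot i j (rot i j g))" "test_fun0 (rot i j g)" for i j
    by (intro test_fun0_rot test_fun0_test_fun g)+
  have "hardy_prod f (sph g) = - (1/2) * (\<Sum>i\<in>UNIV. \<Sum>j\<in>UNIV. hardy_prod f (rot i j (rot i j g)))"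
    unfolding sph_alt hardy_prod_cmult_right by (simp add: hardy_prod_sum_right test_fun0_sum n f)
  also have "\<dots> = 1/2 * (\<Sum>i\<in>UNIV. \<Sum>j\<in>UNIV. hardy_prod (rot i j f) (rot i j g))"
    by (simp add: hardy_prod_rot f n sum_negf)
  finally show ?thesis .
qed

text \<open>\<open>Y\<close> plays the role of \<open>\<langle>v, L v\<rangle>\<close>, written
  through rotational derivatives since v need not vanish at 0. The cross terms are
  \<open>\<langle>E^2 v, E v\<rangle> = a \<parallel>E v\<parallel>^2\<close> and
  \<open>\<langle>E v, L v\<rangle> = a Y\<close>. For \<open>y = rot i j v\<close> one has
  \<open>\<langle>E^2 y, y\<rangle> = 2 a^2 \<parallel>y\<parallel>^2 - \<parallel>E y\<parallel>^2
  <= a^2 \<parallel>y\<parallel>^2\<close>, so \<open>\<langle>E^2 v, L v\<rangle> <= a^2 Y\<close>.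
  Together with \<open>\<parallel>E^2 v\<parallel> >= |a| \<parallel>E v\<parallel>\<close> the
  terms assemble into squares of \<open>a + m\<close>.\<close>

lemma hardy_prod_energy:
  fixes v :: "real^'n \<Rightarrow> real" and a m :: real
  assumes v: "test_fun v" and a: "a = (4 - real CARD('n)) / 2"
  defines "Y \<equiv> 1/2 * (\<Sum>i\<in>UNIV. \<Sum>j\<in>UNIV. hardy_prod (rot i j v) (rot i j v))"
  defines "T \<equiv> \<lambda>x. euler (euler v) x + (m * euler v x + (-1) * sph v x)"
  shows "(a + m)\<^sup>2 * hardy_prod (euler v) (euler v) - 2 * a * (a + m) * Y + hardy_prod (sph v) (sph v) \<le> hardy_prod T T"
proof -
  let ?E = "euler v" let ?EE = "euler (euler v)" let ?L = "sph v"
  have nE: "test_fun0 ?E" and nEE: "test_fun0 ?EE" and nL: "test_fun0 ?L"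
    by (intro test_fun0_euler test_fun0_sph test_fun0_test_fun v)+
  have nr: "test_fun0 (rot i j v)" for i j by (intro test_fun0_rot v)
  have sv: "smooth v" using v by (rule test_fun_smooth)
  have TT: "hardy_prod T T = hardy_prod ?EE ?EE + m\<^sup>2 * hardy_prod ?E ?E + hardy_prod ?L ?L + 2 * m * hardy_prod ?EE ?E
      - 2 * hardy_prod ?EE ?L - 2 * m * hardy_prod ?E ?L"
    unfolding T_def using nE nEE nL
    by (simp only: hardy_prod_add_left hardy_prod_add_right hardy_prod_cmult_left hardy_prod_cmult_right
        test_fun0_add test_fun0_cmult hardy_prod_commute[of ?L ?E] hardy_prod_commute[of ?L ?EE] hardy_prod_commute[of ?E ?EE])
      (simp add: algebra_simps power2_eq_square)
  have 1: "hardy_prod ?EE ?E = a * hardy_prod ?E ?E" "a\<^sup>2 * hardy_prod ?E ?E \<le> hardy_prod ?EE ?EE"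
    using hardy_prod_hardy[OF nE a] by simp_all
  have 2: "hardy_prod ?E ?L = a * Y"
    using nE by (simp add: hardy_prod_sph v Y_def rot_euler sv hardy_prod_hardy(1)[OF nr a] sum_distrib_left)
  have y: "hardy_prod (euler (euler (rot i j v))) (rot i j v) \<le> a\<^sup>2 * hardy_prod (rot i j v) (rot i j v)" for i j
  proof -
    let ?y = "rot i j v"
    have ny: "test_fun0 (euler ?y)" by (intro test_fun0_euler test_fun0_test_fun nr)
    have "hardy_prod (euler (euler ?y)) ?y + hardy_prod (euler ?y) (euler ?y) = 2 * a * hardy_prod (euler ?y) ?y"
      using hardy_prod_euler[OF ny nr] by (simp add: a)
    with hardy_prod_hardy[OF nr a, of i j] show ?thesis by (simp add: power2_eq_square)
  qed
  have "hardy_prod ?EE ?L = 1/2 * (\<Sum>i\<in>UNIV. \<Sum>j\<in>UNIV. hardy_prod (euler (euler (rot i j v))) (rot i j v))"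
    using nEE by (simp add: hardy_prod_sph v rot_euler sv smooth_euler)
  also have "\<dots> \<le> 1/2 * (\<Sum>i\<in>UNIV. \<Sum>j\<in>UNIV. a\<^sup>2 * hardy_prod (rot i j v) (rot i j v))"
    by (intro mult_left_mono sum_mono y) auto
  also have "\<dots> = a\<^sup>2 * Y" by (simp add: Y_def sum_distrib_left)
  finally have 3: "hardy_prod ?EE ?L \<le> a\<^sup>2 * Y" .
  have "(a + m)\<^sup>2 * hardy_prod ?E ?E - 2 * a * (a + m) * Y + hardy_prod ?L ?L =
     a\<^sup>2 * hardy_prod ?E ?E + m\<^sup>2 * hardy_prod ?E ?E + hardy_prod ?L ?L + 2 * m * hardy_prod ?EE ?E
      - 2 * (a\<^sup>2 * Y) - 2 * m * hardy_prod ?E ?L"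
    unfolding 1(1) 2 by (simp add: power2_eq_square algebra_simps)
  also have "\<dots> \<le> hardy_prod T T" unfolding TT using 1(2) 3 by linarith
  finally show ?thesis .
qed

end

section \<open>The Hardy--Rellich inequality\<close>

text \<open>Supplies \<open>|v x - v 0| <= K |x|\<close>, which makes the square of
  \<open>v - v 0\<close> vanish quadratically at the origin.\<close>

lemma test_fun_lipschitz:
  fixes v :: "real^'n \<Rightarrow> real"
  assumes v: "test_fun v"
  obtains K where "K \<ge> 0" "\<And>x y. \<bar>v x - v y\<bar> \<le> K * norm (x - y)"
proof -
  have "\<exists>B. B > 0 \<and> (\<forall>x. \<bar>partial_deriv i v x\<bar> \<le> B)" for i
  proof -
    obtain R where "\<And>x. norm x > R \<Longrightarrow> partial_deriv i v x = 0" "smooth (partial_deriv i v)"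
      using test_fun_partial_deriv[OF v] by (auto simp: test_fun_def)
    then show ?thesis
      using bounded_continuous_bounded_support[OF smooth_continuous] by metis
  qed
  then obtain B where B: "\<And>i. B i > 0" "\<And>i x. \<bar>partial_deriv i v x\<bar> \<le> B i" by metis
  let ?K = "\<Sum>i\<in>UNIV. B i"
  have D: "(v has_derivative (\<lambda>h. \<Sum>i\<in>UNIV. h $ i * partial_deriv i v x)) (at x)" for x
    by (intro has_derivative_partial_deriv smooth_differentiable test_fun_smooth v)
  have "norm (v x - v y) \<le> ?K * norm (x - y)" for x y
  proof (rule differentiable_bound[OF convex_UNIV])
    show "(v has_derivative (\<lambda>h. \<Sum>i\<in>UNIV. h $ i * partial_deriv i v x)) (at x within UNIV)" for x
      using D by simp
    show "onorm (\<lambda>h. \<Sum>i\<in>UNIV. h $ i * partial_deriv i v x) \<le> ?K" for x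
    proof (rule onorm_bound)
      fix h :: "real^'n"
      have "\<bar>\<Sum>i\<in>UNIV. h $ i * partial_deriv i v x\<bar> \<le> (\<Sum>i\<in>UNIV. \<bar>h $ i * partial_deriv i v x\<bar>)"
        by (rule sum_abs)
      also have "\<dots> \<le> (\<Sum>i\<in>UNIV. norm h * B i)"
        unfolding abs_mult by (intro sum_mono mult_mono component_le_norm_cart B) auto
      finally show "norm (\<Sum>i\<in>UNIV. h $ i * partial_deriv i v x) \<le> ?K * norm h"
        by (simp add: sum_distrib_left mult.commute)
    qed (auto intro: sum_nonneg less_imp_le B)
  qed auto
  moreover have "?K \<ge> 0" by (intro sum_nonneg less_imp_le B)
  ultimately show ?thesis using that[of ?K] by simp
qed

lemma radial_weight_shifted_inverse:
  assumes "e > 0"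
  shows "radial_weight (\<lambda>s. 1 / (s + e)\<^sup>2) (\<lambda>s. - 2 / (s + e) ^ 3)"
proof -
  have "((\<lambda>s. 1 / (s + e)\<^sup>2) has_real_derivative - 2 / (s + e) ^ 3) (at s)" if "s \<ge> 0" for s
  proof -
    have "((\<lambda>s. (s + e)\<^sup>2) has_real_derivative 2 * (s + e)) (at s)"
      by (auto intro!: derivative_eq_intros)
    from DERIV_divide[OF DERIV_const[of 1] this]
    have "((\<lambda>s. 1 / (s + e)\<^sup>2) has_real_derivative (0 * (s + e)\<^sup>2 - 1 * (2 * (s + e))) / ((s + e)\<^sup>2 * (s + e)\<^sup>2)) (at s)"
      using that assms by simp
    moreover have "(0 * t\<^sup>2 - 1 * (2 * t)) / (t\<^sup>2 * t\<^sup>2) = - 2 / t ^ 3" if "t \<noteq> 0" for t :: real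
      using that by (simp add: field_simps power2_eq_square power3_eq_cube)
    ultimately show ?thesis using that assms by (metis add_nonneg_pos less_numeral_extra(3))
  qed
  moreover have "continuous_on {0..} (\<lambda>s. - 2 / (s + e) ^ 3)"
    using assms by (intro continuous_intros) auto
  ultimately show ?thesis by (simp add: radial_weight_def)
qed

text \<open>For N > 4 no value at the origin has to be subtracted: v has bounded support, so the
  weight \<open>1 / (s + e)^2\<close> needs no cutoff, and replacing \<open>s / (s + e)\<close> by 1
  gives \<open>N w + 2 s w' >= (N - 4) w\<close> with the favourable sign. The bound is then uniform
  in n, and \<open>wt n\<close> lies below this weight.\<close>

lemma wint_hardy_ge5:
  fixes v :: "real^'n \<Rightarrow> real"
  assumes N: "CARD('n) > 4" and v: "test_fun v"
  shows "((4 - real CARD('n)) / 2)\<^sup>2 * wint (wt n) (\<lambda>x. (v x)\<^sup>2) \<le> hardy_int (\<lambda>x. (euler v x)\<^sup>2)"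
proof -
  have N3: "CARD('n) \<ge> 3" using N by simp
  define e where "e = inverse (real (Suc n))"
  have e: "e > 0" by (simp add: e_def)
  define b where "b = (real CARD('n) - 4) / 2"
  have b: "b > 0" using N by (simp add: b_def)
  have b2: "((4 - real CARD('n)) / 2)\<^sup>2 = b\<^sup>2" by (simp add: b_def power2_eq_square field_simps)
  let ?w = "\<lambda>s. 1 / (s + e)\<^sup>2" let ?w' = "\<lambda>s. - 2 / (s + e) ^ 3"
  let ?s = "\<lambda>x::real^'n. (norm x)\<^sup>2"
  note rw = radial_weight_shifted_inverse[OF e]
  obtain R where R: "\<And>x. norm x > R \<Longrightarrow> v x = 0" and sv: "smooth v" using v by (auto simp: test_fun_def)
  have nE: "test_fun0 (euler v)" by (rule test_fun0_euler[OF v])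
  obtain R' where R': "\<And>x. norm x > R' \<Longrightarrow> euler v x = 0" using nE by (auto simp: test_fun0_def)
  have int: "integrable lborel (\<lambda>x. ?w (?s x) * h x)" if "continuous_on UNIV h" "\<And>x. norm x > r \<Longrightarrow> h x = 0" for h r
  proof (rule integrable_continuous_bounded_support[of _ r])
    show "continuous_on UNIV (\<lambda>x. ?w (?s x) * h x)"
      by (intro continuous_on_mult radial_weight_continuous(1)[OF rw] that)
  qed (simp add: that(2))
  have i1: "integrable lborel (\<lambda>x. ?w (?s x) * (v x)\<^sup>2)"
    by (rule int[of _ R]) (auto intro!: smooth_continuous smooth_sq sv simp: R)
  have i2: "integrable lborel (\<lambda>x. ?w (?s x) * (euler v x)\<^sup>2)"
    by (rule int[of _ R']) (auto intro!: smooth_continuous smooth_sq test_fun0_smooth[OF nE] simp: R')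
  have ef: "euler (\<lambda>x. (v x)\<^sup>2) = (\<lambda>x. 2 * (v x * euler v x))"
    by (simp add: power2_eq_square euler_mult sv fun_eq_iff)
  have s0: "norm x > R \<Longrightarrow> ?w (?s x) * (v x)\<^sup>2 = 0" "norm x > R \<Longrightarrow> ?w' (?s x) * (v x)\<^sup>2 = 0" for x
    by (simp_all add: R)
  have I: "integrable lborel (\<lambda>x. ?w (?s x) * (2 * (v x * euler v x)))"
    "integrable lborel (\<lambda>x. (real CARD('n) * ?w (?s x) + 2 * ?s x * ?w' (?s x)) * (v x)\<^sup>2)"
    "(\<integral>x. ?w (?s x) * (2 * (v x * euler v x)) \<partial>lborel) =
      - (\<integral>x. (real CARD('n) * ?w (?s x) + 2 * ?s x * ?w' (?s x)) * (v x)\<^sup>2 \<partial>lborel)"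
    using integral_radial_euler[OF rw smooth_sq[OF sv] s0] unfolding ef by blast+
  have "2 * b * (\<integral>x. ?w (?s x) * (v x)\<^sup>2 \<partial>lborel) = (\<integral>x. 2 * b * (?w (?s x) * (v x)\<^sup>2) \<partial>lborel)"
    by (rule integral_mult_right_zero[symmetric])
  also have "\<dots> \<le> (\<integral>x. (real CARD('n) * ?w (?s x) + 2 * ?s x * ?w' (?s x)) * (v x)\<^sup>2 \<partial>lborel)"
  proof (rule Bochner_Integration.integral_mono)
    fix x :: "real^'n"
    have "?s x / (?s x + e) * ?w (?s x) \<le> 1 * ?w (?s x)"
      using e by (intro mult_right_mono) (auto simp: divide_le_eq_1 add_nonneg_pos)
    moreover have "2 * ?s x * ?w' (?s x) = - 4 * (?s x / (?s x + e) * ?w (?s x))"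
      by (simp add: power2_eq_square power3_eq_cube)
    moreover have "2 * b * ?w (?s x) = real CARD('n) * ?w (?s x) - 4 * ?w (?s x)"
      by (simp add: b_def left_diff_distrib diff_divide_distrib)
    ultimately have "2 * b * ?w (?s x) \<le> real CARD('n) * ?w (?s x) + 2 * ?s x * ?w' (?s x)"
      by linarith
    then have "2 * b * ?w (?s x) * (v x)\<^sup>2 \<le> (real CARD('n) * ?w (?s x) + 2 * ?s x * ?w' (?s x)) * (v x)\<^sup>2"
      by (rule mult_right_mono) simp
    then show "2 * b * (?w (?s x) * (v x)\<^sup>2) \<le> (real CARD('n) * ?w (?s x) + 2 * ?s x * ?w' (?s x)) * (v x)\<^sup>2"
      by (simp only: mult.assoc)
  qed (use I(2) integrable_mult_right[OF i1, of "2 * b"] in simp_all)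
  also have "\<dots> = (\<integral>x. - (?w (?s x) * (2 * (v x * euler v x))) \<partial>lborel)"
    using I(3) by simp
  also have "\<dots> \<le> (\<integral>x. b * (?w (?s x) * (v x)\<^sup>2) + 1 / b * (?w (?s x) * (euler v x)\<^sup>2) \<partial>lborel)"
  proof (rule Bochner_Integration.integral_mono)
    fix x
    \<comment> \<open>Young's inequality weighted by b: half of the left side
      \<open>2 b \<parallel>v\<parallel>^2\<close> is absorbed, leaving the sharp factor
      \<open>b^2\<close>.\<close>
    have "0 \<le> (b * v x + euler v x)\<^sup>2 / b" using b by simp
    also have "\<dots> = b * (v x)\<^sup>2 + 2 * (v x * euler v x) + 1 / b * (euler v x)\<^sup>2"
      using b by (simp add: power2_eq_square field_simps)
    finally have "?w (?s x) * (- (2 * (v x * euler v x))) \<le> ?w (?s x) * (b * (v x)\<^sup>2 + 1 / b * (euler v x)\<^sup>2)"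
      by (intro mult_left_mono) auto
    then show "- (?w (?s x) * (2 * (v x * euler v x))) \<le> b * (?w (?s x) * (v x)\<^sup>2) + 1 / b * (?w (?s x) * (euler v x)\<^sup>2)"
      by (simp only: distrib_left mult_minus_right mult.left_commute)
  next
    show "integrable lborel (\<lambda>x. - (?w (?s x) * (2 * (v x * euler v x))))"
      by (rule Bochner_Integration.integrable_minus[OF I(1)])
    show "integrable lborel (\<lambda>x. b * (?w (?s x) * (v x)\<^sup>2) + 1 / b * (?w (?s x) * (euler v x)\<^sup>2))"
      by (rule Bochner_Integration.integrable_add; rule integrable_mult_right; rule i1 i2)
  qed
  also have "\<dots> = b * (\<integral>x. ?w (?s x) * (v x)\<^sup>2 \<partial>lborel) + 1 / b * (\<integral>x. ?w (?s x) * (euler v x)\<^sup>2 \<partial>lborel)"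
    by (subst Bochner_Integration.integral_add[OF integrable_mult_right[OF i1] integrable_mult_right[OF i2]])
      (simp only: integral_mult_right_zero)
  finally have "b * (\<integral>x. ?w (?s x) * (v x)\<^sup>2 \<partial>lborel) \<le> 1 / b * (\<integral>x. ?w (?s x) * (euler v x)\<^sup>2 \<partial>lborel)"
    by simp
  from mult_left_mono[OF this, of b] b
  have 1: "b\<^sup>2 * (\<integral>x. ?w (?s x) * (v x)\<^sup>2 \<partial>lborel) \<le> (\<integral>x. ?w (?s x) * (euler v x)\<^sup>2 \<partial>lborel)"
    by (simp add: power2_eq_square mult.assoc)
  have "wint (wt n) (\<lambda>x. (v x)\<^sup>2) \<le> (\<integral>x. ?w (?s x) * (v x)\<^sup>2 \<partial>lborel)"
    unfolding wint_def
  proof (rule Bochner_Integration.integral_mono[OF _ i1])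
    show "integrable lborel (\<lambda>x. wt n (?s x) * (v x)\<^sup>2)"
      by (intro wint_integrable[OF cutoff_weight_wt] continuous_intros smooth_continuous sv)
    show "wt n (?s x) * (v x)\<^sup>2 \<le> ?w (?s x) * (v x)\<^sup>2" for x
      unfolding e_def by (intro mult_right_mono Wt_le') auto
  qed
  then have "b\<^sup>2 * wint (wt n) (\<lambda>x. (v x)\<^sup>2) \<le> b\<^sup>2 * (\<integral>x. ?w (?s x) * (v x)\<^sup>2 \<partial>lborel)"
    by (intro mult_left_mono) auto
  also note 1
  also have "(\<integral>x. ?w (?s x) * (euler v x)\<^sup>2 \<partial>lborel) \<le> hardy_int (\<lambda>x. (euler v x)\<^sup>2)"
    unfolding hardy_int_def
  proof (rule Bochner_Integration.integral_mono[OF i2 tame_integrable[OF N3 tame_sq[OF nE]]])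
    fix x :: "real^'n"
    show "?w (?s x) * (euler v x)\<^sup>2 \<le> (euler v x)\<^sup>2 / norm x ^ 4"
    proof (cases "x = 0")
      case True
      then show ?thesis by (simp add: euler_def)
    next
      case False
      have "(norm x)^4 \<le> (?s x + e)\<^sup>2"
        using power_mono[of "?s x" "?s x + e" 2] e by simp
      then have "(euler v x)\<^sup>2 / (?s x + e)\<^sup>2 \<le> (euler v x)\<^sup>2 / norm x ^ 4"
        using False e by (intro divide_left_mono mult_pos_pos zero_less_power) (auto intro: add_nonneg_pos)
      then show ?thesis by simp
    qed
  qed
  finally show ?thesis by (simp only: b2)
qed

text \<open>Here \<open>N - 4 = -1\<close>, so the regularisation error has the wrong sign and the
  bound holds only asymptotically, through a convergent sequence of right-hand sides. The function
  \<open>u = v - v 0\<close> has no bounded support in general, so the cutoff stays in the weight;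
  its slope has the right sign and is dropped.\<close>

lemma wint_hardy_3:
  fixes v :: "real^'n \<Rightarrow> real"
  assumes N: "CARD('n) = 3" and v: "test_fun v"
  shows "\<exists>r. r \<longlonglongrightarrow> hardy_int (\<lambda>x. (euler v x)\<^sup>2) \<and>
    (\<forall>\<^sub>F n in sequentially. 1/4 * wint (wt n) (\<lambda>x. (v x - v 0)\<^sup>2) \<le> r n)"
proof -
  have N3: "CARD('n) \<ge> 3" using N by simp
  define e where "e n = inverse (real (Suc n))" for n
  have e: "e n > 0" for n by (simp add: e_def)
  have e0: "e \<longlonglongrightarrow> 0" unfolding e_def by (rule LIMSEQ_inverse_real_of_nat)
  obtain K where K: "K \<ge> 0" "\<And>x y. \<bar>v x - v y\<bar> \<le> K * norm (x - y)" using test_fun_lipschitz[OF v] by blast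
  define u where "u x = v x - v 0" for x
  have sv: "smooth v" by (rule test_fun_smooth[OF v])
  have su: "smooth u" unfolding u_def by (intro smooth_intros sv)
  have Eu: "euler u = euler v" unfolding u_def by (simp add: euler_diff sv smooth_const euler_const)
  have nE: "test_fun0 (euler v)" by (rule test_fun0_euler[OF v])
  let ?s = "\<lambda>x::real^'n. (norm x)\<^sup>2"
  have u2: "(u x)\<^sup>2 \<le> K\<^sup>2 * ?s x" for x
    using power_mono[OF K(2)[of x 0], of 2] by (simp add: u_def power_mult_distrib)
  define q where "q n = wint (wt n) (\<lambda>x. (u x)\<^sup>2)" for n
  \<comment> \<open>The regularisation error inside the unit ball. Since u is Lipschitz and vanishes
    at 0, it is dominated by \<open>4 K^2 / |x|^2\<close>, and it tends to 0 pointwise.\<close>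
  let ?g = "\<lambda>n x. indicator (cball 0 1) x * (4 * (e n / (?s x + e n)) * (wt n (?s x) * (u x)\<^sup>2))"
  define r where "r n = (\<integral>x. ?g n x \<partial>lborel)" for n
  have cq: "continuous_on UNIV (\<lambda>x. (u x)\<^sup>2)" by (intro continuous_intros smooth_continuous su)
  have iq: "integrable lborel (\<lambda>x. wt n (?s x) * (u x)\<^sup>2)" for n
    by (rule wint_integrable[OF cutoff_weight_wt cq])
  have frac: "0 \<le> e n / (?s x + e n)" "e n / (?s x + e n) \<le> 1" for n x
    using e[of n] by (auto intro!: divide_nonneg_nonneg add_nonneg_nonneg simp: divide_le_eq_1 add_nonneg_pos)
  have wu: "0 \<le> wt n (?s x) * (u x)\<^sup>2" for n x by (intro mult_nonneg_nonneg Wt_nonneg) auto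
  have mg: "?g n \<in> borel_measurable lborel" for n
  proof -
    have m1: "(\<lambda>x. e n / (?s x + e n)) \<in> borel_measurable lborel"
      using e[of n] by (intro borel_measurable_continuous continuous_intros) (auto simp: add_nonneg_eq_0_iff)
    show ?thesis
      by (intro m1 borel_measurable_integrable[OF iq] borel_measurable_times borel_measurable_indicator
          borel_measurable_const) auto
  qed
  have bg: "\<bar>?g n x\<bar> \<le> 4 * K\<^sup>2 * (indicator (cball 0 1) x / ?s x)" for n x
  proof (cases "x = 0 \<or> norm x > 1")
    case True
    then show ?thesis by (auto simp: u_def)
  next
    case False
    then have s: "?s x > 0" by simp
    have "wt n (?s x) * (u x)\<^sup>2 \<le> 1 / (?s x)\<^sup>2 * (K\<^sup>2 * ?s x)"
      by (intro mult_mono Wt_le u2) (use s in auto)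
    also have "\<dots> = K\<^sup>2 / ?s x" using s by (simp add: power2_eq_square)
    finally have "4 * (e n / (?s x + e n)) * (wt n (?s x) * (u x)\<^sup>2) \<le> 4 * 1 * (K\<^sup>2 / ?s x)"
      using frac[where n=n and x=x] Wt_nonneg by (intro mult_mono) auto
    moreover have "0 \<le> 4 * (e n / (?s x + e n)) * (wt n (?s x) * (u x)\<^sup>2)"
      using frac(1)[of n x] wu[of n x] by (simp only: mult_nonneg_nonneg zero_le_numeral)
    ultimately have "\<bar>4 * (e n / (?s x + e n)) * (wt n (?s x) * (u x)\<^sup>2)\<bar> \<le> 4 * 1 * (K\<^sup>2 / ?s x)"
      by (simp only: abs_of_nonneg)
    also have "\<dots> = 4 * K\<^sup>2 * (1 / ?s x)" by simp
    finally have le: "\<bar>4 * (e n / (?s x + e n)) * (wt n (?s x) * (u x)\<^sup>2)\<bar> \<le> 4 * K\<^sup>2 * (1 / ?s x)" .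
    have ind: "indicator (cball 0 1) x = (1::real)" using False by simp
    show ?thesis unfolding ind mult_1 by (rule le)
  qed
  have ib: "integrable lborel (\<lambda>x::real^'n. 4 * K\<^sup>2 * (indicator (cball 0 1) x / ?s x))"
    by (rule integrable_mult_right, rule integrable_cball_inverse_norm2[OF N3])
  have ig: "integrable lborel (?g n)" for n
    by (rule Bochner_Integration.integrable_bound[OF ib mg]) (use bg in \<open>auto intro!: AE_I2 order_trans[OF bg]\<close>)
  have "r \<longlonglongrightarrow> (\<integral>x. 0 \<partial>(lborel :: (real^'n) measure))"
    unfolding r_def
  proof (rule integral_dominated_convergence[OF _ mg ib])
    show "AE x in lborel. norm (?g n x) \<le> 4 * K\<^sup>2 * (indicator (cball 0 1) x / ?s x)" for n
      using bg by (intro AE_I2) simp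
    show "AE x in lborel. (\<lambda>n. ?g n x) \<longlonglongrightarrow> 0"
    proof (rule AE_I2)
      fix x
      show "(\<lambda>n. ?g n x) \<longlonglongrightarrow> 0"
      proof (cases "x = 0")
        case False
        then have s: "?s x > 0" by simp
        have "(\<lambda>n. ?g n x) \<longlonglongrightarrow> indicator (cball 0 1) x * (4 * (0 / (?s x + 0)) * (1 / (?s x)\<^sup>2 * (u x)\<^sup>2))"
          by (intro tendsto_intros e0 wt_tendsto s) (use s in auto)
        then show ?thesis by simp
      qed (simp add: u_def)
    qed
  qed simp
  then have r0: "r \<longlonglongrightarrow> 0" by simp
  have main: "(1/2 - 4 * e n) * q n \<le> r n + 2 * wint (wt n) (\<lambda>x. (euler v x)\<^sup>2)" for n
  proof -
    note cw = cutoff_weight_wt[of n]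
    obtain R where R: "radial_weight (wt n) (wt' n)" "\<And>x::real^'n. norm x > R \<Longrightarrow> wt n ((norm x)\<^sup>2) = 0"
      "\<And>x::real^'n. norm x > R \<Longrightarrow> wt' n ((norm x)\<^sup>2) = 0"
      using cutoff_weightE[OF cw, where 'n='n] by metis
    have ef: "euler (\<lambda>x. (u x)\<^sup>2) = (\<lambda>x. 2 * (u x * euler v x))"
      using su by (simp add: power2_eq_square euler_mult Eu fun_eq_iff)
    have I2: "integrable lborel (\<lambda>x. (real CARD('n) * wt n (?s x) + 2 * ?s x * wt' n (?s x)) * (u x)\<^sup>2)"
      by (rule integral_radial_euler(2)[OF R(1) smooth_sq[OF su], where R=R]) (simp_all only: R mult_zero_left)
    have I3: "wint (wt n) (\<lambda>x. 2 * (u x * euler v x)) = - (\<integral>x. (real CARD('n) * wt n (?s x) + 2 * ?s x * wt' n (?s x)) * (u x)\<^sup>2 \<partial>lborel)"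
      unfolding wint_def ef[symmetric]
      by (rule integral_radial_euler(3)[OF R(1) smooth_sq[OF su], where R=R]) (simp_all only: R mult_zero_left)
    have i1: "integrable lborel (\<lambda>x. (1 - 4 * e n) * (wt n (?s x) * (u x)\<^sup>2))"
      by (rule integrable_mult_right[OF iq])
    have "(1 - 4 * e n) * q n - r n = (\<integral>x. (1 - 4 * e n) * (wt n (?s x) * (u x)\<^sup>2) - ?g n x \<partial>lborel)"
      unfolding Bochner_Integration.integral_diff[OF i1 ig] by (simp only: integral_mult_right_zero q_def r_def wint_def)
    also have "\<dots> \<le> (\<integral>x. - ((real CARD('n) * wt n (?s x) + 2 * ?s x * wt' n (?s x)) * (u x)\<^sup>2) \<partial>lborel)"
    proof (rule Bochner_Integration.integral_mono)
      fix x
      define s where "s = ?s x"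
      define E where "E = e n"
      define M where "M = real (Suc n)"
      define W where "W = wt n s"
      have s: "s \<ge> 0" by (simp add: s_def)
      have EM: "E > 0" "M > 0" "E = inverse M" by (auto simp: E_def M_def e_def)
      have WM: "W = Wt M E s" by (simp add: W_def M_def E_def e_def)
      have W0: "0 \<le> W * (u x)\<^sup>2" using wu[of n x] by (simp add: W_def s_def)
      have sl: "0 \<le> 4 * (s / M * max 0 (1 - s / M)) / (s + E)\<^sup>2"
        using cutoff_slope_bounds(1)[of s M] s EM by (intro divide_nonneg_nonneg) auto
      have sE: "s / (s + E) = 1 - E / (s + E)"
        using s EM by (simp add: eq_diff_eq add_nonneg_eq_0_iff flip: add_divide_distrib)
      have "3 * W + 2 * s * Wt' M E s \<le> 3 * W - 4 * (s / (s + E)) * W"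
        unfolding WM Wt'_eq using sl by linarith
      also have "\<dots> = - W + 4 * (E / (s + E)) * W" unfolding sE by (simp add: algebra_simps)
      finally have "(3 * W + 2 * s * Wt' M E s) * (u x)\<^sup>2 \<le> (- W + 4 * (E / (s + E)) * W) * (u x)\<^sup>2"
        by (rule mult_right_mono) simp
      then have 1: "(3 * W + 2 * s * Wt' M E s) * (u x)\<^sup>2 \<le> - (W * (u x)\<^sup>2) + 4 * (E / (s + E)) * (W * (u x)\<^sup>2)"
        by (simp add: algebra_simps)
      \<comment> \<open>Outside the unit ball \<open>s >= 1\<close>, so the error is at most
        \<open>4 E\<close> times the integrand and can be absorbed on the left; inside it is exactly
        \<open>?g\<close>.\<close>
      have 2: "4 * (E / (s + E)) * (W * (u x)\<^sup>2) \<le> 4 * E * (W * (u x)\<^sup>2) + ?g n x"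
      proof (cases "norm x \<le> 1")
        case True
        then have "?g n x = 4 * (E / (s + E)) * (W * (u x)\<^sup>2)" by (simp add: s_def E_def W_def)
        then show ?thesis using W0 EM by simp
      next
        case False
        then have "1 \<le> s" using power_mono[of 1 "norm x" 2] by (simp add: s_def)
        then have "E / (s + E) \<le> E / 1" using EM(1) by (intro divide_left_mono) auto
        then have "4 * (E / (s + E)) * (W * (u x)\<^sup>2) \<le> 4 * E * (W * (u x)\<^sup>2)"
          using W0 by (intro mult_right_mono) auto
        then show ?thesis using False by simp
      qed
      have "(1 - 4 * E) * (W * (u x)\<^sup>2) - ?g n x \<le> - ((3 * W + 2 * s * Wt' M E s) * (u x)\<^sup>2)"
        using 1 2 by (simp add: left_diff_distrib)
      then show "(1 - 4 * e n) * (wt n (?s x) * (u x)\<^sup>2) - ?g n x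
          \<le> - ((real CARD('n) * wt n (?s x) + 2 * ?s x * wt' n (?s x)) * (u x)\<^sup>2)"
        by (simp only: E_def W_def s_def M_def e_def N of_nat_numeral)
    next
      show "integrable lborel (\<lambda>x. (1 - 4 * e n) * (wt n (?s x) * (u x)\<^sup>2) - ?g n x)"
        by (rule Bochner_Integration.integrable_diff[OF i1 ig])
      show "integrable lborel (\<lambda>x. - ((real CARD('n) * wt n (?s x) + 2 * ?s x * wt' n (?s x)) * (u x)\<^sup>2))"
        by (rule Bochner_Integration.integrable_minus[OF I2])
    qed
    also have "\<dots> = wint (wt n) (\<lambda>x. 2 * (u x * euler v x))"
      unfolding I3 by (rule Bochner_Integration.integral_minus)
    \<comment> \<open>These weights keep half of the left side and give \<open>2 / (1/2) = 4\<close>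
      in the limit, the sharp constant in dimension 3.\<close>
    also have "\<dots> \<le> wint (wt n) (\<lambda>x. 1/2 * (u x)\<^sup>2 + 2 * (euler v x)\<^sup>2)"
    proof (rule wint_mono[OF cw])
      show "2 * (u x * euler v x) \<le> 1/2 * (u x)\<^sup>2 + 2 * (euler v x)\<^sup>2" for x
        using zero_le_power2[of "u x - 2 * euler v x"] by (simp add: power2_eq_square algebra_simps)
    qed (intro continuous_intros smooth_continuous su test_fun0_smooth nE)+
    also have "\<dots> = 1/2 * q n + 2 * wint (wt n) (\<lambda>x. (euler v x)\<^sup>2)"
    proof -
      have c: "continuous_on UNIV (\<lambda>x. 1/2 * (u x)\<^sup>2)" "continuous_on UNIV (\<lambda>x. 2 * (euler v x)\<^sup>2)"
        by (intro continuous_intros smooth_continuous su test_fun0_smooth nE)+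
      show ?thesis unfolding wint_add[OF cw c] wint_cmult[OF cw] q_def ..
    qed
    finally show ?thesis by (simp add: algebra_simps)
  qed
  let ?H = "hardy_int (\<lambda>x. (euler v x)\<^sup>2)"
  have "(\<lambda>n. 1/4 * ((r n + 2 * wint (wt n) (\<lambda>x. (euler v x)\<^sup>2)) / (1/2 - 4 * e n)))
     \<longlonglongrightarrow> 1/4 * ((0 + 2 * ?H) / (1/2 - 4 * 0))"
    by (intro tendsto_intros r0 e0 wint_wt_tendsto[OF N3] tame_sq nE) auto
  moreover have "\<forall>\<^sub>F n in sequentially. 1/4 * q n \<le> 1/4 * ((r n + 2 * wint (wt n) (\<lambda>x. (euler v x)\<^sup>2)) / (1/2 - 4 * e n))"
  proof -
    have "\<forall>\<^sub>F n in sequentially. e n < 1/8" using e0 by (rule order_tendstoD) simp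
    then show ?thesis
    proof eventually_elim
      case (elim n)
      then have "1/2 - 4 * e n > 0" by simp
      with main[of n] have "q n \<le> (r n + 2 * wint (wt n) (\<lambda>x. (euler v x)\<^sup>2)) / (1/2 - 4 * e n)"
        by (simp add: le_divide_eq mult.commute del: of_nat_Suc)
      then show ?case by linarith
    qed
  qed
  ultimately show ?thesis unfolding q_def u_def by auto
qed

text \<open>The constant subtracted is \<open>v 0\<close> in dimension 3 and 0 above 4. Since E, L
  and the rotation fields annihilate constants, it affects only the norm of v.\<close>

lemma wint_hardy:
  fixes v :: "real^'n \<Rightarrow> real"
  assumes N: "CARD('n) \<ge> 3" "CARD('n) \<noteq> 4" and v: "test_fun v"
  shows "\<exists>\<kappa> r. r \<longlonglongrightarrow> hardy_int (\<lambda>x. (euler v x)\<^sup>2) \<and>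
    (\<forall>\<^sub>F n in sequentially. ((4 - real CARD('n)) / 2)\<^sup>2 * wint (wt n) (\<lambda>x. (v x - \<kappa>)\<^sup>2) \<le> r n)"
proof (cases "CARD('n) = 3")
  case True
  then have q: "((4 - real CARD('n)) / 2)\<^sup>2 = 1/4" by (simp add: power2_eq_square)
  from wint_hardy_3[OF True v] show ?thesis unfolding q by blast
next
  case False
  then have "CARD('n) > 4" using N by simp
  from wint_hardy_ge5[OF this v]
  have "\<forall>\<^sub>F n in sequentially. ((4 - real CARD('n)) / 2)\<^sup>2 * wint (wt n) (\<lambda>x. (v x - 0)\<^sup>2) \<le> hardy_int (\<lambda>x. (euler v x)\<^sup>2)"
    by simp
  then show ?thesis using tendsto_const by blast
qed

text \<open>The spectral gap is used with \<open>b = - a A\<close> and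
  \<open>\<delta> = C a^2\<close>. At each n it leaves
  \<open>(A^2 - C) a^2 \<parallel>u\<parallel>^2\<close>, which the Hardy bound replaces by a
  multiple of \<open>r n\<close>. Only then is n sent to infinity, so no finiteness of the norm of u
  against \<open>|x|^-4\<close> is required.\<close>

lemma spherical_form_nonneg:
  fixes v :: "real^'n \<Rightarrow> real"
  assumes N: "CARD('n) \<ge> 3" "CARD('n) \<noteq> 4" and v: "test_fun v"
    and a: "a = (4 - real CARD('n)) / 2"
    and C: "C \<le> A\<^sup>2" "\<And>k. C * a\<^sup>2 \<le> (sph_ev CARD('n) k + a * A)\<^sup>2"
  shows "0 \<le> hardy_int (\<lambda>x. (sph v x)\<^sup>2)
    + a * A * hardy_int (\<lambda>x. \<Sum>i\<in>UNIV. \<Sum>j\<in>UNIV. rot i j v x * rot i j v x)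
    + (A\<^sup>2 - C) * hardy_int (\<lambda>x. (euler v x)\<^sup>2)"
proof -
  obtain \<kappa> r where r: "r \<longlonglongrightarrow> hardy_int (\<lambda>x. (euler v x)\<^sup>2)"
    "\<forall>\<^sub>F n in sequentially. a\<^sup>2 * wint (wt n) (\<lambda>x. (v x - \<kappa>)\<^sup>2) \<le> r n"
    using wint_hardy[OF N v] unfolding a by blast
  define u where "u x = v x - \<kappa>" for x
  have sv: "smooth v" by (rule test_fun_smooth[OF v])
  have su: "smooth u" unfolding u_def by (intro smooth_intros sv)
  have Lu: "sph u = sph v" unfolding u_def by (simp add: sph_diff sv smooth_const sph_const)
  have Ru: "rot i j u = rot i j v" for i j unfolding u_def by (simp add: rot_diff sv smooth_const)
  have nL: "test_fun0 (sph v)" and nR: "test_fun0 (rot i j v)" for i j by (intro test_fun0_sph test_fun0_rot v)+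
  let ?S = "\<lambda>x. \<Sum>i\<in>UNIV. \<Sum>j\<in>UNIV. rot i j v x * rot i j v x"
  have lim: "(\<lambda>n. wint (wt n) (\<lambda>x. (sph v x)\<^sup>2) + a * A * wint (wt n) ?S + (A\<^sup>2 - C) * r n) \<longlonglongrightarrow>
     hardy_int (\<lambda>x. (sph v x)\<^sup>2) + a * A * hardy_int ?S + (A\<^sup>2 - C) * hardy_int (\<lambda>x. (euler v x)\<^sup>2)"
    by (intro tendsto_add tendsto_mult tendsto_const wint_wt_tendsto[OF N(1)] r(1) tame_sq tame_sum tame_mult nL nR)
  have "\<forall>\<^sub>F n in sequentially. 0 \<le> wint (wt n) (\<lambda>x. (sph v x)\<^sup>2) + a * A * wint (wt n) ?S + (A\<^sup>2 - C) * r n"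
    using r(2)
  proof eventually_elim
    case (elim n)
    note cw = cutoff_weight_wt[of n]
    have gap: "C * a\<^sup>2 \<le> (sph_ev CARD('n) k - (- a * A))\<^sup>2" for k using C(2)[of k] by simp
    have "C * a\<^sup>2 * wint (wt n) (\<lambda>x. (u x)\<^sup>2) \<le> wint (wt n) (\<lambda>x. (sph u x - (- a * A) * u x)\<^sup>2)"
      by (rule wint_sph_gap[OF cw N(1) su gap])
    also have "\<dots> = wint (wt n) (\<lambda>x. (sph v x)\<^sup>2) + 2 * a * A * wint (wt n) (\<lambda>x. sph u x * u x)
        + (a * A)\<^sup>2 * wint (wt n) (\<lambda>x. (u x)\<^sup>2)"
      using wint_sq_diff[OF cw smooth_sph[OF su] su, of "- a * A"] by (simp add: Lu del: of_nat_Suc)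
    also have "wint (wt n) (\<lambda>x. sph u x * u x) = 1/2 * wint (wt n) ?S"
      using wint_sph_parts[OF cw su su] unfolding Ru by (simp only: mult.commute[of "u _"])
    finally have "0 \<le> wint (wt n) (\<lambda>x. (sph v x)\<^sup>2) + a * A * wint (wt n) ?S
        + (A\<^sup>2 - C) * (a\<^sup>2 * wint (wt n) (\<lambda>x. (u x)\<^sup>2))"
      by (simp add: algebra_simps power_mult_distrib del: of_nat_Suc)
    moreover have "(A\<^sup>2 - C) * (a\<^sup>2 * wint (wt n) (\<lambda>x. (u x)\<^sup>2)) \<le> (A\<^sup>2 - C) * r n"
      using elim C(1) unfolding u_def by (intro mult_left_mono) auto
    ultimately show ?case by linarith
  qed
  with lim show ?thesis by (rule tendsto_lowerbound) simp
qed

lemma hardy_rellich_hardy_int: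
  fixes v :: "real^'n \<Rightarrow> real"
  assumes N: "CARD('n) \<ge> 3" and v: "test_fun v"
    and a: "a = (4 - real CARD('n)) / 2" and A: "A = lam - real CARD('n) / 2"
    and C: "C \<le> A\<^sup>2" "CARD('n) = 4 \<or> (\<forall>k. C * a\<^sup>2 \<le> (sph_ev CARD('n) k + a * A)\<^sup>2)"
  shows "C * hardy_int (\<lambda>x. (euler v x)\<^sup>2) \<le> hardy_int (\<lambda>x. (- ((norm x)\<^sup>2 * laplacian v x) + lam * euler v x)\<^sup>2)"
proof -
  define m where "m = real CARD('n) - 2 - lam"
  \<comment> \<open>Up to a global sign the operator times \<open>|x|^2\<close> is
    \<open>E^2 + (N - 2 - lam) E - L\<close>, whence this m; the identity turns the energy bound
    into one in A.\<close>
  have am: "a + m = - A" by (simp add: a m_def A field_simps)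
  have sv: "smooth v" by (rule test_fun_smooth[OF v])
  have nL: "test_fun0 (sph v)" and nR: "test_fun0 (rot i j v)" for i j by (intro test_fun0_sph test_fun0_rot v)+
  let ?S = "\<lambda>x. \<Sum>i\<in>UNIV. \<Sum>j\<in>UNIV. rot i j v x * rot i j v x"
  have S: "(\<Sum>i\<in>UNIV. \<Sum>j\<in>UNIV. hardy_prod (rot i j v) (rot i j v)) = hardy_int ?S"
    unfolding hardy_prod_def by (simp add: hardy_int_sum[OF N] tame_sum tame_mult nR)
  have sq: "hardy_prod f f = hardy_int (\<lambda>x. (f x)\<^sup>2)" for f :: "real^'n \<Rightarrow> real"
    by (simp add: hardy_prod_def power2_eq_square)
  have T: "(\<lambda>x. (- ((norm x)\<^sup>2 * laplacian v x) + lam * euler v x)\<^sup>2) =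
     (\<lambda>x. (euler (euler v) x + (m * euler v x + (-1) * sph v x))\<^sup>2)"
    unfolding laplacian_euler_sph[OF sv] m_def by (simp add: power2_eq_square algebra_simps)
  have en: "A\<^sup>2 * hardy_int (\<lambda>x. (euler v x)\<^sup>2) + a * A * hardy_int ?S + hardy_int (\<lambda>x. (sph v x)\<^sup>2)
     \<le> hardy_int (\<lambda>x. (- ((norm x)\<^sup>2 * laplacian v x) + lam * euler v x)\<^sup>2)"
    using hardy_prod_energy[OF N v a, of m, unfolded S] unfolding sq T am by simp
  have "0 \<le> hardy_int (\<lambda>x. (sph v x)\<^sup>2) + a * A * hardy_int ?S + (A\<^sup>2 - C) * hardy_int (\<lambda>x. (euler v x)\<^sup>2)"
  proof (cases "CARD('n) = 4")
    case True
    \<comment> \<open>In dimension 4 the cross term carries the factor \<open>a = 0\<close>, and the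
      other two terms are nonnegative.\<close>
    then show ?thesis using C(1) by (auto intro!: add_nonneg_nonneg mult_nonneg_nonneg hardy_int_nonneg[OF N] simp: a)
  next
    case False
    with C(2) show ?thesis by (intro spherical_form_nonneg[OF N False v a C(1)]) auto
  qed
  with en show ?thesis by (simp add: left_diff_distrib)
qed

lemma test_fun_test_functions:
  assumes "v \<in> test_functions"
  shows "test_fun v"
proof -
  have "bounded (support_on UNIV v)"
    using assms compact_imp_bounded bounded_subset[OF _ closure_subset] by (auto simp: test_functions_def)
  then obtain R where "\<And>x. x \<in> support_on UNIV v \<Longrightarrow> norm x \<le> R" by (auto simp: bounded_iff)
  then have "norm x > R \<Longrightarrow> v x = 0" for x by (force simp: support_on_def)
  then show ?thesis using assms by (auto simp: test_fun_def smooth_def test_functions_def)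
qed

section \<open>The explicit constant and the eigenvalue conditions\<close>

lemma le_square_if:
  fixes c p :: real
  assumes "c \<ge> 0" "c + 2 * p \<ge> 0"
  shows "p\<^sup>2 \<le> (c + p)\<^sup>2"
  using mult_nonneg_nonneg[OF assms] by (simp add: power2_eq_square algebra_simps)

text \<open>The radicand in \<open>kappa\<close> is \<open>(N - 2)^2 - 8 a A\<close>, the
  discriminant of \<open>k (k + N - 2) + 2 a A\<close>, whose larger root is
  \<open>kappa N lam + 1\<close> when it is real.\<close>

lemma sph_ev_above_kappa:
  assumes "real k \<ge> kappa N lam + 1" "N \<ge> 3" "a = (4 - real N) / 2" "A = lam - real N / 2"
  shows "sph_ev N k + 2 * (a * A) \<ge> 0"
proof -
  have "sqrt (4 * lam * (real N - 4) - (real N)\<^sup>2 + 4 * real N + 4) \<le> 2 * real k + real N - 2"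
    using assms(1) by (simp add: kappa_def field_simps)
  then have "4 * lam * (real N - 4) - (real N)\<^sup>2 + 4 * real N + 4 \<le> (2 * real k + real N - 2)\<^sup>2"
    by (rule sqrt_le_D)
  then show ?thesis unfolding assms sph_ev_def by (simp add: power2_eq_square field_simps)
qed

lemma kappa_le_k0: "kappa N lam \<le> of_int (k0 N lam)"
  by (auto simp: k0_def Nats_def)

text \<open>\<open>lam_exc N k\<close> is the solution of \<open>c_k + a A = 0\<close> for lambda;
  excluding it keeps every term of the inner minimum positive.\<close>

lemma sph_ev_resonance:
  assumes "N \<ge> 3" "N \<noteq> 4" "sph_ev N k + (4 - real N) / 2 * (lam - real N / 2) = 0"
  shows "lam = lam_exc N k"
proof -
  have "real N - 4 \<noteq> 0" using assms(2) by simp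
  then show ?thesis using assms(3) by (simp add: lam_exc_def sph_ev_def field_simps power2_eq_square)
qed

text \<open>One formula for N = 3 and N > 4. Both thresholds for lambda say
  \<open>c_1 + 2 a A >= 0\<close>, with the inequality reversed between the two cases because
  \<open>N - 4\<close> changes sign; the prefactors 4 and \<open>(2 / (N - 4))^2\<close> are both
  \<open>1 / a^2\<close>.\<close>

lemma hardy_rellich_const_eq:
  assumes N: "N \<ge> 3" "N \<noteq> 4" and a: "a = (4 - real N) / 2" and A: "A = lam - real N / 2"
  shows "hardy_rellich_const lam N = (if sph_ev N 1 + 2 * (a * A) \<ge> 0 then A\<^sup>2
    else min (A\<^sup>2) ((1 / a)\<^sup>2 * (MIN k\<in>{1..k0 N lam}. (sph_ev N (nat k) + a * A)\<^sup>2)))"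
    and "\<not> sph_ev N 1 + 2 * (a * A) \<ge> 0 \<Longrightarrow> kappa N lam > 0"
proof -
  have cond: "(sph_ev N 1 + 2 * (a * A) \<ge> 0) \<longleftrightarrow>
     (if N = 3 then lam \<ge> - 1/2 else lam \<le> ((real N)\<^sup>2 - 2 * real N - 2) / (2 * (real N - 4)))"
  proof (cases "N = 3")
    case True
    then show ?thesis by (auto simp: sph_ev_def a A field_simps)
  next
    case False
    then have "real N - 4 > 0" using N by simp
    then show ?thesis using False
      by (simp add: sph_ev_def a A field_simps power2_eq_square, intro iffI; linarith)
  qed
  have A2: "A\<^sup>2 = (real N / 2 - lam)\<^sup>2" by (simp add: A power2_commute)
  have im: "(\<lambda>k. (of_int (k * (k + int N - 2)) + (real N - 4) / 2 * (real N / 2 - lam))\<^sup>2) ` {1..k0 N lam}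
     = (\<lambda>k. (sph_ev N (nat k) + a * A)\<^sup>2) ` {1..k0 N lam}"
  proof (rule image_cong[OF refl])
    fix k assume "k \<in> {1..k0 N lam}"
    then have "real (nat k) = of_int k" by simp
    moreover have "(real N - 4) / 2 * (real N / 2 - lam) = a * A" by (simp add: a A field_simps)
    ultimately show "(of_int (k * (k + int N - 2)) + (real N - 4) / 2 * (real N / 2 - lam))\<^sup>2 = (sph_ev N (nat k) + a * A)\<^sup>2"
      by (simp add: sph_ev_def)
  qed
  have a2: "(2 / (real N - 4))\<^sup>2 = (1 / a)\<^sup>2"
    by (simp add: a power_divide) (simp add: power2_commute)
  show "hardy_rellich_const lam N = (if sph_ev N 1 + 2 * (a * A) \<ge> 0 then A\<^sup>2
    else min (A\<^sup>2) ((1 / a)\<^sup>2 * (MIN k\<in>{1..k0 N lam}. (sph_ev N (nat k) + a * A)\<^sup>2)))"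
  proof (cases "N = 3")
    case True
    have im3: "(\<lambda>k. (of_int (k * (k + 1)) + 1 / 2 * (lam - 3 / 2))\<^sup>2) ` {1..k0 3 lam}
      = (\<lambda>k. (sph_ev N (nat k) + a * A)\<^sup>2) ` {1..k0 N lam}"
      unfolding im[symmetric] by (rule image_cong) (simp_all add: True algebra_simps)
    have "(1 / a)\<^sup>2 = 4" by (simp add: a True)
    then show ?thesis unfolding cond hardy_rellich_const_def im3 using True by (simp add: A)
  next
    case False
    then show ?thesis using N(2) unfolding cond hardy_rellich_const_def A2 a2 im by simp
  qed
  show "\<not> sph_ev N 1 + 2 * (a * A) \<ge> 0 \<Longrightarrow> kappa N lam > 0"
    unfolding cond using N by (intro kappa_pos) (auto split: if_splits)
qed

text \<open>The eigenvalue conditions fall into three ranges: k = 0 is \<open>C <= A^2\<close>; for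
  k from 1 to \<open>k0\<close> the inner minimum was built for them; beyond \<open>k0\<close> the
  bound follows from \<open>c_k + 2 a A >= 0\<close>. If already \<open>c_1 + 2 a A >= 0\<close>,
  the middle range is empty by monotonicity.\<close>

lemma hardy_rellich_const_props:
  assumes N: "N \<ge> 3" and ne: "lam \<noteq> real N / 2" and exc: "N \<noteq> 4 \<Longrightarrow> \<forall>n\<ge>1. lam \<noteq> lam_exc N n"
    and a: "a = (4 - real N) / 2" and A: "A = lam - real N / 2"
  shows "hardy_rellich_const lam N > 0" "hardy_rellich_const lam N \<le> A\<^sup>2"
    "N = 4 \<or> (\<forall>k. hardy_rellich_const lam N * a\<^sup>2 \<le> (sph_ev N k + a * A)\<^sup>2)"
proof -
  have A0: "A \<noteq> 0" using ne by (simp add: A)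
  have *: "hardy_rellich_const lam N > 0 \<and> hardy_rellich_const lam N \<le> A\<^sup>2 \<and>
    (N = 4 \<or> (\<forall>k. hardy_rellich_const lam N * a\<^sup>2 \<le> (sph_ev N k + a * A)\<^sup>2))"
  proof (cases "N = 4")
    case True
    have "hardy_rellich_const lam N = A\<^sup>2"
      using True by (simp add: hardy_rellich_const_def A power2_commute)
    then show ?thesis using A0 True by simp
  next
    case False
    note eq = hardy_rellich_const_eq[OF N False a A]
    have a0: "a \<noteq> 0" using False by (simp add: a)
    have ev0: "sph_ev N k \<ge> 0" for k using N by (simp add: sph_ev_def)
    have evm: "sph_ev N 1 \<le> sph_ev N k" if "k \<ge> 1" for k
      using sph_ev_less[OF N, of 1 k] that by (cases "k = 1") auto
    show ?thesis
    proof (cases "sph_ev N 1 + 2 * (a * A) \<ge> 0")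
      case True
      have "A\<^sup>2 * a\<^sup>2 \<le> (sph_ev N k + a * A)\<^sup>2" for k
      proof (cases "k = 0")
        case True
        then show ?thesis by (simp add: sph_ev_def power_mult_distrib mult.commute)
      next
        case False
        then have "sph_ev N k + 2 * (a * A) \<ge> 0" using evm[of k] True by simp
        from le_square_if[OF ev0 this] show ?thesis by (simp add: power_mult_distrib mult.commute)
      qed
      then show ?thesis using eq(1) True A0 by simp
    next
      case F: False
      let ?g = "\<lambda>k. (sph_ev N (nat k) + a * A)\<^sup>2"
      let ?M = "MIN k\<in>{1..k0 N lam}. ?g k"
      have C: "hardy_rellich_const lam N = min (A\<^sup>2) ((1 / a)\<^sup>2 * ?M)" using eq(1) F by simp
      have k1: "k0 N lam \<ge> 1" using eq(2)[OF F] by (rule k0_ge_1)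
      have "?M \<in> ?g ` {1..k0 N lam}" using k1 by (intro Min_in) auto
      then obtain k where k: "k \<in> {1..k0 N lam}" "?M = ?g k" by auto
      have "sph_ev N (nat k) + a * A \<noteq> 0"
      proof
        assume "sph_ev N (nat k) + a * A = 0"
        then have "lam = lam_exc N (nat k)" using sph_ev_resonance[OF N False] by (simp add: a A)
        moreover have "k \<ge> 1" using k(1) by simp
        then have "nat k \<ge> 1" by linarith
        ultimately show False using exc[OF False] by blast
      qed
      then have Mpos: "?M > 0" unfolding k(2) by simp
      have pos: "hardy_rellich_const lam N > 0" unfolding C using Mpos A0 a0 by simp
      have le: "hardy_rellich_const lam N * a\<^sup>2 \<le> (sph_ev N k + a * A)\<^sup>2" for k
      proof -
        have CA: "hardy_rellich_const lam N * a\<^sup>2 \<le> A\<^sup>2 * a\<^sup>2"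
          unfolding C by (intro mult_right_mono) auto
        have CM: "hardy_rellich_const lam N * a\<^sup>2 \<le> ?M"
        proof -
          have "hardy_rellich_const lam N * a\<^sup>2 \<le> (1 / a)\<^sup>2 * ?M * a\<^sup>2"
            unfolding C by (intro mult_right_mono) auto
          also have "\<dots> = ?M" using a0 by (simp add: power_divide)
          finally show ?thesis .
        qed
        consider "k = 0" | "1 \<le> k" "int k \<le> k0 N lam" | "int k > k0 N lam" by linarith
        then show ?thesis
        proof cases
          case 1
          then show ?thesis using CA by (simp add: sph_ev_def power_mult_distrib mult.commute)
        next
          case 2
          then have "?g (int k) \<in> ?g ` {1..k0 N lam}" by (intro imageI[of "int k" _ ?g]) simp
          then have "?M \<le> ?g (int k)" by (intro Min_le) simp_all
          with CM show ?thesis by simp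
        next
          case 3
          \<comment> \<open>Integrality gives the full unit between k and \<open>k0\<close>, which
            is the offset between \<open>kappa\<close> and the root of the quadratic.\<close>
          then have "of_int (k0 N lam) + 1 \<le> real k" by linarith
          with kappa_le_k0[of N lam] have "kappa N lam + 1 \<le> real k" by linarith
          from le_square_if[OF ev0 sph_ev_above_kappa[OF this N a A]] CA
          show ?thesis by (simp add: power_mult_distrib mult.commute)
        qed
      qed
      show ?thesis using pos le unfolding C by auto
    qed
  qed
  then show "hardy_rellich_const lam N > 0" "hardy_rellich_const lam N \<le> A\<^sup>2"
    "N = 4 \<or> (\<forall>k. hardy_rellich_const lam N * a\<^sup>2 \<le> (sph_ev N k + a * A)\<^sup>2)"
    by auto
qed

theorem theorem1p1:
  fixes lam :: real
  assumes "CARD('n::finite) \<ge> 3"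
    and "lam \<noteq> real CARD('n) / 2"
    and "CARD('n) \<noteq> 4 \<Longrightarrow> (\<forall>n\<ge>1. lam \<noteq> lam_exc CARD('n) n)"
  shows "hardy_rellich_const lam CARD('n) > 0 \<and>
    (\<forall>v \<in> (test_functions :: (real^'n \<Rightarrow> real) set).
      (\<integral>\<^sup>+x. ennreal (\<bar>- laplacian v x + lam * ((x \<bullet> grad v x) / (norm x)\<^sup>2)\<bar>\<^sup>2) \<partial>lborel)
      \<ge> ennreal (hardy_rellich_const lam CARD('n)) *
        (\<integral>\<^sup>+x. ennreal (\<bar>x \<bullet> grad v x\<bar>\<^sup>2 / norm x ^ 4) \<partial>lborel))"
proof (intro conjI ballI)
  let ?C = "hardy_rellich_const lam CARD('n)"
  note C = hardy_rellich_const_props[OF assms refl refl]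
  show "?C > 0" by (rule C(1))
  fix v :: "real^'n \<Rightarrow> real" assume "v \<in> test_functions"
  then have v: "test_fun v" by (rule test_fun_test_functions)
  have sv: "smooth v" by (rule test_fun_smooth[OF v])
  have nE: "test_fun0 (euler v)" by (rule test_fun0_euler[OF v])
  let ?T = "\<lambda>x. - ((norm x)\<^sup>2 * laplacian v x) + lam * euler v x"
  have T: "test_fun0 ?T"
  proof -
    \<comment> \<open>Written through L and E, the operator times \<open>|x|^2\<close> visibly
      vanishes at the origin, so its square is integrable against \<open>|x|^-4\<close>.\<close>
    have "?T = (\<lambda>x. sph v x - euler (euler v) x + (lam + 2 - real CARD('n)) * euler v x)"
      unfolding laplacian_euler_sph[OF sv] by (simp add: fun_eq_iff algebra_simps)
    then show ?thesis
      by (simp only:) (intro test_fun0_add test_fun0_diff test_fun0_cmult test_fun0_sph test_fun0_euler test_fun0_test_fun v)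
  qed
  have main: "?C * hardy_int (\<lambda>x. (euler v x)\<^sup>2) \<le> hardy_int (\<lambda>x. (?T x)\<^sup>2)"
    by (rule hardy_rellich_hardy_int[OF assms(1) v refl refl C(2,3)])
  have nn: "(\<integral>\<^sup>+x. ennreal ((f x)\<^sup>2 / norm x ^ 4) \<partial>lborel) = ennreal (hardy_int (\<lambda>x. (f x)\<^sup>2))"
    if "test_fun0 f" for f :: "real^'n \<Rightarrow> real"
    unfolding hardy_int_def by (rule nn_integral_eq_integral[OF tame_integrable[OF assms(1) tame_sq[OF that]]]) simp
  have "ennreal ?C * (\<integral>\<^sup>+x. ennreal (\<bar>x \<bullet> grad v x\<bar>\<^sup>2 / norm x ^ 4) \<partial>lborel)
      = ennreal (?C * hardy_int (\<lambda>x. (euler v x)\<^sup>2))"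
    unfolding inner_grad power2_abs nn[OF nE] using C(1) by (simp add: ennreal_mult')
  also have "\<dots> \<le> ennreal (hardy_int (\<lambda>x. (?T x)\<^sup>2))" by (rule ennreal_leI[OF main])
  also have "\<dots> = (\<integral>\<^sup>+x. ennreal ((?T x)\<^sup>2 / norm x ^ 4) \<partial>lborel)" by (rule nn[OF T, symmetric])
  \<comment> \<open>Equality holds away from the origin. At \<open>x = 0\<close> the left integrand
    is 0 by division by zero while the right one is the square of the Laplacian, so a pointwise
    inequality avoids an almost-everywhere argument.\<close>
  also have "\<dots> \<le> (\<integral>\<^sup>+x. ennreal (\<bar>- laplacian v x + lam * ((x \<bullet> grad v x) / (norm x)\<^sup>2)\<bar>\<^sup>2) \<partial>lborel)"
  proof (rule nn_integral_mono, rule ennreal_leI)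
    fix x :: "real^'n"
    show "(?T x)\<^sup>2 / norm x ^ 4 \<le> \<bar>- laplacian v x + lam * ((x \<bullet> grad v x) / (norm x)\<^sup>2)\<bar>\<^sup>2"
    proof (cases "x = 0")
      case False
      then have "?T x = (norm x)\<^sup>2 * (- laplacian v x + lam * (euler v x / (norm x)\<^sup>2))"
        by (simp add: algebra_simps)
      then show ?thesis using False by (simp add: inner_grad power_mult_distrib)
    qed simp
  qed
  finally show "(\<integral>\<^sup>+x. ennreal (\<bar>- laplacian v x + lam * ((x \<bullet> grad v x) / (norm x)\<^sup>2)\<bar>\<^sup>2) \<partial>lborel)
      \<ge> ennreal ?C * (\<integral>\<^sup>+x. ennreal (\<bar>x \<bullet> grad v x\<bar>\<^sup>2 / norm x ^ 4) \<partial>lborel)" .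
qed

end
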